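(* Let $N\in\mathbb{N}$, $p\in\{0\}\cup[1,\infty)$ and $\mu,\mu_n\in\mathcal{P}_p(\mathbb{R}^N)$, $n\in\mathbb{N}$. Then $\mu_n\to\mu$ in the $p$-adapted weak topology if and only if $Q^{\mu_n}\to Q^\mu$ in $\|\cdot\|_p$.
   Context: $\lambda$ is Lebesgue measure on $(0,1)$ and $\lambda^N$ the product measure on $(0,1)^N$. For $p\in[1,\infty)$, $|x|_p^p:=\sum_i|x_i|^p$, $\mathcal{P}_p(\mathbb{R}^N)$ is the set of Borel probability measures on $\mathbb{R}^N$ with finite $p$-th moment, and $\|f\|_p=(\int|f|_p^p\,d\lambda^N)^{1/p}$ for $f\in L_p(\lambda^N;\mathbb{R}^N)$. For $p=0$, $\mathcal{P}_0(\mathbb{R}^N)$ is the set of all Borel probability measures and $\|f-g\|_0:=\int(|f-g|\wedge1)\,d\lambda^N$ for measurable $f,g:(0,1)^N\to\mathbb{R}^N$ (convergence in probability). A (measurable) map $T=(T_k)_{k=1}^N:(0,1)^N\to\mathbb{R}^N$ is triangular if each $T_k$ depends only on the first $k$ variables. A triangular $Q=(Q_k)_{k=1}^N:(0,1)^N\to\mathbb{R}^N$ is a quantile process if for all $k\le m\le N$ and $u_1,\dots,u_m,u_k'\in(0,1)$ with $u_k\le u_k'$: (inc) $Q_k(u_1,\dots,u_k)\le Q_k(u_1,\dots,u_{k-1},u_k')$; (con) if $Q_k(u_1,\dots,u_k)=Q_k(u_1,\dots,u_{k-1},u_k')$ then $Q_m(u_1,\dots,u_k,\dots,u_m)=Q_m(u_1,\dots,u_k',\dots,u_m)$.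 For every $\mu\in\mathcal{P}_0(\mathbb{R}^N)$ there is a $\lambda^N$-a.s. unique quantile process $Q^\mu$ with $Q^\mu_\#\lambda^N=\mu$. Explicitly, writing $\mu(dx)=\mu_1(dx_1)\mu_2^{x_1}(dx_2)\cdots\mu_N^{x_1,\dots,x_{N-1}}(dx_N)$ for the successive disintegration, $Q^\mu_k(u_1,\dots,u_k)$ is the value at $u_k$ of the quantile function of $\mu_k^{Q^\mu_1(u_1),\dots,Q^\mu_{k-1}(u_1,\dots,u_{k-1})}$. A coupling $\pi$ of $\mu$ and $\nu$ on $\mathbb{R}^N\times\mathbb{R}^N$ is bicausal, $\pi\in\Pi_{\rm bc}(\mu,\nu)$, if its successive disintegration $\pi=\pi_1(dx_1,dy_1)\,\pi_2^{x_1,y_1}(dx_2,dy_2)\cdots$ satisfies, $\pi$-a.s. and for all $k\le N$, that $\pi_k^{x_1,\dots,x_{k-1},y_1,\dots,y_{k-1}}$ is a coupling of $\mu_k^{x_1,\dots,x_{k-1}}$ and $\nu_k^{y_1,\dots,y_{k-1}}$. The adapted Wasserstein distance is $\mathcal{AW}_p(\mu,\nu):=\inf_{\pi\in\Pi_{\rm bc}(\mu,\nu)}\big(\int|x-y|_p^p\,d\pi\big)^{1/p}$ for $p\ge1$ and $\mathcal{AW}_0(\mu,\nu):=\inf_{\pi\in\Pi_{\rm bc}(\mu,\nu)}\int(|x-y|\wedge1)\,d\pi$. The $p$-adapted weak topology on $\mathcal{P}_p(\mathbb{R}^N)$ is the topology induced by $\mathcal{AW}_p$. *)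

theory Defs
  imports "HOL-Probability.Probability"
begin

text \<open>
  Coordinates are numbered \<open>0, \<dots>, N - 1\<close>. A point of $\mathbb{R}^N$ is an extensional function on
  \<open>{0..<N}\<close>, so that a prefix of a path is its restriction to \<open>{0..<k}\<close> and the composition of
  kernels is the one from the theorem of Ionescu-Tulcea in HOL-Probability.
\<close>

abbreviation RN :: "nat \<Rightarrow> (nat \<Rightarrow> real) measure" where
  "RN N \<equiv> PiM {0..<N} (\<lambda>_. borel)"

abbreviation lambdaN :: "nat \<Rightarrow> (nat \<Rightarrow> real) measure" where
  "lambdaN N \<equiv> PiM {0..<N} (\<lambda>_. restrict_space lborel {0<..<1})"


section \<open>The spaces of measures and the p-costs\<close>

text \<open>
  \<open>|x - y|\<^sub>p\<^sup>p\<close> for \<open>p \<ge> 1\<close>, and \<open>|x - y| \<and> 1\<close> with the Euclidean norm for \<open>p = 0\<close>.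
\<close>

definition cost :: "real \<Rightarrow> nat \<Rightarrow> (nat \<Rightarrow> real) \<Rightarrow> (nat \<Rightarrow> real) \<Rightarrow> real" where
  "cost p N x y =
     (if p = 0 then min (L2_set (\<lambda>i. x i - y i) {0..<N}) 1
      else (\<Sum>i<N. \<bar>x i - y i\<bar> powr p))"

definition p_root :: "real \<Rightarrow> real \<Rightarrow> real" where
  "p_root p c = (if p = 0 then c else c powr (1 / p))"

definition P_space :: "real \<Rightarrow> nat \<Rightarrow> (nat \<Rightarrow> real) measure set" where
  "P_space p N =
     {\<mu>. prob_space \<mu> \<and> sets \<mu> = sets (RN N) \<and>
         (p \<noteq> 0 \<longrightarrow> integrable \<mu> (\<lambda>x. \<Sum>i<N. \<bar>x i\<bar> powr p))}"

text \<open>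
  \<open>\<parallel>f - g\<parallel>\<^sub>p\<close>. The Bochner integral is \<open>0\<close> for non-integrable functions; this convention is never
  used for \<open>f\<close>, \<open>g\<close> in \<open>L\<^sub>p\<close> (for \<open>p = 0\<close>: measurable), hence not for maps whose laws are in
  \<open>P_space p N\<close>.
\<close>

definition Lp_dist ::
  "real \<Rightarrow> nat \<Rightarrow> ((nat \<Rightarrow> real) \<Rightarrow> nat \<Rightarrow> real) \<Rightarrow> ((nat \<Rightarrow> real) \<Rightarrow> nat \<Rightarrow> real) \<Rightarrow> real" where
  "Lp_dist p N f g = p_root p (\<integral>u. cost p N (f u) (g u) \<partial>lambdaN N)"


section \<open>Quantile processes\<close>

definition triangular :: "nat \<Rightarrow> ((nat \<Rightarrow> real) \<Rightarrow> nat \<Rightarrow> real) \<Rightarrow> bool" where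
  "triangular N T \<longleftrightarrow>
     T \<in> measurable (lambdaN N) (RN N) \<and>
     (\<forall>k<N. \<forall>u\<in>space (lambdaN N). \<forall>v\<in>space (lambdaN N).
        (\<forall>i\<le>k. u i = v i) \<longrightarrow> T u k = T v k)"

text \<open>
  By triangularity \<open>Q u m\<close> depends on \<open>u 0, \<dots>, u m\<close> only, so both conditions may be stated for
  full points \<open>u\<close> of the cube.
\<close>

definition quantile_process :: "nat \<Rightarrow> ((nat \<Rightarrow> real) \<Rightarrow> nat \<Rightarrow> real) \<Rightarrow> bool" where
  "quantile_process N Q \<longleftrightarrow>
     triangular N Q \<and>
     (\<forall>k<N. \<forall>u\<in>space (lambdaN N). \<forall>t\<in>{0<..<1}. u k \<le> t \<longrightarrow>
        Q u k \<le> Q (u(k := t)) k \<and>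
        (Q u k = Q (u(k := t)) k \<longrightarrow> (\<forall>m\<in>{k..<N}. Q u m = Q (u(k := t)) m)))"

text \<open>
  The quantile process with law \<open>\<mu>\<close> exists and is almost surely unique, so the choice among
  its versions is immaterial.
\<close>

definition Qproc :: "nat \<Rightarrow> (nat \<Rightarrow> real) measure \<Rightarrow> (nat \<Rightarrow> real) \<Rightarrow> nat \<Rightarrow> real" where
  "Qproc N \<mu> = (SOME Q. quantile_process N Q \<and> distr (lambdaN N) (RN N) Q = \<mu>)"


section \<open>Bicausal couplings and the adapted Wasserstein distance\<close>

definition coupling :: "'a measure \<Rightarrow> 'b measure \<Rightarrow> ('a \<times> 'b) measure \<Rightarrow> bool" where
  "coupling \<mu> \<nu> \<pi> \<longleftrightarrow>
     sets \<pi> = sets (\<mu> \<Otimes>\<^sub>M \<nu>) \<and> distr \<pi> \<mu> fst = \<mu> \<and> distr \<pi> \<nu> snd = \<nu>"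

text \<open>
  \<open>disintegration M N \<mu> K\<close>: \<open>\<mu>\<close>, a measure on sequences of length \<open>N\<close> in \<open>M\<close>, equals
  \<open>K 0 (dx\<^sub>0) K 1 x\<^sub>0 (dx\<^sub>1) \<dots> K (N - 1) (x\<^sub>0, \<dots>, x\<^bsub>N - 2\<^esub>) (dx\<^bsub>N - 1\<^esub>)\<close>.
  The locale predicate says that each \<open>K k\<close> is a probability kernel from \<open>{0..<k}\<close>-indexed
  sequences to \<open>M\<close> (the kernels with \<open>k \<ge> N\<close> play no role), and \<open>C K _ 0 N\<close> composes the
  first \<open>N\<close> of them, starting from the empty sequence.
\<close>

definition disintegration ::
  "'a measure \<Rightarrow> nat \<Rightarrow> (nat \<Rightarrow> 'a) measure \<Rightarrow> (nat \<Rightarrow> (nat \<Rightarrow> 'a) \<Rightarrow> 'a measure) \<Rightarrow> bool" where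
  "disintegration M N \<mu> K \<longleftrightarrow>
     Ionescu_Tulcea K (\<lambda>_. M) \<and>
     Ionescu_Tulcea.C K (\<lambda>_. M) 0 N (\<lambda>_. undefined) = \<mu>"

definition zip_upto :: "nat \<Rightarrow> (nat \<Rightarrow> 'a) \<times> (nat \<Rightarrow> 'b) \<Rightarrow> nat \<Rightarrow> 'a \<times> 'b" where
  "zip_upto k z = (\<lambda>i\<in>{0..<k}. (fst z i, snd z i))"

text \<open>
  The disintegration of \<open>\<pi>\<close> is that of its image under the identification of
  $\mathbb{R}^N \times \mathbb{R}^N$ with $(\mathbb{R} \times \mathbb{R})^N$. Disintegrations exist and
  are almost surely unique, so it does not matter which versions \<open>K\<close>, \<open>A\<close>, \<open>B\<close> are taken.
\<close>

definition bicausal ::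
  "nat \<Rightarrow> (nat \<Rightarrow> real) measure \<Rightarrow> (nat \<Rightarrow> real) measure \<Rightarrow>
    ((nat \<Rightarrow> real) \<times> (nat \<Rightarrow> real)) measure set" where
  "bicausal N \<mu> \<nu> =
     {\<pi>. coupling \<mu> \<nu> \<pi> \<and>
        (\<exists>K A B.
           disintegration (borel \<Otimes>\<^sub>M borel) N
             (distr \<pi> (PiM {0..<N} (\<lambda>_. borel \<Otimes>\<^sub>M borel)) (zip_upto N)) K \<and>
           disintegration borel N \<mu> A \<and>
           disintegration borel N \<nu> B \<and>
           (AE z in \<pi>. \<forall>k<N.
              coupling (A k (restrict (fst z) {0..<k})) (B k (restrict (snd z) {0..<k}))
                (K k (zip_upto k z))))}"

text \<open>
  For \<open>\<mu>\<close>, \<open>\<nu>\<close> in \<open>P_space p N\<close> the cost is integrable under every coupling, and the infimum is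
  over a nonempty set (the product measure is bicausal) of nonnegative numbers.
\<close>

definition AW :: "real \<Rightarrow> nat \<Rightarrow> (nat \<Rightarrow> real) measure \<Rightarrow> (nat \<Rightarrow> real) measure \<Rightarrow> real" where
  "AW p N \<mu> \<nu> =
     (INF \<pi>\<in>bicausal N \<mu> \<nu>. p_root p (\<integral>z. cost p N (fst z) (snd z) \<partial>\<pi>))"

text \<open>
  The open sets are those containing an \<open>AW\<close>-ball around each of their points. This is
  \<open>Metric_space.mtopology\<close> written out; the locale itself does not fit because it constrains the
  distance outside the carrier too, where \<open>AW\<close> may be an infimum over the empty set.
\<close>

definition adapted_weak_topology :: "real \<Rightarrow> nat \<Rightarrow> (nat \<Rightarrow> real) measure topology" where
  "adapted_weak_topology p N =
     topology (\<lambda>U. U \<subseteq> P_space p N \<and>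
       (\<forall>\<mu>\<in>U. \<exists>r>0. {\<nu> \<in> P_space p N. AW p N \<mu> \<nu> < r} \<subseteq> U))"

end

theory Submission
  imports Defs
begin

text \<open>
  By (con), the value \<open>Q u k\<close> is a measurable function of the past \<open>Q u 0, \<dots>, Q u (k - 1)\<close> and
  of \<open>u k\<close>, so the law of \<open>(Q\<^sup>\<mu>, Q\<^sup>\<nu>)\<close> is bicausal and \<open>AW\<close> is at most the \<open>L\<^sub>p\<close> distance of the
  quantile processes. Conversely, let \<open>\<pi>\<^sub>n\<close> be bicausal couplings of \<open>\<mu>\<close> and \<open>\<mu>\<^sub>n\<close> with vanishing cost.
  Bicausality makes the conditional means of a Lipschitz function of the next coordinate close
  under \<open>\<pi>\<^sub>n\<close>. If the pasts of the quantile processes are already close, approximating the kernel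
  of \<open>\<mu>\<close> by a Lipschitz function of the past (Lusin) carries this over to the quantile coupling,
  and for the comonotone next coordinates close conditional laws mean close values. Induction on
  the coordinate gives convergence in probability, and the \<open>L\<^sub>p\<close>-close couplings \<open>\<pi>\<^sub>n\<close> provide
  the uniform integrability. Balls for the \<open>L\<^sub>p\<close> distance of quantile processes, which satisfies the
  triangle inequality, are thus open, and no triangle inequality for \<open>AW\<close> is needed.
\<close>

section \<open>Paths driven by independent noise\<close>

text \<open>Two objects are given only up to choice: \<open>Qproc\<close> is some quantile process
  with the right law, and \<open>bicausal\<close> grants some versions of the kernels. Composition
  of kernels is therefore expressed throughout by a recursion driven by independent uniform noise. A
  disintegration then becomes an identity between paths, and the same device serves for one quantile
  process, for a pair of them fed with the same noise, and for building a process from a given law.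
  The kernels granted by \<open>bicausal\<close> are compared with these only through the integral
  of one bounded test function at a time, where uniqueness of densities settles the matter.

  The obstacle in the converse direction is that the kernels of the approximating laws are merely
  measurable, without a common modulus of continuity. So only the kernel of the fixed limit is
  approximated, and its Lipschitz constant is fixed before the index tends to infinity. The
  resulting comparison is not quantitative: it holds along sequences and yields a radius that
  depends on the centre. Openness of a set is a condition at each point separately, so such radii
  are enough.\<close>

abbreviation lambda1 :: "real measure" where
  "lambda1 \<equiv> restrict_space lborel {0<..<1}"

abbreviation paths :: "nat \<Rightarrow> 'a measure \<Rightarrow> (nat \<Rightarrow> 'a) measure" where
  "paths k M \<equiv> PiM {0..<k} (\<lambda>_. M)"

abbreviation past :: "nat \<Rightarrow> (nat \<Rightarrow> 'a) \<Rightarrow> nat \<Rightarrow> 'a" where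
  "past k x \<equiv> restrict x {0..<k}"

lemma space_lambda1: "space lambda1 = {0<..<1}"
  by (simp add: space_restrict_space)

interpretation lambda1: prob_space lambda1
  by (rule prob_spaceI) (simp add: space_restrict_space emeasure_restrict_space)

interpretation lN: prob_space "lambdaN N" for N
  by (intro prob_space_PiM lambda1.prob_space_axioms)

lemma space_lambdaN: "u \<in> space (lambdaN N) \<longleftrightarrow> u \<in> extensional {0..<N} \<and> (\<forall>i<N. u i \<in> {0<..<1})"
  by (auto simp: space_PiM PiE_iff space_lambda1)

lemma fun_upd_in_lambdaN:
  "u \<in> space (lambdaN N) \<Longrightarrow> k < N \<Longrightarrow> t \<in> {0<..<1} \<Longrightarrow> u(k := t) \<in> space (lambdaN N)"
  by (auto simp: space_lambdaN extensional_def)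

lemma measurable_fun_upd_lambdaN [measurable (raw)]:
  assumes "f \<in> measurable L (lambdaN N)" "g \<in> measurable L lambda1" "k < N"
  shows "(\<lambda>w. (f w)(k := g w)) \<in> measurable L (lambdaN N)"
  using assms by (intro measurable_fun_upd[where J="{0..<N}"]) auto

lemma measurable_component_lambdaN [measurable (raw)]:
  "f \<in> measurable L (lambdaN N) \<Longrightarrow> k < N \<Longrightarrow> (\<lambda>w. f w k) \<in> measurable L lambda1"
  by (rule measurable_compose[where N="lambdaN N"]) (auto intro!: measurable_component_singleton)

text \<open>Both sides reduce to an integral over the coordinates other than \<open>k\<close>, since
  on the right the value \<open>s\<close> is overwritten. Conditional expectations given the
  remaining noise can thus be written as plain inner integrals over \<open>t\<close>.\<close>

lemma nn_integral_lambdaN_resample: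
  assumes f: "f \<in> borel_measurable (lambdaN N)" and k: "k < N"
  shows "(\<integral>\<^sup>+u. f u \<partial>lambdaN N) = (\<integral>\<^sup>+u. \<integral>\<^sup>+t. f (u(k := t)) \<partial>lambda1 \<partial>lambdaN N)"
proof -
  interpret lambdaN: product_sigma_finite "\<lambda>_::nat. lambda1"
    by (simp add: product_sigma_finite_def lambda1.prob_space_axioms prob_space_imp_sigma_finite)
  define I where "I = {0..<N} - {k}"
  have I: "finite I" "k \<notin> I" "{0..<N} = insert k I"
    using k by (auto simp: I_def)
  have f2: "(\<lambda>u. \<integral>\<^sup>+t. f (u(k := t)) \<partial>lambda1) \<in> borel_measurable (lambdaN N)"
    using f k by measurable
  have "(\<integral>\<^sup>+u. \<integral>\<^sup>+t. f (u(k := t)) \<partial>lambda1 \<partial>lambdaN N)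
    = (\<integral>\<^sup>+x. \<integral>\<^sup>+s. \<integral>\<^sup>+t. f ((x(k := s))(k := t)) \<partial>lambda1 \<partial>lambda1 \<partial>PiM I (\<lambda>_. lambda1))"
    using f2 unfolding I(3) by (rule lambdaN.product_nn_integral_insert[OF I(1,2)])
  also have "\<dots> = (\<integral>\<^sup>+x. \<integral>\<^sup>+t. f (x(k := t)) \<partial>lambda1 \<partial>PiM I (\<lambda>_. lambda1))"
    using lambda1.emeasure_space_1 by (simp add: space_lambda1)
  also have "\<dots> = (\<integral>\<^sup>+u. f u \<partial>lambdaN N)"
    using f unfolding I(3) by (rule lambdaN.product_nn_integral_insert[OF I(1,2), symmetric])
  finally show ?thesis ..
qed

text \<open>
  \<open>z k x t\<close> is the next value after the past \<open>x\<close> of length \<open>k\<close>, driven by the noise \<open>t\<close>.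
\<close>

primrec noise_path ::
  "(nat \<Rightarrow> (nat \<Rightarrow> 'a) \<Rightarrow> real \<Rightarrow> 'a) \<Rightarrow> nat \<Rightarrow> (nat \<Rightarrow> real) \<Rightarrow> nat \<Rightarrow> 'a" where
  "noise_path z 0 u = (\<lambda>_. undefined)"
| "noise_path z (Suc k) u = (noise_path z k u)(k := z k (noise_path z k u) (u k))"

lemma noise_path_cong: "(\<And>i. i < k \<Longrightarrow> u i = v i) \<Longrightarrow> noise_path z k u = noise_path z k v"
  by (induction k) auto

lemma noise_path_prefix: "i < k \<Longrightarrow> k \<le> n \<Longrightarrow> noise_path z n u i = noise_path z k u i"
  by (induction n) (auto simp: le_Suc_eq)

lemma noise_path_nth:
  "k < n \<Longrightarrow> noise_path z n u k = z k (noise_path z k u) (u k)"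
  using noise_path_prefix[of k "Suc k" n z u] by simp

text \<open>Uniqueness of the solution of the recursion. It serves to recognise a given map, such as
  a quantile process or a pair of them, as a noise path.\<close>

lemma noise_path_eqI:
  assumes Z: "\<And>k. k < N \<Longrightarrow> Z k = z k (past k Z) (u k)"
    and ext: "Z \<in> extensional {0..<N}"
  shows "noise_path z N u = Z"
proof -
  have "k \<le> N \<Longrightarrow> noise_path z k u = past k Z" for k
  proof (induction k)
    case (Suc k)
    have "noise_path z (Suc k) u = (past k Z)(k := Z k)"
      using Suc.prems Suc.IH Z[of k] by (simp only: noise_path.simps Suc_le_eq less_imp_le)
    also have "\<dots> = restrict Z {0..<Suc k}"
      by (auto simp: fun_eq_iff less_Suc_eq)
    finally show ?case .
  qed auto
  from this[of N] ext show ?thesis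
    by (simp add: extensional_restrict)
qed

lemma measurable_noise_path:
  assumes z: "\<And>k. case_prod (z k) \<in> measurable (paths k M \<Otimes>\<^sub>M lambda1) M"
  shows "k \<le> N \<Longrightarrow> noise_path z k \<in> measurable (lambdaN N) (paths k M)"
proof (induction k)
  case 0
  then show ?case by (simp add: space_PiM_empty)
next
  case (Suc k)
  have IH[measurable]: "noise_path z k \<in> measurable (lambdaN N) (paths k M)"
    using Suc by simp
  have kN[measurable]: "k < N" using Suc by simp
  have "(\<lambda>u. z k (noise_path z k u) (u k)) \<in> measurable (lambdaN N) M"
    using measurable_compose[OF _ z[of k], of "\<lambda>u. (noise_path z k u, u k)" "lambdaN N"] by simp
  then have "(\<lambda>u. (noise_path z k u)(k := z k (noise_path z k u) (u k)))
      \<in> measurable (lambdaN N) (paths (Suc k) M)"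
    by (intro measurable_fun_upd[where J="{0..<k}"]) auto
  then show ?case
    by (subst measurable_cong) (rule noise_path.simps(2))
qed

lemma Ionescu_Tulcea_noise:
  assumes z: "\<And>k. case_prod (z k) \<in> measurable (paths k M \<Otimes>\<^sub>M lambda1) M"
  shows "Ionescu_Tulcea (\<lambda>k x. distr lambda1 M (z k x)) (\<lambda>_. M)"
proof (rule Ionescu_Tulcea.intro)
  fix i
  show "(\<lambda>x. distr lambda1 M (z i x)) \<in> measurable (paths i M) (subprob_algebra M)"
    by (rule measurable_distr2[OF z])
      (simp add: space_subprob_algebra lambda1.subprob_space_axioms)
next
  fix i :: nat and x assume "x \<in> space (paths i M)"
  from measurable_compose_Pair1[OF this z] show "prob_space (distr lambda1 M (z i x))"
    by (intro lambda1.prob_space_distr) simp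
qed

text \<open>The path \<open>noise_path z k u\<close> does not see \<open>u k\<close>, so
  \<open>u k\<close> may be resampled; the inner integral over the fresh noise is then the one-step
  kernel \<open>IT.eP k\<close> at that path. All lengths \<open>k\<close> are realised on one cube
  of dimension \<open>N\<close>, so the induction stays on a single probability space.\<close>

lemma C_noise:
  assumes z: "\<And>k. case_prod (z k) \<in> measurable (paths k M \<Otimes>\<^sub>M lambda1) M"
  shows "k \<le> N \<Longrightarrow> Ionescu_Tulcea.C (\<lambda>k x. distr lambda1 M (z k x)) (\<lambda>_. M) 0 k (\<lambda>_. undefined)
    = distr (lambdaN N) (paths k M) (noise_path z k)"
proof (induction k)
  interpret IT: Ionescu_Tulcea "\<lambda>k x. distr lambda1 M (z k x)" "\<lambda>_. M"
    by (rule Ionescu_Tulcea_noise[OF z])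
  case 0
  show ?case
    by (intro measure_eqI) (auto simp: space_PiM_empty PiM_empty sets_PiM_empty emeasure_distr
        lN.emeasure_space_1 split: split_indicator)
next
  interpret IT: Ionescu_Tulcea "\<lambda>k x. distr lambda1 M (z k x)" "\<lambda>_. M"
    by (rule Ionescu_Tulcea_noise[OF z])
  case (Suc k)
  let ?n = "noise_path z k" and ?n' = "noise_path z (Suc k)" and ?Z = "paths (Suc k) M"
  let ?D = "distr (lambdaN N) (paths k M) ?n" and ?D' = "distr (lambdaN N) ?Z ?n'"
  note np = measurable_noise_path[OF z]
  have k[measurable]: "k < N" using Suc by simp
  have np1[measurable]: "?n \<in> measurable (lambdaN N) (paths k M)"
    using k by (intro np) simp
  have np2[measurable]: "?n' \<in> measurable (lambdaN N) (?Z)"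
    using k by (intro np) simp
  have IH: "IT.C 0 k (\<lambda>_. undefined) = ?D"
    using Suc by simp
  have "IT.C 0 (Suc k) (\<lambda>_. undefined) = ?D \<bind> IT.eP k"
    by (simp add: IH)
  also have "\<dots> = ?D'"
  proof (rule measure_eqI)
    show "sets (?D \<bind> IT.eP k) =
      sets (?D')"
      by (subst sets_bind[where N="?Z"]) (auto simp: IT.sets_eP lN.not_empty)
    fix X assume "X \<in> sets (?D \<bind> IT.eP k)"
    then have X[measurable]: "X \<in> sets ?Z"
      by (subst (asm) sets_bind[where N="?Z"]) (auto simp: IT.sets_eP lN.not_empty)
    have "emeasure (?D \<bind> IT.eP k) X
      = (\<integral>\<^sup>+u. emeasure (IT.eP k (?n u)) X \<partial>lambdaN N)"
      by (subst emeasure_bind[where N="?Z"]) (auto simp: nn_integral_distr lN.not_empty)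
    also have "\<dots> = (\<integral>\<^sup>+u. \<integral>\<^sup>+t. indicator X (?n' (u(k := t))) \<partial>lambda1 \<partial>lambdaN N)"
    proof (rule nn_integral_cong)
      fix u assume u: "u \<in> space (lambdaN N)"
      have x: "?n u \<in> space (paths k M)"
        using measurable_space[OF np1 u] .
      have zx: "z k (?n u) \<in> measurable lambda1 M"
        using measurable_compose_Pair1[OF x z] by simp
      have "emeasure (IT.eP k (?n u)) X = (\<integral>\<^sup>+y. indicator X y \<partial>IT.eP k (?n u))"
        using x by (simp add: IT.sets_eP)
      also have "\<dots> = (\<integral>\<^sup>+y. indicator X ((?n u)(k := y)) \<partial>distr lambda1 M (z k (?n u)))"
        by (rule IT.nn_integral_eP[OF x]) simp
      also have "\<dots> = (\<integral>\<^sup>+t. indicator X ((?n u)(k := z k (?n u) t)) \<partial>lambda1)"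
        using x by (intro nn_integral_distr zx measurable_compose[OF _ borel_measurable_indicator[OF X]] measurable_fun_upd[where J="{0..<k}"]) auto
      also have "\<dots> = (\<integral>\<^sup>+t. indicator X (?n' (u(k := t))) \<partial>lambda1)"
        using noise_path_cong[of k "u(k := t)" u z for t] by (intro nn_integral_cong) simp
      finally show "emeasure (IT.eP k (?n u)) X = (\<integral>\<^sup>+t. indicator X (?n' (u(k := t))) \<partial>lambda1)" .
    qed
    also have "\<dots> = (\<integral>\<^sup>+u. indicator X (?n' u) \<partial>lambdaN N)"
      using k by (intro nn_integral_lambdaN_resample[symmetric] measurable_compose[OF np2]) auto
    also have "\<dots> = emeasure (?D') X"
      by (subst nn_integral_distr[symmetric, OF np2]) auto
    finally show "emeasure (?D \<bind> IT.eP k) X =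
      emeasure (?D') X" .
  qed
  finally show ?case .
qed

lemma disintegration_noise:
  assumes z: "\<And>k. case_prod (z k) \<in> measurable (paths k M \<Otimes>\<^sub>M lambda1) M"
  shows "disintegration M N (distr (lambdaN N) (paths N M) (noise_path z N))
    (\<lambda>k x. distr lambda1 M (z k x))"
  unfolding disintegration_def using Ionescu_Tulcea_noise[OF z] C_noise[OF z, of N N] by simp

text \<open>The tower property. An integrand in the first \<open>Suc k\<close> coordinates sees only
  the composition of the first \<open>Suc k\<close> kernels, and the last of these is
  \<open>K k\<close>.\<close>

lemma nn_integral_disintegration:
  assumes D: "disintegration M N \<mu> K" and k: "k < N"
    and h[measurable]: "h \<in> borel_measurable (paths k M \<Otimes>\<^sub>M M)"
  shows "(\<integral>\<^sup>+x. h (past k x, x k) \<partial>\<mu>)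
    = (\<integral>\<^sup>+x. \<integral>\<^sup>+w. h (past k x, w) \<partial>K k (past k x) \<partial>\<mu>)"
proof -
  interpret IT: Ionescu_Tulcea K "\<lambda>_. M"
    using D by (simp add: disintegration_def)
  have mu: "\<mu> = IT.C 0 N (\<lambda>_. undefined)"
    using D by (simp add: disintegration_def)
  have u: "(\<lambda>_. undefined) \<in> space (paths 0 M)" by (simp add: space_PiM_empty)
  note [simp] = u[simplified]
  note n = IT.nn_integral_C[OF _ _ _ u, simplified]
  have f1: "(\<lambda>x. h (past k x, x k)) \<in> borel_measurable (paths (Suc k) M)"
    by (rule measurable_compose[OF _ h]) (auto intro!: measurable_Pair measurable_restrict_subset)
  have f2: "(\<lambda>x. \<integral>\<^sup>+w. h (x, w) \<partial>K k x) \<in> borel_measurable (paths k M)"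
    by (rule nn_integral_measurable_subprob_algebra2[OF _ IT.P]) simp
  have "(\<integral>\<^sup>+x. h (past k x, x k) \<partial>\<mu>)
      = (\<integral>\<^sup>+x. h (past k x, x k) \<partial>IT.C 0 (Suc k) (\<lambda>_. undefined))"
    unfolding mu using n[of "Suc k" N, OF _ f1] k by (simp add: min_absorb2 Suc_leI cong: nn_integral_cong)
  also have "\<dots> = (\<integral>\<^sup>+x. \<integral>\<^sup>+y. h (past k y, y k) \<partial>IT.eP k x \<partial>IT.C 0 k (\<lambda>_. undefined))"
    using f1 by (simp, subst nn_integral_bind[where B="paths (Suc k) M"])
      (auto simp: IT.sets_C measurable_cong_sets[OF IT.sets_C refl])
  also have "\<dots> = (\<integral>\<^sup>+x. \<integral>\<^sup>+w. h (x, w) \<partial>K k x \<partial>IT.C 0 k (\<lambda>_. undefined))"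
  proof (rule nn_integral_cong)
    fix x assume "x \<in> space (IT.C 0 k (\<lambda>_. undefined))"
    then have x: "x \<in> space (paths k M)" by (simp add: IT.space_C)
    then have "past k (x(k := w)) = x" for w
      by (auto simp: space_PiM restrict_def fun_eq_iff PiE_iff extensional_def)
    then show "(\<integral>\<^sup>+y. h (past k y, y k) \<partial>IT.eP k x) = (\<integral>\<^sup>+w. h (x, w) \<partial>K k x)"
      by (subst IT.nn_integral_eP[OF x f1]) simp
  qed
  also have "\<dots> = (\<integral>\<^sup>+x. \<integral>\<^sup>+w. h (past k x, w) \<partial>K k (past k x) \<partial>\<mu>)"
    unfolding mu using n[of k N, OF _ f2] k by simp
  finally show ?thesis .
qed

section \<open>Quantile processes as noise-driven paths\<close>

lemma measure_lambda1_Ioo: "0 \<le> x \<Longrightarrow> x \<le> 1 \<Longrightarrow> measure lambda1 {0<..<x} = x"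
  by (subst measure_restrict_space) auto

lemma measure_lambda1_Ioc: "0 \<le> x \<Longrightarrow> x < 1 \<Longrightarrow> measure lambda1 {0<..x} = x"
  by (subst measure_restrict_space) auto

lemma sets_lambda1: "A \<in> sets borel \<Longrightarrow> A \<subseteq> {0<..<1} \<Longrightarrow> A \<in> sets lambda1"
  by (simp add: sets_restrict_space_iff)

text \<open>The numbers \<alpha> and \<beta> are the end points of the level interval of
  \<open>\<phi> s0\<close>, written as measures so that they stay measurable when \<phi> carries
  parameters. End points may miss the level set or lie at \<open>0\<close> or \<open>1\<close>; the
  midpoint of a proper interval does neither, and if \<alpha> = \<beta> it is \<open>s0\<close>
  itself.\<close>

lemma level_midpoint:
  fixes \<phi> :: "real \<Rightarrow> real"
  assumes [measurable]: "\<phi> \<in> borel_measurable lambda1"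
    and mono: "\<And>s t. 0 < s \<Longrightarrow> s \<le> t \<Longrightarrow> t < 1 \<Longrightarrow> \<phi> s \<le> \<phi> t"
    and s0: "0 < s0" "s0 < 1"
  defines "\<alpha> \<equiv> measure lambda1 {t\<in>{0<..<1}. \<phi> t < \<phi> s0}"
    and "\<beta> \<equiv> measure lambda1 {t\<in>{0<..<1}. \<phi> t \<le> \<phi> s0}"
  shows "0 < (\<alpha> + \<beta>) / 2" "(\<alpha> + \<beta>) / 2 < 1" "\<phi> ((\<alpha> + \<beta>) / 2) = \<phi> s0"
proof -
  have "{t\<in>space lambda1. \<phi> t < \<phi> s0} \<in> sets lambda1"
    "{t\<in>space lambda1. \<phi> t \<le> \<phi> s0} \<in> sets lambda1"
    by measurable
  then have m1: "{t\<in>{0<..<1}. \<phi> t < \<phi> s0} \<in> sets lambda1"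
    and m2: "{t\<in>{0<..<1}. \<phi> t \<le> \<phi> s0} \<in> sets lambda1"
    unfolding space_lambda1 by blast+
  have "\<alpha> \<le> measure lambda1 {0<..<s0}"
    unfolding \<alpha>_def using mono s0
    by (intro lambda1.finite_measure_mono sets_lambda1) (auto simp: not_le[symmetric])
  then have a: "\<alpha> \<le> s0" using s0 by (simp add: measure_lambda1_Ioo)
  have "measure lambda1 {0<..s0} \<le> \<beta>"
    unfolding \<beta>_def using mono s0 by (intro lambda1.finite_measure_mono m2) auto
  then have b: "s0 \<le> \<beta>" using s0 by (simp add: measure_lambda1_Ioc)
  have a0: "0 \<le> \<alpha>" and b1: "\<beta> \<le> 1"
    by (auto simp: \<alpha>_def \<beta>_def lambda1.prob_le_1)
  define s where "s = (\<alpha> + \<beta>) / 2"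
  have s: "0 < s" "s < 1" using a b a0 b1 s0 by (auto simp: s_def)
  have "\<phi> s = \<phi> s0"
  proof (cases "\<alpha> = \<beta>")
    case True
    then have "s = s0" using a b by (simp add: s_def)
    then show ?thesis by simp
  next
    case False
    then have ab: "\<alpha> < s" "s < \<beta>" using a b by (auto simp: s_def)
    show ?thesis
    proof (rule antisym)
      show "\<phi> s \<le> \<phi> s0"
      proof (rule ccontr)
        assume "\<not> \<phi> s \<le> \<phi> s0"
        then have "\<beta> \<le> measure lambda1 {0<..<s}"
          unfolding \<beta>_def using mono s
          by (intro lambda1.finite_measure_mono sets_lambda1) (force simp: not_le[symmetric])+
        then show False using ab s by (simp add: measure_lambda1_Ioo)
      qed
      show "\<phi> s0 \<le> \<phi> s"
      proof (rule ccontr)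
        assume "\<not> \<phi> s0 \<le> \<phi> s"
        then have "measure lambda1 {0<..s} \<le> \<alpha>"
          unfolding \<alpha>_def using mono s
          by (intro lambda1.finite_measure_mono m1) force+
        then show False using ab s by (simp add: measure_lambda1_Ioc)
      qed
    qed
  qed
  with s show "0 < (\<alpha> + \<beta>) / 2" "(\<alpha> + \<beta>) / 2 < 1" "\<phi> ((\<alpha> + \<beta>) / 2) = \<phi> s0"
    by (simp_all add: s_def)
qed

section \<open>Recovering the noise from the path of a quantile process\<close>

abbreviation law :: "nat \<Rightarrow> ((nat \<Rightarrow> real) \<Rightarrow> nat \<Rightarrow> real) \<Rightarrow> (nat \<Rightarrow> real) measure" where
  "law N Q \<equiv> distr (lambdaN N) (RN N) Q"

lemma triangularD:
  assumes "triangular N T"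
  shows "T \<in> measurable (lambdaN N) (RN N)"
    and "k < N \<Longrightarrow> u \<in> space (lambdaN N) \<Longrightarrow> v \<in> space (lambdaN N) \<Longrightarrow>
      (\<And>i. i \<le> k \<Longrightarrow> u i = v i) \<Longrightarrow> T u k = T v k"
  using assms unfolding triangular_def by blast+

lemma quantile_processD:
  assumes "quantile_process N Q"
  shows "triangular N Q"
    and "Q \<in> measurable (lambdaN N) (RN N)"
    and "k < N \<Longrightarrow> u \<in> space (lambdaN N) \<Longrightarrow> 0 < t \<Longrightarrow> t < 1 \<Longrightarrow> u k \<le> t \<Longrightarrow> Q u k \<le> Q (u(k := t)) k"
    and "k \<le> m \<Longrightarrow> m < N \<Longrightarrow> u \<in> space (lambdaN N) \<Longrightarrow> 0 < t \<Longrightarrow> t < 1 \<Longrightarrow> Q u k = Q (u(k := t)) k \<Longrightarrow>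
      Q u m = Q (u(k := t)) m"
proof -
  show tri: "triangular N Q" using assms by (simp add: quantile_process_def)
  then show "Q \<in> measurable (lambdaN N) (RN N)" by (simp add: triangular_def)
  have ax: "Q v j \<le> Q (v(j := s)) j \<and>
      (Q v j = Q (v(j := s)) j \<longrightarrow> (\<forall>m\<in>{j..<N}. Q v m = Q (v(j := s)) m))"
    if "j < N" "v \<in> space (lambdaN N)" "s \<in> {0<..<1}" "v j \<le> s" for j v s
    using assms that unfolding quantile_process_def by blast
  show "Q u k \<le> Q (u(k := t)) k" if "k < N" "u \<in> space (lambdaN N)" "0 < t" "t < 1" "u k \<le> t"
    using ax[of k u t] that by simp
  assume *: "k \<le> m" "m < N" "u \<in> space (lambdaN N)" "0 < t" "t < 1" "Q u k = Q (u(k := t)) k"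
  then have k: "k < N" by simp
  have con: "v k \<le> s \<Longrightarrow> v \<in> space (lambdaN N) \<Longrightarrow> 0 < s \<Longrightarrow> s < 1 \<Longrightarrow>
    Q v k = Q (v(k := s)) k \<Longrightarrow> Q v m = Q (v(k := s)) m" for v s
    using ax[of k v s] * k by simp
  show "Q u m = Q (u(k := t)) m"
  proof (cases "u k \<le> t")
    case True
    then show ?thesis using con * by simp
  next
    \<comment> \<open>The definition speaks only of raising a coordinate; lowering
      \<open>u k\<close> to \<open>t\<close> is read as raising coordinate \<open>k\<close> of
      \<open>u(k := t)\<close> back to \<open>u k\<close>.\<close>
    case False
    have "0 < u k" "u k < 1" using * k by (auto simp: space_lambdaN)
    then show ?thesis
      using con[of "u(k := t)" "u k"] fun_upd_in_lambdaN[of u N k t] * k False by simp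
  qed
qed

lemma measurable_coordinate_comp:
  assumes "Q \<in> measurable (lambdaN N) (RN N)" "f \<in> measurable L (lambdaN N)" "k < N"
  shows "(\<lambda>w. Q (f w) k) \<in> borel_measurable L"
  using measurable_compose[OF measurable_compose[OF assms(2,1)] measurable_component_singleton[of k "{0..<N}" "\<lambda>_. borel"]] assms(3)
  by simp

text \<open>
  A measurable right inverse of \<open>Q\<close> on its range: each coordinate is the midpoint of the interval
  on which \<open>Q\<close> takes the prescribed value; off the range the value \<open>1/2\<close> is a dummy.
\<close>

primrec quantile_inv ::
  "nat \<Rightarrow> ((nat \<Rightarrow> real) \<Rightarrow> nat \<Rightarrow> real) \<Rightarrow> nat \<Rightarrow> (nat \<Rightarrow> real) \<Rightarrow> nat \<Rightarrow> real" where
  "quantile_inv N Q 0 x = (\<lambda>i\<in>{0..<N}. 1/2)"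
| "quantile_inv N Q (Suc k) x = (quantile_inv N Q k x)(k :=
     (let s = (measure lambda1 {t\<in>{0<..<1}. Q ((quantile_inv N Q k x)(k := t)) k < x k}
             + measure lambda1 {t\<in>{0<..<1}. Q ((quantile_inv N Q k x)(k := t)) k \<le> x k}) / 2
      in if 0 < s \<and> s < 1 then s else 1/2))"

lemma quantile_inv_cong: "(\<And>i. i < k \<Longrightarrow> x i = y i) \<Longrightarrow> quantile_inv N Q k x = quantile_inv N Q k y"
  by (induction k) (auto simp: Let_def)

text \<open>The end points of the level intervals are measures of sections of jointly measurable
  sets, hence measurable in \<open>x\<close>. The dimension \<open>m\<close> is left free because
  only the first \<open>k\<close> coordinates of \<open>x\<close> are read; the inverse is applied
  both to bare pasts (\<open>m = k\<close>) and to full paths (\<open>m = N\<close>).\<close>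

lemma measurable_quantile_inv:
  assumes Q: "Q \<in> measurable (lambdaN N) (RN N)"
  shows "k \<le> N \<Longrightarrow> k \<le> m \<Longrightarrow> quantile_inv N Q k \<in> measurable (RN m) (lambdaN N)"
proof (induction k)
  case 0
  have "(\<lambda>i\<in>{0..<N}. 1/2) \<in> space (lambdaN N)"
    by (auto simp: space_lambdaN)
  then show ?case by (subst measurable_cong[OF quantile_inv.simps(1)]) (rule measurable_const)
next
  case (Suc k)
  have IH[measurable]: "quantile_inv N Q k \<in> measurable (RN m) (lambdaN N)"
    using Suc by simp
  have k: "k < N" "k < m" using Suc by auto
  have xk[measurable]: "(\<lambda>x. x k) \<in> borel_measurable (RN m)"
    using k by (auto intro!: measurable_component_singleton)
  let ?r = "quantile_inv N Q k"
  have Qk: "(\<lambda>w. Q ((?r (fst w))(k := snd w)) k) \<in> borel_measurable (RN m \<Otimes>\<^sub>M lambda1)"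
    by (intro measurable_coordinate_comp[OF Q] measurable_fun_upd_lambdaN k
        measurable_compose[OF measurable_fst IH] measurable_snd)
  have fk: "(\<lambda>w. fst w k) \<in> borel_measurable (RN m \<Otimes>\<^sub>M lambda1)"
    by (rule measurable_compose[OF measurable_fst xk])
  have sp: "space (RN m \<Otimes>\<^sub>M lambda1) = space (RN m) \<times> {0<..<1}"
    by (simp add: space_pair_measure space_lambda1)
  have "{w\<in>space (RN m \<Otimes>\<^sub>M lambda1). Q ((?r (fst w))(k := snd w)) k \<le> fst w k}
      \<in> sets (RN m \<Otimes>\<^sub>M lambda1)"
    by (rule borel_measurable_le[OF Qk fk])
  then have 1: "(\<lambda>x. emeasure lambda1 {t\<in>{0<..<1}. Q ((?r x)(k := t)) k \<le> x k}) \<in> borel_measurable (RN m)"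
    by (intro lambda1.measurable_emeasure) (auto simp: sp space_lambda1 elim!: back_subst[of "\<lambda>A. A \<in> sets _"])
  have "{w\<in>space (RN m \<Otimes>\<^sub>M lambda1). Q ((?r (fst w))(k := snd w)) k < fst w k}
      \<in> sets (RN m \<Otimes>\<^sub>M lambda1)"
    by (rule borel_measurable_less[OF Qk fk])
  then have 2: "(\<lambda>x. emeasure lambda1 {t\<in>{0<..<1}. Q ((?r x)(k := t)) k < x k}) \<in> borel_measurable (RN m)"
    by (intro lambda1.measurable_emeasure) (auto simp: sp space_lambda1 elim!: back_subst[of "\<lambda>A. A \<in> sets _"])
  define s where "s x = (measure lambda1 {t\<in>{0<..<1}. Q ((?r x)(k := t)) k < x k}
             + measure lambda1 {t\<in>{0<..<1}. Q ((?r x)(k := t)) k \<le> x k}) / 2" for x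
  have s[measurable]: "s \<in> borel_measurable (RN m)"
    unfolding s_def measure_def using 1 2 by measurable
  have "(\<lambda>x. if 0 < s x \<and> s x < 1 then s x else 1/2) \<in> measurable (RN m) lambda1"
    by (intro measurable_restrict_space2) (auto split: if_splits)
  then have "(\<lambda>x. (quantile_inv N Q k x)(k := if 0 < s x \<and> s x < 1 then s x else 1/2)) \<in> measurable (RN m) (lambdaN N)"
    by (intro measurable_fun_upd_lambdaN IH k)
  moreover have "quantile_inv N Q (Suc k) = (\<lambda>x. (quantile_inv N Q k x)(k := if 0 < s x \<and> s x < 1 then s x else 1/2))"
    by (rule ext) (simp only: quantile_inv.simps(2) s_def Let_def)
  ultimately show ?case by (simp only:)
qed

text \<open>
  Replacing the first \<open>k\<close> coordinates of \<open>u\<close> one after the other by a point of the same level set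
  does not change \<open>Q u\<close>, by (con); so \<open>Q\<close> is recovered from its own path.
\<close>

lemma quantile_inv_level:
  assumes Q: "quantile_process N Q" and u: "u \<in> space (lambdaN N)"
  defines "w \<equiv> \<lambda>k i. if i < k then quantile_inv N Q k (Q u) i else u i"
  shows "k \<le> N \<Longrightarrow> w k \<in> space (lambdaN N) \<and> (\<forall>m<N. Q (w k) m = Q u m)"
proof (induction k)
  case 0
  then show ?case using u by (simp add: w_def)
next
  case (Suc k)
  note tri = triangularD(2)[OF quantile_processD(1)[OF Q]]
  have k: "k < N" using Suc by simp
  have wk: "w k \<in> space (lambdaN N)" and Qw: "\<And>m. m < N \<Longrightarrow> Q (w k) m = Q u m"
    using Suc by auto
  let ?r = "quantile_inv N Q k (Q u)"
  define \<phi> where "\<phi> t = Q ((w k)(k := t)) k" for t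
  have [measurable]: "Q \<in> measurable (lambdaN N) (RN N)" by (rule quantile_processD(2)[OF Q])
  have Qr: "Q u \<in> space (RN N)" using measurable_space[OF quantile_processD(2)[OF Q] u] .
  have r: "?r \<in> space (lambdaN N)"
    using measurable_space[OF measurable_quantile_inv[OF quantile_processD(2)[OF Q], of k N] Qr] k by simp
  \<comment> \<open>\<open>?r\<close> and \<open>w k\<close> agree below \<open>k\<close>, and
    coordinate \<open>k\<close> of \<open>Q\<close> looks no further. So the recipe of
    \<open>quantile_inv\<close>, which is formulated along \<open>?r\<close>, can be analysed along
    \<open>w k\<close>, where the induction hypothesis gives the values of \<open>Q\<close>.\<close>
  have \<phi>r: "Q (?r(k := t)) k = \<phi> t" if "t \<in> {0<..<1}" for t
    unfolding \<phi>_def using that k wk r by (intro tri fun_upd_in_lambdaN) (auto simp: w_def)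
  have \<phi>m: "\<phi> \<in> borel_measurable lambda1"
    unfolding \<phi>_def
    using wk by (intro measurable_coordinate_comp[OF quantile_processD(2)[OF Q]] measurable_fun_upd_lambdaN k
        measurable_const measurable_ident_sets refl)
  have mono: "\<phi> s \<le> \<phi> t" if "0 < s" "s \<le> t" "t < 1" for s t
    using quantile_processD(3)[OF Q k fun_upd_in_lambdaN[OF wk k, of s], of t] that by (simp add: \<phi>_def)
  have uk: "0 < u k" "u k < 1" using u k by (auto simp: space_lambdaN)
  have \<phi>u: "\<phi> (u k) = Q u k"
    using Qw[OF k] fun_upd_triv[of "w k" k] by (simp add: \<phi>_def w_def)
  define s where "s = (measure lambda1 {t\<in>{0<..<1}. \<phi> t < \<phi> (u k)}
             + measure lambda1 {t\<in>{0<..<1}. \<phi> t \<le> \<phi> (u k)}) / 2"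
  have s: "0 < s" "s < 1" "\<phi> s = Q u k"
    using level_midpoint[OF \<phi>m mono uk] unfolding s_def \<phi>u by auto
  have sets_eq: "{t\<in>{0<..<1}. Q (?r(k := t)) k < Q u k} = {t\<in>{0<..<1}. \<phi> t < \<phi> (u k)}"
    "{t\<in>{0<..<1}. Q (?r(k := t)) k \<le> Q u k} = {t\<in>{0<..<1}. \<phi> t \<le> \<phi> (u k)}"
    using \<phi>r \<phi>u by auto
  have "quantile_inv N Q (Suc k) (Q u) = ?r(k := s)"
    using s unfolding quantile_inv.simps(2) sets_eq s_def[symmetric] by (simp add: Let_def)
  then have w_Suc: "w (Suc k) = (w k)(k := s)"
    unfolding w_def by (auto simp: fun_eq_iff simp del: quantile_inv.simps)
  have "Q (w (Suc k)) m = Q u m" if m: "m < N" for m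
  proof (cases "k \<le> m")
    case True
    have "Q (w k) m = Q ((w k)(k := s)) m"
      using s Qw[OF k] by (intro quantile_processD(4)[OF Q True m wk]) (auto simp: \<phi>_def)
    then show ?thesis using Qw[OF m] by (simp add: w_Suc)
  next
    case False
    then have "Q ((w k)(k := s)) m = Q (w k) m"
      using s by (intro tri m fun_upd_in_lambdaN wk k) auto
    then show ?thesis using Qw[OF m] by (simp add: w_Suc)
  qed
  then show ?case
    using s(1,2) fun_upd_in_lambdaN[OF wk k, of s] unfolding w_Suc greaterThanLessThan_iff by blast
qed

text \<open>The conditional quantile function of coordinate \<open>k\<close> given the past
  \<open>x\<close>: any noise that produces \<open>x\<close> would do, and
  \<open>quantile_inv\<close> selects one measurably. The value \<open>0\<close> from index
  \<open>N\<close> on provides a kernel at every index, as the Ionescu-Tulcea locale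
  demands.\<close>

definition cond_quantile ::
  "nat \<Rightarrow> ((nat \<Rightarrow> real) \<Rightarrow> nat \<Rightarrow> real) \<Rightarrow> nat \<Rightarrow> (nat \<Rightarrow> real) \<Rightarrow> real \<Rightarrow> real" where
  "cond_quantile N Q k x t = (if k < N then Q ((quantile_inv N Q k x)(k := t)) k else 0)"

lemma measurable_cond_quantile:
  assumes Q: "Q \<in> measurable (lambdaN N) (RN N)"
  shows "case_prod (cond_quantile N Q k) \<in> borel_measurable (RN k \<Otimes>\<^sub>M lambda1)"
proof (cases "k < N")
  case True
  have qi: "quantile_inv N Q k \<in> measurable (RN k) (lambdaN N)"
    using True by (intro measurable_quantile_inv[OF Q]) auto
  have "(\<lambda>w. Q ((quantile_inv N Q k (fst w))(k := snd w)) k) \<in> borel_measurable (RN k \<Otimes>\<^sub>M lambda1)"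
    using True by (intro measurable_coordinate_comp[OF Q] measurable_fun_upd_lambdaN
        measurable_compose[OF measurable_fst qi] measurable_snd)
  with True show ?thesis
    by (simp add: cond_quantile_def split_beta')
qed (simp add: cond_quantile_def split_beta')

text \<open>Changing \<open>u k\<close> leaves the values of \<open>Q u\<close> before
  \<open>k\<close> alone, so \<open>quantile_inv\<close> receives the same input from
  \<open>u\<close> and from \<open>u(k := t)\<close>. By \<open>quantile_inv_level\<close>,
  exchanging the first \<open>k\<close> coordinates of the latter for the selected ones does not
  change its value at \<open>k\<close>.\<close>

lemma cond_quantile_resample:
  assumes Q: "quantile_process N Q" and u: "u \<in> space (lambdaN N)" and k: "k < N" and t: "0 < t" "t < 1"
  shows "cond_quantile N Q k (past k (Q u)) t = Q (u(k := t)) k"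
proof -
  define v where "v = u(k := t)"
  have v: "v \<in> space (lambdaN N)" using fun_upd_in_lambdaN[OF u k, of t] t by (simp add: v_def)
  note tri = triangularD(2)[OF quantile_processD(1)[OF Q]]
  have prefix: "Q u i = Q v i" if "i < k" for i
    using that k by (intro tri u v) (auto simp: v_def)
  define r where "r = quantile_inv N Q k (Q v)"
  define w where "w = (\<lambda>i. if i < k then r i else v i)"
  have w: "w \<in> space (lambdaN N)" "Q w k = Q v k"
    using quantile_inv_level[OF Q v, of k] k unfolding w_def r_def by simp_all
  have "Q v \<in> space (RN N)" using measurable_space[OF quantile_processD(2)[OF Q] v] .
  then have r: "r \<in> space (lambdaN N)"
    unfolding r_def using measurable_space[OF measurable_quantile_inv[OF quantile_processD(2)[OF Q], of k N]] k by simp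
  have "quantile_inv N Q k (past k (Q u)) = r"
    unfolding r_def using prefix by (intro quantile_inv_cong) simp
  then have "cond_quantile N Q k (past k (Q u)) t = Q (r(k := t)) k"
    using k by (simp add: cond_quantile_def)
  also have "\<dots> = Q w k"
    using t by (intro tri k w fun_upd_in_lambdaN r) (auto simp: w_def v_def)
  finally show ?thesis using w by (simp add: v_def)
qed

lemma quantile_process_recursion:
  assumes Q: "quantile_process N Q" and u: "u \<in> space (lambdaN N)" and k: "k < N"
  shows "Q u k = cond_quantile N Q k (past k (Q u)) (u k)"
  using cond_quantile_resample[OF Q u k, of "u k"] u k by (simp add: space_lambdaN)

lemma quantile_process_in_space:
  "quantile_process N Q \<Longrightarrow> u \<in> space (lambdaN N) \<Longrightarrow> Q u \<in> space (RN N)"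
  by (rule measurable_space[OF quantile_processD(2)])

text \<open>By its own recursion \<open>Q\<close> is the noise path of
  \<open>cond_quantile N Q\<close>, so its kernels are explicit images of the uniform law and no
  conditioning has to be carried out.\<close>

lemma disintegration_quantile_process:
  assumes Q: "quantile_process N Q"
  shows "disintegration borel N (law N Q) (\<lambda>k x. distr lambda1 borel (cond_quantile N Q k x))"
proof -
  have "noise_path (cond_quantile N Q) N u = Q u" if u: "u \<in> space (lambdaN N)" for u
    using quantile_process_in_space[OF Q u] quantile_process_recursion[OF Q u]
    by (intro noise_path_eqI) (auto simp: space_PiM PiE_iff)
  then have "law N Q = distr (lambdaN N) (RN N) (noise_path (cond_quantile N Q) N)"
    by (intro distr_cong) auto
  then show ?thesis
    using disintegration_noise[OF measurable_cond_quantile[OF quantile_processD(2)[OF Q]], of N] by simp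
qed

section \<open>The coupling of two quantile processes by common noise\<close>

lemma measurable_zip_upto:
  "zip_upto N \<in> measurable (RN N \<Otimes>\<^sub>M RN N) (PiM {0..<N} (\<lambda>_. borel \<Otimes>\<^sub>M borel))"
  unfolding zip_upto_def
  by (auto intro!: measurable_restrict measurable_Pair measurable_compose[OF measurable_fst measurable_component_singleton]
      measurable_compose[OF measurable_snd measurable_component_singleton])

text \<open>The zipped pair is again a noise path, in the plane, with both components fed the same
  noise. Its kernel is the image of the uniform law under a pair of functions, each of which reads
  only its own past; so the marginals of the kernel are the two separate kernels, which is
  bicausality.\<close>

lemma bicausal_quantile_coupling:
  assumes Q: "quantile_process N Q" and Q': "quantile_process N Q'"
  shows "distr (lambdaN N) (RN N \<Otimes>\<^sub>M RN N) (\<lambda>u. (Q u, Q' u))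
    \<in> bicausal N (law N Q) (law N Q')"
proof -
  have [measurable]: "Q \<in> measurable (lambdaN N) (RN N)" "Q' \<in> measurable (lambdaN N) (RN N)"
    using Q Q' by (auto intro: quantile_processD)
  let ?\<mu> = "law N Q" and ?\<nu> = "law N Q'"
  let ?\<pi> = "distr (lambdaN N) (RN N \<Otimes>\<^sub>M RN N) (\<lambda>u. (Q u, Q' u))"
  let ?B = "borel \<Otimes>\<^sub>M borel :: (real \<times> real) measure"
  have coup: "coupling ?\<mu> ?\<nu> ?\<pi>"
    unfolding coupling_def
  proof (intro conjI)
    show "sets ?\<pi> = sets (?\<mu> \<Otimes>\<^sub>M ?\<nu>)" by (simp cong: sets_pair_measure_cong)
    have "distr ?\<pi> ?\<mu> fst = distr ?\<pi> (RN N) fst" by (intro distr_cong) auto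
    also have "\<dots> = ?\<mu>" by (subst distr_distr) (auto simp: comp_def)
    finally show "distr ?\<pi> ?\<mu> fst = ?\<mu>" .
    have "distr ?\<pi> ?\<nu> snd = distr ?\<pi> (RN N) snd" by (intro distr_cong) auto
    also have "\<dots> = ?\<nu>" by (subst distr_distr) (auto simp: comp_def)
    finally show "distr ?\<pi> ?\<nu> snd = ?\<nu>" .
  qed
  note q = measurable_cond_quantile[OF quantile_processD(2)[OF Q]]
    measurable_cond_quantile[OF quantile_processD(2)[OF Q']]
  define z where "z k w t = (cond_quantile N Q k (\<lambda>i\<in>{0..<k}. fst (w i)) t,
    cond_quantile N Q' k (\<lambda>i\<in>{0..<k}. snd (w i)) t)" for k and w :: "nat \<Rightarrow> real \<times> real" and t
  have z: "case_prod (z k) \<in> measurable (paths k ?B \<Otimes>\<^sub>M lambda1) ?B" for k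
  proof -
    have wi: "(\<lambda>w. fst w i) \<in> measurable (paths k ?B \<Otimes>\<^sub>M lambda1) ?B" if "i \<in> {0..<k}" for i
      using that by (rule measurable_compose[OF measurable_fst measurable_component_singleton])
    have m1: "(\<lambda>w. (\<lambda>i\<in>{0..<k}. fst (fst w i), snd w)) \<in> measurable (paths k ?B \<Otimes>\<^sub>M lambda1) (RN k \<Otimes>\<^sub>M lambda1)"
      by (intro measurable_Pair measurable_snd measurable_restrict measurable_compose[OF wi measurable_fst])
    have m2: "(\<lambda>w. (\<lambda>i\<in>{0..<k}. snd (fst w i), snd w)) \<in> measurable (paths k ?B \<Otimes>\<^sub>M lambda1) (RN k \<Otimes>\<^sub>M lambda1)"
      by (intro measurable_Pair measurable_snd measurable_restrict measurable_compose[OF wi measurable_snd])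
    from measurable_compose[OF m1 q(1)[of k]] measurable_compose[OF m2 q(2)[of k]]
    have "(\<lambda>w. cond_quantile N Q k (\<lambda>i\<in>{0..<k}. fst (fst w i)) (snd w)) \<in> borel_measurable (paths k ?B \<Otimes>\<^sub>M lambda1)"
      and "(\<lambda>w. cond_quantile N Q' k (\<lambda>i\<in>{0..<k}. snd (fst w i)) (snd w)) \<in> borel_measurable (paths k ?B \<Otimes>\<^sub>M lambda1)"
      by simp_all
    then show ?thesis
      by (simp add: z_def split_beta')
  qed
  have np: "noise_path z N u = zip_upto N (Q u, Q' u)" if u: "u \<in> space (lambdaN N)" for u
  proof (rule noise_path_eqI)
    fix k assume k: "k < N"
    have "(\<lambda>i\<in>{0..<k}. fst (past k (zip_upto N (Q u, Q' u)) i)) = past k (Q u)"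
      "(\<lambda>i\<in>{0..<k}. snd (past k (zip_upto N (Q u, Q' u)) i)) = past k (Q' u)"
      using k by (auto simp: zip_upto_def restrict_def)
    then show "zip_upto N (Q u, Q' u) k = z k (past k (zip_upto N (Q u, Q' u))) (u k)"
      using k quantile_process_recursion[OF Q u k] quantile_process_recursion[OF Q' u k]
      by (simp add: z_def zip_upto_def)
  qed (simp add: zip_upto_def)
  have "distr ?\<pi> (paths N ?B) (zip_upto N) = distr (lambdaN N) (paths N ?B) (noise_path z N)"
    using measurable_zip_upto np by (subst distr_distr) (auto intro!: distr_cong simp: comp_def)
  then have dis: "disintegration ?B N (distr ?\<pi> (paths N ?B) (zip_upto N)) (\<lambda>k x. distr lambda1 ?B (z k x))"
    using disintegration_noise[OF z, of N] by simp
  have cpl: "coupling (distr lambda1 borel (cond_quantile N Q k (past k (fst w))))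
      (distr lambda1 borel (cond_quantile N Q' k (past k (snd w))))
      (distr lambda1 ?B (z k (zip_upto k w)))" if w: "w \<in> space (RN N \<Otimes>\<^sub>M RN N)" and k: "k < N" for w k
  proof -
    have "past k (fst w) \<in> space (RN k)" "past k (snd w) \<in> space (RN k)"
      using w k by (auto simp: space_PiM)
    from measurable_compose_Pair1[OF this(1) q(1)] measurable_compose_Pair1[OF this(2) q(2)]
    have [measurable]: "cond_quantile N Q k (past k (fst w)) \<in> borel_measurable lambda1"
      "cond_quantile N Q' k (past k (snd w)) \<in> borel_measurable lambda1" by simp_all
    have zz: "z k (zip_upto k w) = (\<lambda>t. (cond_quantile N Q k (past k (fst w)) t,
        cond_quantile N Q' k (past k (snd w)) t))"
      by (simp add: z_def zip_upto_def fun_eq_iff restrict_def cong: if_cong)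
    show ?thesis
      unfolding coupling_def zz
      by (auto simp: distr_distr comp_def cong: sets_pair_measure_cong
          intro!: trans[OF distr_cong[OF refl sets_distr refl]])
  qed
  show ?thesis
    unfolding bicausal_def
    using coup dis disintegration_quantile_process[OF Q] disintegration_quantile_process[OF Q'] cpl
    by (auto intro!: exI AE_I2)
qed

section \<open>Existence of quantile processes\<close>

text \<open>Radon-Nikodym derivatives are known through their set integrals; testing on the set
  where \<open>g x < f x\<close> makes such information pointwise.\<close>

lemma AE_le_of_set_nn_integral_le:
  fixes f g :: "'a \<Rightarrow> ennreal"
  assumes [measurable]: "f \<in> borel_measurable M" "g \<in> borel_measurable M"
    and fin: "(\<integral>\<^sup>+x. g x \<partial>M) \<noteq> \<infinity>"
    and le: "\<And>B. B \<in> sets M \<Longrightarrow> (\<integral>\<^sup>+x\<in>B. f x \<partial>M) \<le> (\<integral>\<^sup>+x\<in>B. g x \<partial>M)"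
  shows "AE x in M. f x \<le> g x"
proof -
  define B where "B = {x\<in>space M. g x < f x}"
  have B[measurable]: "B \<in> sets M" by (simp add: B_def)
  have "(\<integral>\<^sup>+x\<in>B. g x \<partial>M) \<le> (\<integral>\<^sup>+x. g x \<partial>M)"
    by (intro nn_integral_mono) (auto split: split_indicator)
  then have fin': "(\<integral>\<^sup>+x\<in>B. g x \<partial>M) \<noteq> \<infinity>" using fin by (auto simp: top_unique)
  then have "(\<integral>\<^sup>+x. f x * indicator B x - g x * indicator B x \<partial>M) = (\<integral>\<^sup>+x\<in>B. f x \<partial>M) - (\<integral>\<^sup>+x\<in>B. g x \<partial>M)"
    by (intro nn_integral_diff) (auto simp: B_def split: split_indicator)
  also have "\<dots> = 0" using le[OF B] using fin' by (intro diff_eq_0_ennreal) (auto simp: less_top)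
  finally have "AE x in M. f x * indicator B x - g x * indicator B x = 0"
    by (subst (asm) nn_integral_0_iff_AE) auto
  then show ?thesis
    by (rule AE_mp, intro AE_I2) (auto simp: B_def indicator_def ennreal_minus_eq_0 not_less split: if_splits)
qed

lemma sets_pair_atMost:
  "sets (M \<Otimes>\<^sub>M (borel :: real measure)) = sigma_sets (space M \<times> UNIV) {A \<times> {..b} | A b. A \<in> sets M}"
proof -
  have "\<exists>S\<subseteq>range (atMost :: real \<Rightarrow> _). countable S \<and> UNIV = \<Union>S"
    using real_arch_simple by (intro exI[of _ "range (\<lambda>n::nat. {..real n})"]) auto
  then have "sigma (space M) (sets M) \<Otimes>\<^sub>M sigma UNIV (range (atMost :: real \<Rightarrow> _)) =
    sigma (space M \<times> UNIV) {A \<times> B | A B. A \<in> sets M \<and> B \<in> range atMost}"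
    by (intro sigma_prod exI[of _ "{space M}"]) (auto dest: sets.sets_into_space)
  moreover have "sets (M \<Otimes>\<^sub>M borel) = sets (sigma (space M) (sets M) \<Otimes>\<^sub>M sigma UNIV (range (atMost :: real \<Rightarrow> _)))"
    by (intro sets_pair_measure_cong) (simp_all add: borel_eq_atMost)
  moreover have "{A \<times> B | A B. A \<in> sets M \<and> B \<in> range atMost} = {A \<times> {..b :: real} | A b. A \<in> sets M}" by auto
  moreover have "{A \<times> {..b :: real} | A b. A \<in> sets M} \<subseteq> Pow (space M \<times> UNIV)"
    by (auto dest: sets.sets_into_space)
  ultimately show ?thesis by (simp only: sets_measure_of)
qed

lemma measure_eqI_times_atMost:
  fixes P P' :: "('a \<times> real) measure"
  assumes fin: "finite_measure P"
    and sets: "sets P = sets (M \<Otimes>\<^sub>M borel)" "sets P' = sets (M \<Otimes>\<^sub>M borel)"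
    and eq: "\<And>A b. A \<in> sets M \<Longrightarrow> emeasure P (A \<times> {..b}) = emeasure P' (A \<times> {..b})"
  shows "P = P'"
proof (rule measure_eqI_generator_eq[where A="\<lambda>n. space M \<times> {..real n}"])
  show "Int_stable {A \<times> {..b :: real} | A b. A \<in> sets M}"
  proof (rule Int_stableI, safe)
    fix A B and a b :: real assume "A \<in> sets M" "B \<in> sets M"
    then show "\<exists>C c. (A \<times> {..a}) \<inter> (B \<times> {..b}) = C \<times> {..c} \<and> C \<in> sets M"
      by (intro exI[of _ "A \<inter> B"] exI[of _ "min a b"]) auto
  qed
  show "(\<Union>n::nat. space M \<times> {..real n}) = space M \<times> UNIV" using real_arch_simple by auto
  show "emeasure P (space M \<times> {..real n}) \<noteq> \<infinity>" for n
    using finite_measure.emeasure_finite[OF fin] by simp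
qed (auto simp: sets sets_pair_atMost eq dest: sets.sets_into_space)

lemma emeasure_lambda1_le:
  assumes "c \<le> 1"
  shows "emeasure lambda1 {t\<in>{0<..<1}. ennreal t \<le> c} = c"
proof -
  obtain r where r: "c = ennreal r" "0 \<le> r" "r \<le> 1"
    using assms by (cases c) (auto simp: ennreal_le_1 top_unique)
  have "emeasure lambda1 {t\<in>{0<..<1}. ennreal t \<le> c} = emeasure lambda1 (if r = 1 then {0<..<1} else {0<..r})"
    using r by (intro arg_cong[where f="emeasure _"]) (auto simp: ennreal_le_iff)
  also have "\<dots> = c"
  proof (cases "r = 1")
    case True
    then show ?thesis using r lambda1.emeasure_space_1 by (simp add: space_lambda1)
  next
    case False
    then have "{0<..r} \<subseteq> {0<..<1}" using r by auto
    with False r show ?thesis by (subst if_not_P, simp, subst emeasure_restrict_space) auto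
  qed
  finally show ?thesis .
qed

text \<open>
  Conditional distribution functions are Radon-Nikodym derivatives. Taking them at all real levels
  \<open>b\<close> gives right-continuity; only the countably many rational ones are corrected on a null set.
\<close>

lemma conditional_cdf_exists:
  fixes P :: "('a \<times> real) measure"
  assumes P: "prob_space P" and sets_P: "sets P = sets (M \<Otimes>\<^sub>M borel)"
  obtains F :: "rat \<Rightarrow> 'a \<Rightarrow> ennreal" where
    "\<And>a. F a \<in> borel_measurable M"
    "\<And>a x. F a x \<le> 1" "\<And>a b x. a \<le> b \<Longrightarrow> F a x \<le> F b x"
    "\<And>x. 1 \<le> (SUP n::nat. F (of_nat n) x)" "\<And>x. (INF n::nat. F (- of_nat n) x) = 0"
    "\<And>b B. B \<in> sets M \<Longrightarrow>
      (\<integral>\<^sup>+x\<in>B. (INF a\<in>{a. b < of_rat a}. F a x) \<partial>distr P M fst) = emeasure P (B \<times> {..b})"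
proof -
  interpret P: prob_space P by fact
  note [measurable_cong] = sets_P
  have sp: "space P = space M \<times> UNIV" using sets_eq_imp_space_eq[OF sets_P] by (simp add: space_pair_measure)
  let ?m = "distr P M fst"
  interpret m: prob_space ?m by (rule P.prob_space_distr) simp
  have Pmono: "emeasure P (B \<times> {..a}) \<le> emeasure P (B \<times> {..b})" if "a \<le> b" and [measurable]: "B \<in> sets M" for a b :: real and B
    using that by (intro emeasure_mono) auto
  have mB: "emeasure ?m B = emeasure P (B \<times> UNIV)" if [measurable]: "B \<in> sets M" for B
  proof -
    have "fst -` B \<inter> space P = B \<times> UNIV"
      using sets.sets_into_space[OF that] by (auto simp: sp)
    then show ?thesis by (simp add: emeasure_distr)
  qed
  have "\<exists>f\<in>borel_measurable ?m. \<forall>B\<in>sets M. (\<integral>\<^sup>+x\<in>B. f x \<partial>?m) = emeasure P (B \<times> {..a})" for a :: real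
  proof -
    let ?n = "distr (density P (indicator (space M \<times> {..a}))) M fst"
    have n: "emeasure ?n B = emeasure P (B \<times> {..a})" if [measurable]: "B \<in> sets M" for B
    proof -
      have "emeasure ?n B = emeasure (density P (indicator (space M \<times> {..a}))) (fst -` B \<inter> space P)"
        by (subst emeasure_distr) auto
      also have "\<dots> = emeasure P (space M \<times> {..a} \<inter> (fst -` B \<inter> space P))"
        by (rule emeasure_restricted) measurable
      also have "space M \<times> {..a} \<inter> (fst -` B \<inter> space P) = B \<times> {..a}"
        using sets.sets_into_space[OF that] by (auto simp: sp)
      finally show ?thesis .
    qed
    have "absolutely_continuous ?m ?n"
    proof (unfold absolutely_continuous_def, safe)
      fix B assume "B \<in> null_sets ?m"
      then have B[measurable]: "B \<in> sets M" and "emeasure P (B \<times> UNIV) = 0" by (auto simp: mB null_sets_def)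
      moreover have "emeasure P (B \<times> {..a}) \<le> emeasure P (B \<times> UNIV)"
        by (intro emeasure_mono) auto
      ultimately show "B \<in> null_sets ?n" by (auto simp: null_sets_def n)
    qed
    then obtain f where f: "f \<in> borel_measurable ?m" "density ?m f = ?n"
      using m.Radon_Nikodym[of ?n] by auto
    show ?thesis
    proof (intro bexI[OF _ f(1)] ballI)
      fix B assume B: "B \<in> sets M"
      have "(\<integral>\<^sup>+x\<in>B. f x \<partial>?m) = emeasure (density ?m f) B"
        using B f(1) by (subst emeasure_density) auto
      then show "(\<integral>\<^sup>+x\<in>B. f x \<partial>?m) = emeasure P (B \<times> {..a})"
        using n[OF B] f(2) by simp
    qed
  qed
  then obtain G where G: "\<And>a. G a \<in> borel_measurable ?m"
    and G_int: "\<And>a B. B \<in> sets M \<Longrightarrow> (\<integral>\<^sup>+x\<in>B. G a x \<partial>?m) = emeasure P (B \<times> {..a})"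
    by metis
  have [measurable]: "G a \<in> borel_measurable M" for a using G[of a] by simp
  have G_fin: "(\<integral>\<^sup>+x. G a x \<partial>?m) \<noteq> \<infinity>" for a
  proof -
    have "(\<integral>\<^sup>+x. G a x \<partial>?m) = (\<integral>\<^sup>+x\<in>space M. G a x \<partial>?m)"
      by (intro nn_integral_cong) simp
    then show ?thesis using G_int[of "space M" a] by simp
  qed
  have G_mono: "AE x in ?m. G a x \<le> G b x" if "a \<le> b" for a b
    using G_fin that by (intro AE_le_of_set_nn_integral_le) (auto simp: G_int Pmono)
  have G_1: "AE x in ?m. G a x \<le> 1" for a
    using m.emeasure_space_1
    by (intro AE_le_of_set_nn_integral_le) (auto simp: G_int mB intro!: emeasure_mono)
  let ?S = "\<lambda>x. SUP n::nat. G (real n) x" and ?L = "\<lambda>x. INF n::nat. G (- real n) x"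
  have G_sup: "AE x in ?m. 1 \<le> ?S x"
  proof (rule AE_le_of_set_nn_integral_le)
    have "AE x in ?m. ?S x \<le> 1"
      using G_1 by (simp add: SUP_le_iff AE_all_countable)
    then have "(\<integral>\<^sup>+x. ?S x \<partial>?m) \<le> (\<integral>\<^sup>+x. 1 \<partial>?m)"
      by (rule nn_integral_mono_AE)
    then show "(\<integral>\<^sup>+x. ?S x \<partial>?m) \<noteq> \<infinity>"
      using m.emeasure_space_1 by (auto simp: top_unique)
    fix B assume "B \<in> sets ?m"
    then have B[measurable]: "B \<in> sets M" by simp
    have "(\<integral>\<^sup>+x\<in>B. 1 \<partial>?m) = emeasure P (\<Union>n::nat. B \<times> {..real n})"
      using real_arch_simple by (auto simp: mB intro!: arg_cong[where f="emeasure P"])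
    also have "\<dots> = (SUP n::nat. emeasure P (B \<times> {..real n}))"
      by (rule SUP_emeasure_incseq[symmetric]) (auto simp: incseq_def)
    also have "\<dots> \<le> (\<integral>\<^sup>+x\<in>B. ?S x \<partial>?m)"
      unfolding G_int[OF B, symmetric]
      by (intro SUP_least nn_integral_mono mult_right_mono SUP_upper) auto
    finally show "(\<integral>\<^sup>+x\<in>B. 1 \<partial>?m) \<le> (\<integral>\<^sup>+x\<in>B. ?S x \<partial>?m)" .
  qed auto
  have G_inf: "AE x in ?m. ?L x \<le> 0"
  proof (rule AE_le_of_set_nn_integral_le)
    fix B assume "B \<in> sets ?m"
    then have B[measurable]: "B \<in> sets M" by simp
    have "(\<integral>\<^sup>+x\<in>B. ?L x \<partial>?m) \<le> (INF n::nat. emeasure P (B \<times> {..- real n}))"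
      unfolding G_int[OF B, symmetric]
      by (intro INF_greatest nn_integral_mono mult_right_mono INF_lower) auto
    also have "\<dots> = emeasure P (\<Inter>n::nat. B \<times> {..- real n})"
      by (rule INF_emeasure_decseq) (auto simp: decseq_def)
    also have "(\<Inter>n::nat. B \<times> {..- real n}) = {}"
    proof -
      have "\<exists>n::nat. \<not> y \<le> - real n" for y :: real
      proof -
        obtain n :: nat where "- y < real n" using reals_Archimedean2 by blast
        then show ?thesis by (intro exI[of _ n]) simp
      qed
      then show ?thesis by fastforce
    qed
    finally show "(\<integral>\<^sup>+x\<in>B. ?L x \<partial>?m) \<le> (\<integral>\<^sup>+x\<in>B. 0 \<partial>?m)" by simp
  qed auto
  define good where "good x \<longleftrightarrow> (\<forall>a::rat. G (of_rat a) x \<le> 1) \<and> (\<forall>a b::rat. a \<le> b \<longrightarrow> G (of_rat a) x \<le> G (of_rat b) x) \<and>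
     1 \<le> ?S x \<and> ?L x \<le> 0" for x
  have good[measurable]: "Measurable.pred M good"
    unfolding good_def by measurable
  have AE_good: "AE x in ?m. good x"
    unfolding good_def using G_1 G_mono G_sup G_inf
    by (simp add: AE_conj_iff AE_all_countable of_rat_less_eq)
  \<comment> \<open>Off the good set the distribution function of the point mass at \<open>0\<close>
    takes over, so that bounds, monotonicity and limits hold at every \<open>x\<close>.\<close>
  define F where "F a x = (if good x then G (of_rat a) x else if 0 \<le> a then 1 else 0)" for a x
  have F_m[measurable]: "F a \<in> borel_measurable M" for a
    unfolding F_def by measurable
  have F_AE: "AE x in ?m. F a x = G (of_rat a) x" for a
    using AE_good by eventually_elim (simp add: F_def)
  have F_int: "(\<integral>\<^sup>+x\<in>B. F a x \<partial>?m) = emeasure P (B \<times> {..of_rat a})" if "B \<in> sets M" for a B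
    unfolding G_int[OF that, symmetric] using F_AE[of a] by (intro nn_integral_cong_AE) auto
  let ?I = "\<lambda>b x. INF a\<in>{a. b < of_rat a}. F a x"
  have "1 \<le> (SUP n::nat. F (of_nat n) x)" for x
  proof (cases "good x")
    case True
    then show ?thesis by (simp add: F_def) (simp add: good_def)
  next
    case False
    then show ?thesis by (simp add: F_def)
  qed
  moreover have "(INF n::nat. F (- of_nat n) x) = 0" for x
  proof (cases "good x")
    case True
    then show ?thesis by (simp add: F_def of_rat_minus) (simp add: good_def)
  next
    case False
    then have "(INF n::nat. F (- of_nat n) x) \<le> F (- of_nat 1) x" by (intro INF_lower) auto
    with False show ?thesis by (simp add: F_def)
  qed
  moreover have "(\<integral>\<^sup>+x\<in>B. ?I b x \<partial>?m) = emeasure P (B \<times> {..b})"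
    if B[measurable]: "B \<in> sets M" for b B
  proof (rule antisym)
    have "AE x in ?m. \<forall>a::rat. b < of_rat a \<longrightarrow> G b x \<le> F a x"
    proof (subst AE_all_countable, intro allI)
      fix a :: rat
      show "AE x in ?m. b < of_rat a \<longrightarrow> G b x \<le> F a x"
        using F_AE[of a] G_mono[of b "of_rat a"] by (cases "b < of_rat a") auto
    qed
    then have "(\<integral>\<^sup>+x\<in>B. G b x \<partial>?m) \<le> (\<integral>\<^sup>+x\<in>B. ?I b x \<partial>?m)"
      by (intro nn_integral_mono_AE, eventually_elim) (auto intro!: INF_greatest mult_right_mono)
    then show "emeasure P (B \<times> {..b}) \<le> (\<integral>\<^sup>+x\<in>B. ?I b x \<partial>?m)"
      by (simp add: G_int)
    \<comment> \<open>Upper bound: a rational strictly between \<open>b\<close> and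
      \<open>c n\<close> dominates the infimum, and \<open>P\<close> is continuous from above along
      the sets \<open>B \<times> {..c n}\<close>.\<close>
    define c where "c n = b + 1 / real (Suc n)" for n
    have "(\<integral>\<^sup>+x\<in>B. ?I b x \<partial>?m) \<le> (INF n. emeasure P (B \<times> {..c n}))"
    proof (rule INF_greatest)
      fix n
      have "b < c n" by (simp add: c_def)
      then obtain a where a: "b < of_rat a" "of_rat a < c n" using of_rat_dense by blast
      have "(\<integral>\<^sup>+x\<in>B. ?I b x \<partial>?m) \<le> (\<integral>\<^sup>+x\<in>B. F a x \<partial>?m)"
        using a by (intro nn_integral_mono mult_right_mono INF_lower) auto
      also have "\<dots> \<le> emeasure P (B \<times> {..c n})"
        using a by (simp add: F_int Pmono)
      finally show "(\<integral>\<^sup>+x\<in>B. ?I b x \<partial>?m) \<le> emeasure P (B \<times> {..c n})" .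
    qed
    also have "\<dots> = emeasure P (\<Inter>n. B \<times> {..c n})"
    proof (rule INF_emeasure_decseq)
      show "decseq (\<lambda>n. B \<times> {..c n})"
      proof (unfold decseq_def, intro allI impI Sigma_mono order_refl)
        fix m n :: nat assume "m \<le> n"
        then have "c n \<le> c m" by (simp add: c_def frac_le)
        then show "{..c n} \<subseteq> {..c m}" by simp
      qed
    qed auto
    also have "(\<Inter>n. B \<times> {..c n}) = B \<times> {..b}"
    proof -
      have "y \<le> b" if "\<And>n. y \<le> c n" for y
      proof (rule LIMSEQ_le_const)
        show "c \<longlonglongrightarrow> b" unfolding c_def using LIMSEQ_inverse_real_of_nat_add[of b] by (simp add: inverse_eq_divide)
        show "\<exists>N. \<forall>n\<ge>N. y \<le> c n" using that by auto
      qed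
      moreover have "b \<le> c n" for n by (simp add: c_def)
      ultimately have "(\<forall>n. y \<le> c n) \<longleftrightarrow> y \<le> b" for y by (meson order_trans)
      then show ?thesis by auto
    qed
    finally show "(\<integral>\<^sup>+x\<in>B. ?I b x \<partial>?m) \<le> emeasure P (B \<times> {..b})" .
  qed
  moreover have "F a x \<le> 1" "a \<le> b \<Longrightarrow> F a x \<le> F b x" for a b x
    by (auto simp: F_def good_def)
  ultimately show ?thesis using F_m by (intro that)
qed

text \<open>\<open>q x\<close> is the generalised inverse of the conditional distribution function,
  taken along the rationals; the limits of \<open>F\<close> at both ends make the infimum a genuine
  one. The equivalence \<open>q_le\<close>, a Galois connection with the right-continuous version of
  \<open>F\<close>, yields measurability, monotonicity, and the law on the rectangles
  \<open>B \<times> {..b}\<close>, which determine a finite measure.\<close>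

lemma noise_outsourcing:
  fixes P :: "('a \<times> real) measure"
  assumes P: "prob_space P" and sets_P: "sets P = sets (M \<Otimes>\<^sub>M borel)"
  obtains q :: "'a \<Rightarrow> real \<Rightarrow> real" where
    "case_prod q \<in> borel_measurable (M \<Otimes>\<^sub>M lambda1)"
    "\<And>x s t. 0 < s \<Longrightarrow> s \<le> t \<Longrightarrow> t < 1 \<Longrightarrow> q x s \<le> q x t"
    "distr (distr P M fst \<Otimes>\<^sub>M lambda1) (M \<Otimes>\<^sub>M borel) (\<lambda>(x, t). (x, q x t)) = P"
proof -
  interpret P: prob_space P by fact
  note [measurable_cong] = sets_P
  let ?m = "distr P M fst"
  interpret m: prob_space ?m by (rule P.prob_space_distr) simp
  interpret mu: pair_prob_space ?m lambda1 by standard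
  obtain F :: "rat \<Rightarrow> 'a \<Rightarrow> ennreal" where
    F_m[measurable]: "\<And>a. F a \<in> borel_measurable M" and
    F1: "\<And>a x. F a x \<le> 1" and F_mono: "\<And>a b x. a \<le> b \<Longrightarrow> F a x \<le> F b x" and
    F_sup: "\<And>x. 1 \<le> (SUP n::nat. F (of_nat n) x)" and F_inf: "\<And>x. (INF n::nat. F (- of_nat n) x) = 0" and
    F_int: "\<And>b B. B \<in> sets M \<Longrightarrow>
      (\<integral>\<^sup>+x\<in>B. (INF a\<in>{a. b < of_rat a}. F a x) \<partial>?m) = emeasure P (B \<times> {..b})"
    by (rule conditional_cdf_exists[OF P sets_P]) blast
  define S where "S x t = {of_rat a :: real | a. ennreal t \<le> F a x}" for x t
  define q where "q x t = Inf (S x t)" for x t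
  have S_bdd: "bdd_below (S x t)" if "0 < t" for x t
  proof -
    have "(INF n::nat. F (- of_nat n) x) < ennreal t" using that by (simp add: F_inf)
    then obtain n :: nat where "F (- of_nat n) x < ennreal t" by (auto simp: INF_less_iff)
    then have "- of_nat n \<le> a" if "ennreal t \<le> F a x" for a
      using that F_mono[of a "- of_nat n" x] by (auto simp: not_less[symmetric])
    then have "(of_rat (- of_nat n) :: real) \<le> y" if "y \<in> S x t" for y
      using that by (auto simp only: S_def of_rat_less_eq)
    then show ?thesis by (rule bdd_belowI)
  qed
  have S_ne: "S x t \<noteq> {}" if "t < 1" for x t
  proof -
    have "ennreal t < (SUP n::nat. F (of_nat n) x)"
      using that by (intro less_le_trans[OF _ F_sup]) (simp add: ennreal_less_one_iff)
    then obtain n :: nat where "ennreal t < F (of_nat n) x" by (auto simp: less_SUP_iff)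
    then show ?thesis by (auto simp: S_def intro: less_imp_le)
  qed
  have q_le: "q x t \<le> b \<longleftrightarrow> (\<forall>a. b < of_rat a \<longrightarrow> ennreal t \<le> F a x)" if t: "0 < t" "t < 1" for x t b
  proof safe
    fix a assume "q x t \<le> b" "b < of_rat a"
    then have "Inf (S x t) < of_rat a" by (simp add: q_def)
    then obtain a' where "of_rat a' < (of_rat a :: real)" "ennreal t \<le> F a' x"
      using cInf_lessD[OF S_ne[OF t(2)]] by (auto simp: S_def)
    then show "ennreal t \<le> F a x"
      using F_mono[of a' a x] by (simp add: of_rat_less)
  next
    assume *: "\<forall>a. b < of_rat a \<longrightarrow> ennreal t \<le> F a x"
    show "q x t \<le> b"
    proof (rule ccontr)
      assume "\<not> q x t \<le> b"
      then obtain a where a: "b < of_rat a" "of_rat a < q x t" using of_rat_dense[of b "q x t"] by auto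
      then have "of_rat a \<in> S x t" using * by (auto simp: S_def)
      then have "q x t \<le> of_rat a" unfolding q_def by (rule cInf_lower[OF _ S_bdd[OF t(1)]])
      with a show False by simp
    qed
  qed
  have q_m: "(\<lambda>w. q (fst w) (snd w)) \<in> borel_measurable (M \<Otimes>\<^sub>M lambda1)"
  proof (subst borel_measurable_iff_le, intro allI)
    fix b
    have id[measurable]: "(\<lambda>t. t) \<in> borel_measurable lambda1" by (rule measurable_restrict_space1) simp
    have "{w \<in> space (M \<Otimes>\<^sub>M lambda1). q (fst w) (snd w) \<le> b} =
      {w \<in> space (M \<Otimes>\<^sub>M lambda1). \<forall>a. b < of_rat a \<longrightarrow> ennreal (snd w) \<le> F a (fst w)}"
      using q_le by (auto simp: space_pair_measure space_lambda1)
    also have "\<dots> \<in> sets (M \<Otimes>\<^sub>M lambda1)"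
      using measurable_compose[OF measurable_snd id] by measurable
    finally show "{w \<in> space (M \<Otimes>\<^sub>M lambda1). q (fst w) (snd w) \<le> b} \<in> sets (M \<Otimes>\<^sub>M lambda1)" .
  qed
  have q_mono: "q x s \<le> q x t" if "0 < s" "s \<le> t" "t < 1" for x s t
    using that q_le[of s x "q x t"] q_le[of t x "q x t"] by (auto intro: order_trans[OF ennreal_leI])
  let ?f = "\<lambda>(x, t). (x, q x t)"
  have f_m: "?f \<in> measurable (?m \<Otimes>\<^sub>M lambda1) (M \<Otimes>\<^sub>M borel)"
    using q_m by (simp add: split_beta')
  let ?P' = "distr (?m \<Otimes>\<^sub>M lambda1) (M \<Otimes>\<^sub>M borel) ?f"
  have "?P' = P"
  proof (rule measure_eqI_times_atMost[where M=M])
    show "finite_measure ?P'" by (intro mu.finite_measure_distr f_m)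
    fix B :: "'a set" and b assume B[measurable]: "B \<in> sets M"
    let ?V = "?f -` (B \<times> {..b}) \<inter> space (?m \<Otimes>\<^sub>M lambda1)"
    have "emeasure ?P' (B \<times> {..b}) = emeasure (?m \<Otimes>\<^sub>M lambda1) ?V"
      using f_m by (intro emeasure_distr) auto
    also have "\<dots> = (\<integral>\<^sup>+x. emeasure lambda1 (Pair x -` ?V) \<partial>?m)"
      by (rule lambda1.emeasure_pair_measure_alt, rule measurable_sets[OF f_m], rule pair_measureI[OF B]) simp
    also have "\<dots> = (\<integral>\<^sup>+x\<in>B. (INF a\<in>{a. b < of_rat a}. F a x) \<partial>?m)"
    proof (rule nn_integral_cong)
      fix x assume x: "x \<in> space ?m"
      let ?c = "INF a\<in>{a. b < of_rat a}. F a x"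
      obtain a0 :: rat where "b < of_rat a0" using of_rat_dense[of b "b + 1"] by auto
      then have c: "?c \<le> 1" using F1 by (intro INF_lower2[of a0]) auto
      have "Pair x -` ?V = (if x \<in> B then {t\<in>{0<..<1}. ennreal t \<le> ?c} else {})"
        using x q_le by (auto simp: space_pair_measure space_lambda1 le_INF_iff)
      then show "emeasure lambda1 (Pair x -` ?V) = ?c * indicator B x"
        using emeasure_lambda1_le[OF c] by simp
    qed
    also have "\<dots> = emeasure P (B \<times> {..b})" by (rule F_int[OF B])
    finally show "emeasure ?P' (B \<times> {..b}) = emeasure P (B \<times> {..b})" .
  qed (auto simp: sets_P intro: P.finite_measure_axioms)
  with q_m q_mono show ?thesis by (intro that[of q]) (auto simp: split_beta')
qed

lemma nn_integral_distr_on: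
  "T \<in> measurable M N \<Longrightarrow> f \<in> borel_measurable N \<Longrightarrow>
    (\<integral>\<^sup>+y. f y \<partial>distr M N T) = (\<integral>\<^sup>+x. f (T x) \<partial>M)"
  by (rule nn_integral_distr) auto

lemma nn_integral_distr_pair_lambda1:
  assumes f: "f \<in> measurable N M" and "prob_space N"
    and h: "h \<in> borel_measurable (M \<Otimes>\<^sub>M lambda1)"
  shows "(\<integral>\<^sup>+w. h w \<partial>(distr N M f \<Otimes>\<^sub>M lambda1)) = (\<integral>\<^sup>+x. \<integral>\<^sup>+t. h (f x, t) \<partial>lambda1 \<partial>N)"
proof -
  have "(\<integral>\<^sup>+w. h w \<partial>(distr N M f \<Otimes>\<^sub>M lambda1)) = (\<integral>\<^sup>+x. \<integral>\<^sup>+t. h (x, t) \<partial>lambda1 \<partial>distr N M f)"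
    using h by (intro lambda1.nn_integral_fst[symmetric]) (simp cong: measurable_cong_sets)
  also have "\<dots> = (\<integral>\<^sup>+x. \<integral>\<^sup>+t. h (f x, t) \<partial>lambda1 \<partial>N)"
    using h by (intro nn_integral_distr f lambda1.borel_measurable_nn_integral) simp
  finally show ?thesis .
qed

text \<open>The process is the noise path driven by the conditional quantile functions of \<mu>. Its
  law agrees with \<mu> on longer and longer prefixes because \<open>P k\<close>, the joint law of
  past and next coordinate, is reproduced by fresh noise. (inc) is monotonicity of
  \<open>q k x\<close>; (con) holds because the recursion sees \<open>u k\<close> only through the
  value that it produces.\<close>

theorem quantile_process_exists:
  assumes \<mu>: "prob_space \<mu>" and sets_\<mu>: "sets \<mu> = sets (RN N)"
  shows "\<exists>Q. quantile_process N Q \<and> law N Q = \<mu>"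
proof -
  interpret \<mu>: prob_space \<mu> by fact
  note [measurable_cong] = sets_\<mu>
  have sp: "space \<mu> = space (RN N)" using sets_eq_imp_space_eq[OF sets_\<mu>] .
  define pre where "pre k x = (past k x, x k)" for k :: nat and x :: "nat \<Rightarrow> real"
  have re: "(past k) \<in> measurable \<mu> (RN k)" if "k \<le> N" for k
    using that by (subst measurable_cong_sets[OF sets_\<mu> refl]) (auto intro!: measurable_restrict_subset)
  have pre: "pre k \<in> measurable \<mu> (RN k \<Otimes>\<^sub>M borel)" if "k < N" for k
    unfolding pre_def using that re[of k]
    by (intro measurable_Pair) (auto simp: measurable_cong_sets[OF sets_\<mu> refl])
  define P where "P k = distr \<mu> (RN k \<Otimes>\<^sub>M borel) (pre k)" for k
  have P_fst: "distr (P k) (RN k) fst = distr \<mu> (RN k) (past k)" if "k < N" for k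
    unfolding P_def using pre[OF that] by (subst distr_distr) (auto simp: comp_def pre_def)
  define noise where "noise k q \<longleftrightarrow> case_prod q \<in> borel_measurable (RN k \<Otimes>\<^sub>M lambda1) \<and>
    (\<forall>x s t. 0 < s \<longrightarrow> s \<le> t \<longrightarrow> t < 1 \<longrightarrow> q x s \<le> q x t) \<and>
    (k < N \<longrightarrow> distr (distr (P k) (RN k) fst \<Otimes>\<^sub>M lambda1) (RN k \<Otimes>\<^sub>M borel) (\<lambda>(x, t). (x, q x t)) = P k)"
    for k and q :: "(nat \<Rightarrow> real) \<Rightarrow> real \<Rightarrow> real"
  have "\<exists>q. noise k q" for k
  proof (cases "k < N")
    case True
    have "prob_space (P k)" unfolding P_def by (rule \<mu>.prob_space_distr[OF pre[OF True]])
    moreover have "sets (P k) = sets (RN k \<Otimes>\<^sub>M borel)" by (simp add: P_def)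
    ultimately show ?thesis
      by (rule noise_outsourcing) (auto simp: noise_def)
  next
    case False
    then show ?thesis by (intro exI[of _ "\<lambda>_ _. 0"]) (simp add: noise_def)
  qed
  then obtain q where "\<And>k. noise k (q k)" by metis
  then have q: "\<And>k. case_prod (q k) \<in> borel_measurable (RN k \<Otimes>\<^sub>M lambda1)"
    and q_mono: "\<And>k x s t. 0 < s \<Longrightarrow> s \<le> t \<Longrightarrow> t < 1 \<Longrightarrow> q k x s \<le> q k x t"
    and q_law: "\<And>k. k < N \<Longrightarrow> distr (distr (P k) (RN k) fst \<Otimes>\<^sub>M lambda1) (RN k \<Otimes>\<^sub>M borel) (\<lambda>(x, t). (x, q k x t)) = P k"
    unfolding noise_def by blast+
  note np = measurable_noise_path[of q, OF q]
  have law: "distr (lambdaN N) (RN k) (noise_path q k) = distr \<mu> (RN k) (past k)" if "k \<le> N" for k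
    using that
  proof (induction k)
    case 0
    then show ?case
      by (intro measure_eqI)
        (auto simp: emeasure_distr space_PiM_empty sets_PiM_empty PiM_empty lN.emeasure_space_1 \<mu>.emeasure_space_1 split: split_indicator)
  next
    case (Suc k)
    then have k: "k < N" "k \<le> N" by auto
    define g where "g w = (fst w)(k := snd w)" for w :: "(nat \<Rightarrow> real) \<times> real"
    have g[measurable]: "g \<in> measurable (RN k \<Otimes>\<^sub>M borel) (RN (Suc k))"
      unfolding g_def by (rule measurable_fun_upd[where J="{0..<k}"]) auto
    have qf[measurable]: "(\<lambda>(x, t). (x, q k x t)) \<in> measurable (RN k \<Otimes>\<^sub>M lambda1) (RN k \<Otimes>\<^sub>M borel)"
      using q[of k] by (simp add: split_beta')
    have npS: "noise_path q (Suc k) \<in> measurable (lambdaN N) (RN (Suc k))" using Suc.prems by (rule np)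
    show ?case
    proof (rule measure_eqI)
      fix X assume "X \<in> sets (distr (lambdaN N) (RN (Suc k)) (noise_path q (Suc k)))"
      then have X: "X \<in> sets (RN (Suc k))" by simp
      note iX = borel_measurable_indicator[OF X]
      have "emeasure (distr (lambdaN N) (RN (Suc k)) (noise_path q (Suc k))) X
        = (\<integral>\<^sup>+u. indicator X (noise_path q (Suc k) u) \<partial>lambdaN N)"
        using X by (subst nn_integral_distr_on[OF npS iX, symmetric]) simp
      also have "\<dots> = (\<integral>\<^sup>+u. \<integral>\<^sup>+t. indicator X (noise_path q (Suc k) (u(k := t))) \<partial>lambda1 \<partial>lambdaN N)"
        by (rule nn_integral_lambdaN_resample[OF measurable_compose[OF npS iX] k(1)])
      also have "\<dots> = (\<integral>\<^sup>+u. \<integral>\<^sup>+t. indicator X (g ((\<lambda>(x, t). (x, q k x t)) (noise_path q k u, t))) \<partial>lambda1 \<partial>lambdaN N)"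
        using noise_path_cong[of k "u(k := t)" u q for u t] by (simp add: g_def)
      also have "\<dots> = (\<integral>\<^sup>+w. indicator X (g ((\<lambda>(x, t). (x, q k x t)) w)) \<partial>(distr (lambdaN N) (RN k) (noise_path q k) \<Otimes>\<^sub>M lambda1))"
        by (rule nn_integral_distr_pair_lambda1[OF np[OF k(2)] lN.prob_space_axioms
              measurable_compose[OF qf measurable_compose[OF g iX]], symmetric])
      also have "\<dots> = (\<integral>\<^sup>+w. indicator X (g ((\<lambda>(x, t). (x, q k x t)) w)) \<partial>(distr (P k) (RN k) fst \<Otimes>\<^sub>M lambda1))"
        unfolding Suc.IH[OF k(2)] P_fst[OF k(1)] ..
      also have "\<dots> = (\<integral>\<^sup>+w. indicator X (g w) \<partial>P k)"
      proof (subst (2) q_law[OF k(1), symmetric], rule nn_integral_distr_on[symmetric])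
        show "(\<lambda>(x, t). (x, q k x t)) \<in> measurable (distr (P k) (RN k) fst \<Otimes>\<^sub>M lambda1) (RN k \<Otimes>\<^sub>M borel)"
          using qf by (simp cong: measurable_cong_sets)
      qed (rule measurable_compose[OF g iX])
      also have "\<dots> = (\<integral>\<^sup>+x. indicator X (g (pre k x)) \<partial>\<mu>)"
        unfolding P_def by (rule nn_integral_distr_on[OF pre[OF k(1)] measurable_compose[OF g iX]])
      also have "\<dots> = (\<integral>\<^sup>+x. indicator X (restrict x {0..<Suc k}) \<partial>\<mu>)"
      proof -
        have "g (pre k x) = restrict x {0..<Suc k}" for x
          by (auto simp: g_def pre_def fun_eq_iff less_Suc_eq)
        then show ?thesis by simp
      qed
      also have "\<dots> = emeasure (distr \<mu> (RN (Suc k)) (\<lambda>x. restrict x {0..<Suc k})) X"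
        using X by (subst nn_integral_distr_on[OF re[OF Suc.prems] iX, symmetric]) simp
      finally show "emeasure (distr (lambdaN N) (RN (Suc k)) (noise_path q (Suc k))) X
        = emeasure (distr \<mu> (RN (Suc k)) (\<lambda>x. restrict x {0..<Suc k})) X" .
    qed simp
  qed
  have "distr \<mu> (RN N) (past N) = distr \<mu> \<mu> (\<lambda>x. x)"
    by (intro distr_cong) (auto simp: sets_\<mu> sp space_PiM PiE_iff extensional_restrict)
  with law[of N] have "distr (lambdaN N) (RN N) (noise_path q N) = \<mu>" by simp
  moreover have "quantile_process N (noise_path q N)"
    unfolding quantile_process_def triangular_def
  proof (intro conjI allI ballI impI)
    show "noise_path q N \<in> measurable (lambdaN N) (RN N)" by (rule np) simp
  next
    fix k and u v :: "nat \<Rightarrow> real" assume "k < N" "\<forall>i\<le>k. u i = v i"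
    then show "noise_path q N u k = noise_path q N v k"
      using noise_path_cong[of k u v q] by (simp add: noise_path_nth)
  next
    fix k t and u :: "nat \<Rightarrow> real" assume k: "k < N" and u: "u \<in> space (lambdaN N)" and t: "t \<in> {0<..<1}" "u k \<le> t"
    have prefix: "noise_path q k (u(k := t)) = noise_path q k u" by (rule noise_path_cong) simp
    have "0 < u k" using u k by (auto simp: space_lambdaN)
    then show "noise_path q N u k \<le> noise_path q N (u(k := t)) k"
      using t k by (simp add: noise_path_nth prefix q_mono)
    fix m assume eq: "noise_path q N u k = noise_path q N (u(k := t)) k" and m: "m \<in> {k..<N}"
    \<comment> \<open>Once the common value at \<open>k\<close> has been appended, both paths agree
      and are fed the same noise from then on.\<close>
    have "k \<le> j \<Longrightarrow> noise_path q (Suc j) u = noise_path q (Suc j) (u(k := t))" for j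
    proof (induction j rule: dec_induct)
      case base
      have "q k (noise_path q k u) (u k) = q k (noise_path q k u) t"
        using eq k by (simp add: noise_path_nth prefix)
      then show ?case by (simp only: noise_path.simps(2) prefix fun_upd_same)
    next
      case (step j)
      then have "(u(k := t)) (Suc j) = u (Suc j)" by simp
      with step.IH show ?case by (simp only: noise_path.simps(2)[of q "Suc j"])
    qed
    then have "noise_path q (Suc m) u = noise_path q (Suc m) (u(k := t))" using m by simp
    moreover have "noise_path q N w m = noise_path q (Suc m) w m" for w
      by (rule noise_path_prefix) (use m in auto)
    ultimately show "noise_path q N u m = noise_path q N (u(k := t)) m" by (simp only:)
  qed
  ultimately show ?thesis by blast
qed

lemma Qproc:
  assumes "\<mu> \<in> P_space p N"
  shows quantile_process_Qproc: "quantile_process N (Qproc N \<mu>)"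
    and distr_Qproc: "law N (Qproc N \<mu>) = \<mu>"
  using someI_ex[OF quantile_process_exists[of \<mu> N]] assms by (auto simp: P_space_def Qproc_def)

section \<open>Conditional means under bicausal couplings\<close>

lemma disintegration_kernel:
  assumes "disintegration M N \<mu> K"
  shows "K k \<in> measurable (paths k M) (subprob_algebra M)"
    and "x \<in> space (paths k M) \<Longrightarrow> prob_space (K k x)"
    and "x \<in> space (paths k M) \<Longrightarrow> sets (K k x) = sets M"
proof -
  interpret Ionescu_Tulcea K "\<lambda>_. M" using assms by (simp add: disintegration_def)
  show "K k \<in> measurable (paths k M) (subprob_algebra M)" by (rule P)
  show "x \<in> space (paths k M) \<Longrightarrow> prob_space (K k x)" by (rule prob_space_P)
  show "x \<in> space (paths k M) \<Longrightarrow> sets (K k x) = sets M" by (rule sets_P)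
qed

lemma disintegration_sets:
  assumes "disintegration M N \<mu> K"
  shows "sets \<mu> = sets (paths N M)" and "prob_space \<mu>"
proof -
  interpret Ionescu_Tulcea K "\<lambda>_. M" using assms by (simp add: disintegration_def)
  have \<mu>: "\<mu> = C 0 N (\<lambda>_. undefined)" using assms by (simp add: disintegration_def)
  have u: "(\<lambda>_. undefined) \<in> space (paths 0 M)" by (simp add: space_PiM_empty)
  show "sets \<mu> = sets (paths N M)" using sets_C[OF u, of N] by (simp add: \<mu>)
  show "prob_space \<mu>" unfolding \<mu> by (rule prob_space_C[OF u])
qed

lemma measurable_restrict_prefix:
  fixes k N :: nat
  assumes "sets \<mu> = sets (paths N M)" "k \<le> N"
  shows "(past k) \<in> measurable \<mu> (paths k M)"
  using assms(2) by (subst measurable_cong_sets[OF assms(1) refl]) (auto intro!: measurable_restrict_subset)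

text \<open>Both kernels turn \<open>f\<close> into a density of the same measure with respect to
  the law of the past, and densities are unique almost everywhere. The exceptional set may depend on
  \<open>f\<close>, which is harmless since only one test function is compared at a time.\<close>

lemma disintegration_unique_nn:
  assumes D: "disintegration M N \<mu> K" and D': "disintegration M N \<mu> K'" and k: "k < N"
    and f: "f \<in> borel_measurable M"
  shows "AE x in \<mu>. (\<integral>\<^sup>+w. f w \<partial>K k (past k x)) = (\<integral>\<^sup>+w. f w \<partial>K' k (past k x))"
proof -
  let ?R = "paths k M"
  interpret \<mu>: prob_space \<mu> by (rule disintegration_sets(2)[OF D])
  have re: "(past k) \<in> measurable \<mu> ?R"
    using k by (intro measurable_restrict_prefix[OF disintegration_sets(1)[OF D]]) simp
  let ?m = "distr \<mu> ?R (past k)"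
  interpret m: prob_space ?m by (rule \<mu>.prob_space_distr[OF re])
  let ?J = "\<lambda>L B. \<integral>\<^sup>+x\<in>B. (\<integral>\<^sup>+w. f w \<partial>L k x) \<partial>?m"
  have kernel_int: "(\<lambda>x. \<integral>\<^sup>+w. f w \<partial>L k x) \<in> borel_measurable ?R"
    "B \<in> sets ?R \<Longrightarrow> ?J L B = (\<integral>\<^sup>+x. f (x k) * indicator B (past k x) \<partial>\<mu>)"
    if L: "disintegration M N \<mu> L" for L B
  proof -
    show 1: "(\<lambda>x. \<integral>\<^sup>+w. f w \<partial>L k x) \<in> borel_measurable ?R"
      by (rule measurable_compose[OF disintegration_kernel(1)[OF L] nn_integral_measurable_subprob_algebra[OF f]])
    assume B[measurable]: "B \<in> sets ?R"
    note [measurable] = f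
    have h: "(\<lambda>w. f (snd w) * indicator B (fst w)) \<in> borel_measurable (?R \<Otimes>\<^sub>M M)" by measurable
    have "?J L B = (\<integral>\<^sup>+x. (\<integral>\<^sup>+w. f w \<partial>L k (past k x)) * indicator B (past k x) \<partial>\<mu>)"
      using 1 by (intro nn_integral_distr_on[OF re]) auto
    also have "\<dots> = (\<integral>\<^sup>+x. \<integral>\<^sup>+w. f w * indicator B (past k x) \<partial>L k (past k x) \<partial>\<mu>)"
    proof (intro nn_integral_cong nn_integral_multc[symmetric])
      fix x assume "x \<in> space \<mu>"
      from disintegration_kernel(3)[OF L measurable_space[OF re this]]
      show "f \<in> borel_measurable (L k (past k x))"
        using f by (subst measurable_cong_sets) auto
    qed
    also have "\<dots> = (\<integral>\<^sup>+x. f (x k) * indicator B (past k x) \<partial>\<mu>)"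
      using nn_integral_disintegration[OF L k h] by (simp del: restrict_apply)
    finally show "?J L B = (\<integral>\<^sup>+x. f (x k) * indicator B (past k x) \<partial>\<mu>)" .
  qed
  have "AE x in ?m. (\<integral>\<^sup>+w. f w \<partial>K k x) = (\<integral>\<^sup>+w. f w \<partial>K' k x)"
    using kernel_int(1)[OF D] kernel_int(1)[OF D'] kernel_int(2)[OF D] kernel_int(2)[OF D']
    by (intro m.density_unique2) auto
  then show ?thesis
    by (subst (asm) AE_distr_iff[OF re]) (use kernel_int(1)[OF D] kernel_int(1)[OF D'] in auto)
qed

lemma disintegration_unique:
  fixes f :: "'a \<Rightarrow> real"
  assumes D: "disintegration M N \<mu> K" and D': "disintegration M N \<mu> K'" and k: "k < N"
    and f: "f \<in> borel_measurable M" and f01: "\<And>w. 0 \<le> f w" "\<And>w. f w \<le> 1"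
  shows "AE x in \<mu>. (\<integral>w. f w \<partial>K k (past k x)) = (\<integral>w. f w \<partial>K' k (past k x))"
proof -
  have re: "(past k) \<in> measurable \<mu> (paths k M)"
    using k by (intro measurable_restrict_prefix[OF disintegration_sets(1)[OF D]]) simp
  have *: "(\<integral>w. f w \<partial>L k (past k x)) = enn2real (\<integral>\<^sup>+w. ennreal (f w) \<partial>L k (past k x))"
    if L: "disintegration M N \<mu> L" and x: "x \<in> space \<mu>" for L x
    using disintegration_kernel(3)[OF L measurable_space[OF re x]] f f01
    by (intro integral_eq_nn_integral) (auto cong: measurable_cong_sets)
  have "AE x in \<mu>. (\<integral>\<^sup>+w. ennreal (f w) \<partial>K k (past k x)) = (\<integral>\<^sup>+w. ennreal (f w) \<partial>K' k (past k x))"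
    using f f01 by (intro disintegration_unique_nn[OF D D' k]) auto
  with AE_space show ?thesis
    by eventually_elim (simp add: *[OF D] *[OF D'] del: restrict_apply)
qed

section \<open>Conditional means of the next coordinate\<close>

definition cond_mean ::
  "nat \<Rightarrow> ((nat \<Rightarrow> real) \<Rightarrow> nat \<Rightarrow> real) \<Rightarrow> (real \<Rightarrow> real) \<Rightarrow> nat \<Rightarrow> (nat \<Rightarrow> real) \<Rightarrow> real" where
  "cond_mean N Q f k x = (\<integral>t. f (cond_quantile N Q k x t) \<partial>lambda1)"

lemma measurable_cond_mean:
  assumes Q: "Q \<in> measurable (lambdaN N) (RN N)" and f: "f \<in> borel_measurable borel"
  shows "cond_mean N Q f k \<in> borel_measurable (RN k)"
proof -
  have "(\<lambda>w. f (cond_quantile N Q k (fst w) (snd w))) \<in> borel_measurable (RN k \<Otimes>\<^sub>M lambda1)"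
    using measurable_compose[OF measurable_cond_quantile[OF Q] f, of k] by (simp add: split_beta')
  then show ?thesis
    unfolding cond_mean_def by (intro lambda1.borel_measurable_lebesgue_integral) (simp add: split_beta')
qed

text \<open>A non-integrable \<open>f\<close> is covered by the default value \<open>0\<close> of
  the Bochner integral.\<close>

lemma (in prob_space) integral_unit_interval:
  fixes f :: "'a \<Rightarrow> real"
  assumes "\<And>x. 0 \<le> f x" "\<And>x. f x \<le> 1"
  shows "0 \<le> (\<integral>x. f x \<partial>M)" "(\<integral>x. f x \<partial>M) \<le> 1"
proof -
  show "0 \<le> (\<integral>x. f x \<partial>M)" by (intro integral_nonneg_AE) (simp add: assms)
  show "(\<integral>x. f x \<partial>M) \<le> 1"
    using assms integral_mono_AE[of M f "\<lambda>_. 1"] by (cases "integrable M f") (auto simp: not_integrable_integral_eq prob_space)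
qed

lemma cond_mean_eq_kernel:
  assumes Q: "Q \<in> measurable (lambdaN N) (RN N)" and f: "f \<in> borel_measurable borel" and x: "x \<in> space (RN k)"
  shows "(\<integral>w. f w \<partial>distr lambda1 borel (cond_quantile N Q k x)) = cond_mean N Q f k x"
  unfolding cond_mean_def
  using measurable_compose_Pair1[OF x measurable_cond_quantile[OF Q]] f by (intro integral_distr) simp_all

lemma AE_kernel_eq_cond_mean:
  assumes Q: "quantile_process N Q" and A: "disintegration borel N (law N Q) A"
    and g: "g \<in> measurable \<pi> (RN N)" "distr \<pi> (RN N) g = law N Q"
    and k: "k < N" and f: "f \<in> borel_measurable borel" "\<And>w. 0 \<le> f w" "\<And>w. f w \<le> 1"
  shows "AE z in \<pi>. (\<integral>w. f w \<partial>A k (past k (g z))) = cond_mean N Q f k (past k (g z))"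
proof -
  have "AE x in distr \<pi> (RN N) g. (\<integral>w. f w \<partial>A k (past k x))
    = (\<integral>w. f w \<partial>distr lambda1 borel (cond_quantile N Q k (past k x)))"
    unfolding g(2) by (rule disintegration_unique[OF A disintegration_quantile_process[OF Q] k f])
  from AE_distrD[OF g(1) this] AE_space show ?thesis
  proof eventually_elim
    case (elim z)
    then have "past k (g z) \<in> space (RN k)"
      using k measurable_space[OF g(1)] by (auto simp: space_PiM)
    with elim show ?case by (simp add: cond_mean_eq_kernel[OF quantile_processD(2)[OF Q] f(1)] del: restrict_apply)
  qed
qed

lemma bicausal_marginals:
  assumes \<pi>: "\<pi> \<in> bicausal N \<mu> \<nu>" and \<mu>: "prob_space \<mu>"
    and sets: "sets \<mu> = sets (RN N)" "sets \<nu> = sets (RN N)"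
  shows "sets \<pi> = sets (RN N \<Otimes>\<^sub>M RN N)" "distr \<pi> (RN N) fst = \<mu>" "distr \<pi> (RN N) snd = \<nu>"
    and "prob_space \<pi>" "fst \<in> measurable \<pi> (RN N)" "snd \<in> measurable \<pi> (RN N)"
proof -
  have c: "sets \<pi> = sets (\<mu> \<Otimes>\<^sub>M \<nu>)" "distr \<pi> \<mu> fst = \<mu>" "distr \<pi> \<nu> snd = \<nu>"
    using \<pi> by (auto simp: bicausal_def coupling_def)
  show s: "sets \<pi> = sets (RN N \<Otimes>\<^sub>M RN N)" using c(1) sets by (simp cong: sets_pair_measure_cong)
  show f: "fst \<in> measurable \<pi> (RN N)" "snd \<in> measurable \<pi> (RN N)"
    by (simp_all add: measurable_cong_sets[OF s refl])
  have "distr \<pi> (RN N) fst = distr \<pi> \<mu> fst" by (intro distr_cong) (auto simp: sets)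
  then show d: "distr \<pi> (RN N) fst = \<mu>" using c by simp
  have "distr \<pi> (RN N) snd = distr \<pi> \<nu> snd" by (intro distr_cong) (auto simp: sets)
  then show "distr \<pi> (RN N) snd = \<nu>" using c by simp
  show "prob_space \<pi>" using \<mu> by (intro prob_space_distrD[OF f(1)]) (simp add: d)
qed

text \<open>This is where the causality constraint is exploited. Given the joint past, the next pair
  is distributed according to a coupling of the two separate kernels, so the difference of the two
  conditional means is at most the conditional mean of the difference; the tower property for the
  zipped coupling then removes the conditioning. For an arbitrary coupling, the marginals of the
  conditional law could depend on both pasts, and the comparison would fail.\<close>

lemma bicausal_cond_mean_le:
  assumes Q: "quantile_process N Q" and Q': "quantile_process N Q'"
    and \<pi>: "\<pi> \<in> bicausal N (law N Q) (law N Q')"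
    and k: "k < N" and f[measurable]: "f \<in> borel_measurable borel" and f01: "\<And>w. 0 \<le> f w" "\<And>w. f w \<le> 1"
  shows "(\<integral>z. \<bar>cond_mean N Q f k (past k (fst z)) - cond_mean N Q' f k (past k (snd z))\<bar> \<partial>\<pi>)
    \<le> (\<integral>z. \<bar>f (fst z k) - f (snd z k)\<bar> \<partial>\<pi>)"
proof -
  let ?\<mu> = "law N Q" and ?\<nu> = "law N Q'"
  let ?B = "borel \<Otimes>\<^sub>M borel :: (real \<times> real) measure"
  obtain K A B where K: "disintegration ?B N (distr \<pi> (paths N ?B) (zip_upto N)) K"
    and A: "disintegration borel N ?\<mu> A" and B: "disintegration borel N ?\<nu> B"
    and AE_coup: "AE z in \<pi>. \<forall>k<N. coupling (A k (past k (fst z))) (B k (past k (snd z))) (K k (zip_upto k z))"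
    using \<pi> unfolding bicausal_def by blast
  have "prob_space ?\<mu>" by (rule disintegration_sets(2)[OF A])
  note marg = bicausal_marginals[OF \<pi> this sets_distr sets_distr]
  note [measurable_cong] = marg(1)
  have sp: "space \<pi> = space (RN N \<Otimes>\<^sub>M RN N)" by (rule sets_eq_imp_space_eq[OF marg(1)])
  have zip: "zip_upto N \<in> measurable \<pi> (paths N ?B)"
    using measurable_zip_upto by (simp add: measurable_cong_sets[OF marg(1) refl])
  interpret \<pi>: prob_space \<pi> by (rule marg(4))
  note fst_m = marg(5) and snd_m = marg(6)
  note 1 = AE_kernel_eq_cond_mean[OF Q A fst_m marg(2) k f f01]
  note 2 = AE_kernel_eq_cond_mean[OF Q' B snd_m marg(3) k f f01]
  let ?a = "\<lambda>z. cond_mean N Q f k (past k (fst z))" and ?b = "\<lambda>z. cond_mean N Q' f k (past k (snd z))"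
  let ?h = "\<lambda>w. ennreal \<bar>f (fst w) - f (snd w)\<bar>"
  have zip_restrict: "past k (zip_upto N z) = zip_upto k z" for z :: "(nat \<Rightarrow> real) \<times> (nat \<Rightarrow> real)"
    using k by (auto simp: zip_upto_def fun_eq_iff)
  have re: "(past k) \<in> measurable (paths N ?B) (paths k ?B)"
    using k by (intro measurable_restrict_prefix[OF refl]) simp
  have "AE z in \<pi>. ennreal \<bar>?a z - ?b z\<bar>
    \<le> (\<integral>\<^sup>+w. ?h w \<partial>K k (past k (zip_upto N z)))"
    using 1 2 AE_coup AE_space
  proof eventually_elim
    case (elim z)
    let ?K = "K k (zip_upto k z)" and ?ka = "A k (past k (fst z))" and ?kb = "B k (past k (snd z))"
    have x: "past k (fst z) \<in> space (RN k)" "past k (snd z) \<in> space (RN k)"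
      using elim(4) k by (auto simp: sp space_pair_measure space_PiM)
    have zk: "zip_upto k z \<in> space (paths k ?B)"
      using measurable_space[OF re measurable_space[OF zip elim(4)]] by (simp add: zip_restrict del: restrict_apply)
    have sa: "sets ?ka = sets borel" and sb: "sets ?kb = sets borel"
      using disintegration_kernel(3)[OF A x(1)] disintegration_kernel(3)[OF B x(2)] by auto
    have sK[measurable_cong]: "sets ?K = sets ?B" by (rule disintegration_kernel(3)[OF K zk])
    interpret K: prob_space ?K by (rule disintegration_kernel(2)[OF K zk])
    have cp: "distr ?K ?ka fst = ?ka" "distr ?K ?kb snd = ?kb"
      using elim(3) k by (auto simp: coupling_def)
    have "(\<integral>w. f w \<partial>?ka) = (\<integral>w. f (fst w) \<partial>?K)"
      by (subst cp(1)[symmetric], rule integral_distr) (simp_all cong: measurable_cong_sets add: sa)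
    moreover have "(\<integral>w. f w \<partial>?kb) = (\<integral>w. f (snd w) \<partial>?K)"
      by (subst cp(2)[symmetric], rule integral_distr) (simp_all cong: measurable_cong_sets add: sb)
    moreover have int: "integrable ?K (\<lambda>w. f (fst w))" "integrable ?K (\<lambda>w. f (snd w))"
      using f01 by (auto intro!: K.integrable_const_bound[where B=1])
    ultimately have "\<bar>?a z - ?b z\<bar>
      = \<bar>\<integral>w. f (fst w) - f (snd w) \<partial>?K\<bar>"
      using elim(1,2) by (simp del: restrict_apply)
    also have "\<dots> \<le> (\<integral>w. \<bar>f (fst w) - f (snd w)\<bar> \<partial>?K)" by (rule integral_abs_bound)
    finally have "ennreal \<bar>?a z - ?b z\<bar>
      \<le> ennreal (\<integral>w. \<bar>f (fst w) - f (snd w)\<bar> \<partial>?K)" by (rule ennreal_leI)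
    also have "\<dots> = (\<integral>\<^sup>+w. ?h w \<partial>?K)"
      using int by (intro nn_integral_eq_integral[symmetric]) auto
    finally show ?case by (simp add: zip_restrict del: restrict_apply)
  qed
  then have "(\<integral>\<^sup>+z. ennreal \<bar>?a z - ?b z\<bar> \<partial>\<pi>)
    \<le> (\<integral>\<^sup>+z. \<integral>\<^sup>+w. ?h w \<partial>K k (past k (zip_upto N z)) \<partial>\<pi>)"
    by (rule nn_integral_mono_AE)
  also have "\<dots> = (\<integral>\<^sup>+y. \<integral>\<^sup>+w. ?h w \<partial>K k (past k y) \<partial>distr \<pi> (paths N ?B) (zip_upto N))"
    by (intro nn_integral_distr_on[OF zip, symmetric] measurable_compose[OF re]
        measurable_compose[OF disintegration_kernel(1)[OF K] nn_integral_measurable_subprob_algebra]) measurable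
  also have "\<dots> = (\<integral>\<^sup>+y. ?h (y k) \<partial>distr \<pi> (paths N ?B) (zip_upto N))"
    using nn_integral_disintegration[OF K k, of "\<lambda>w. ?h (snd w)"] by simp
  also have "\<dots> = (\<integral>\<^sup>+z. ?h (zip_upto N z k) \<partial>\<pi>)"
  proof (rule nn_integral_distr_on[OF zip])
    have "(\<lambda>y. y k) \<in> measurable (paths N ?B) ?B" using k by simp
    then show "(\<lambda>y. ?h (y k)) \<in> borel_measurable (paths N ?B)" by measurable
  qed
  also have "\<dots> = (\<integral>\<^sup>+z. ennreal \<bar>f (fst z k) - f (snd z k)\<bar> \<partial>\<pi>)"
    using k by (simp add: zip_upto_def)
  finally have le: "(\<integral>\<^sup>+z. ennreal \<bar>?a z - ?b z\<bar> \<partial>\<pi>)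
    \<le> (\<integral>\<^sup>+z. ennreal \<bar>f (fst z k) - f (snd z k)\<bar> \<partial>\<pi>)" .
  have m1: "(\<lambda>z. f (fst z k)) \<in> borel_measurable \<pi>" "(\<lambda>z. f (snd z k)) \<in> borel_measurable \<pi>"
    using k by (auto intro!: measurable_compose[OF _ f] measurable_compose[OF fst_m measurable_component_singleton]
        measurable_compose[OF snd_m measurable_component_singleton])
  have int1: "integrable \<pi> (\<lambda>z. \<bar>f (fst z k) - f (snd z k)\<bar>)"
  proof (rule \<pi>.integrable_const_bound[where B=1])
    have "\<bar>f a - f b\<bar> \<le> 1" for a b using f01(1)[of a] f01(2)[of a] f01(1)[of b] f01(2)[of b] by linarith
    then show "AE z in \<pi>. norm \<bar>f (fst z k) - f (snd z k)\<bar> \<le> 1" by simp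
  qed (use m1 in simp)
  have reN: "(past k) \<in> measurable (RN N) (RN k)"
    using k by (intro measurable_restrict_prefix[OF refl]) simp
  have m2: "(\<lambda>z. ?a z) \<in> borel_measurable \<pi>"
    "(\<lambda>z. ?b z) \<in> borel_measurable \<pi>"
    by (rule measurable_compose[OF fst_m measurable_compose[OF reN measurable_cond_mean[OF quantile_processD(2)[OF Q] f]]]
        measurable_compose[OF snd_m measurable_compose[OF reN measurable_cond_mean[OF quantile_processD(2)[OF Q'] f]]])+
  have "enn2real (\<integral>\<^sup>+z. ennreal \<bar>?a z - ?b z\<bar> \<partial>\<pi>)
    \<le> enn2real (\<integral>\<^sup>+z. ennreal \<bar>f (fst z k) - f (snd z k)\<bar> \<partial>\<pi>)"
    using le int1 by (intro enn2real_mono) (auto simp: nn_integral_eq_integral)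
  then show ?thesis
    using m1 m2 by (subst (1 2) integral_eq_nn_integral) (auto simp del: restrict_apply)
qed

section \<open>Lipschitz approximation and transfer between couplings\<close>

text \<open>Additive over the coordinates, in contrast to the truncated Euclidean norm, so that an
  induction over coordinates adds one summand at a time. Its mean still measures convergence in
  probability.\<close>

definition trunc_dist :: "nat \<Rightarrow> (nat \<Rightarrow> real) \<Rightarrow> (nat \<Rightarrow> real) \<Rightarrow> real" where
  "trunc_dist k x y = (\<Sum>i<k. min \<bar>x i - y i\<bar> 1)"

lemma trunc_dist_nonneg: "0 \<le> trunc_dist k x y"
  by (simp add: trunc_dist_def sum_nonneg)

lemma trunc_dist_le: "trunc_dist k x y \<le> real k"
  unfolding trunc_dist_def using sum_bounded_above[of "{..<k}" "\<lambda>i. min \<bar>x i - y i\<bar> 1" 1] by simp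

lemma trunc_dist_commute: "trunc_dist k x y = trunc_dist k y x"
  by (simp add: trunc_dist_def abs_minus_commute)

lemma borel_measurable_trunc_dist:
  assumes "\<And>i. i < k \<Longrightarrow> (\<lambda>w. f w i) \<in> borel_measurable M" "\<And>i. i < k \<Longrightarrow> (\<lambda>w. g w i) \<in> borel_measurable M"
  shows "(\<lambda>w. trunc_dist k (f w) (g w)) \<in> borel_measurable M"
  unfolding trunc_dist_def using assms by (intro borel_measurable_sum) simp

text \<open>Lipschitz for the truncated distance, hence of bounded oscillation: such a function is
  integrable against every finite measure, and its variation along a coupling is controlled by
  closeness in probability.\<close>

definition trunc_lipschitz :: "nat \<Rightarrow> real \<Rightarrow> ((nat \<Rightarrow> real) \<Rightarrow> real) \<Rightarrow> bool" where
  "trunc_lipschitz k L g \<longleftrightarrow> g \<in> borel_measurable (RN k) \<and> 0 \<le> L \<and> (\<forall>x y. \<bar>g x - g y\<bar> \<le> L * trunc_dist k x y)"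

lemma trunc_lipschitz_add:
  assumes "trunc_lipschitz k L g" "trunc_lipschitz k L' g'"
  shows "trunc_lipschitz k (L + L') (\<lambda>x. g x + g' x)"
  unfolding trunc_lipschitz_def
proof (intro conjI allI)
  fix x y
  have "\<bar>g x - g y\<bar> \<le> L * trunc_dist k x y" "\<bar>g' x - g' y\<bar> \<le> L' * trunc_dist k x y"
    using assms by (auto simp: trunc_lipschitz_def)
  then show "\<bar>g x + g' x - (g y + g' y)\<bar> \<le> (L + L') * trunc_dist k x y"
    by (simp add: distrib_right)
qed (use assms in \<open>auto simp: trunc_lipschitz_def\<close>)

lemma trunc_lipschitz_scale:
  assumes "trunc_lipschitz k L g"
  shows "trunc_lipschitz k (\<bar>c\<bar> * L) (\<lambda>x. c * g x)"
  unfolding trunc_lipschitz_def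
proof (intro conjI allI)
  fix x y
  have "\<bar>c\<bar> * \<bar>g x - g y\<bar> \<le> \<bar>c\<bar> * (L * trunc_dist k x y)"
    using assms by (intro mult_left_mono) (auto simp: trunc_lipschitz_def)
  then show "\<bar>c * g x - c * g y\<bar> \<le> \<bar>c\<bar> * L * trunc_dist k x y"
    by (simp add: abs_mult[symmetric] right_diff_distrib mult.assoc)
qed (use assms in \<open>auto simp: trunc_lipschitz_def\<close>)

lemma (in finite_measure) integrable_trunc_lipschitz:
  assumes g: "trunc_lipschitz k L g" and X: "X \<in> measurable M (RN k)"
  shows "integrable M (\<lambda>x. g (X x))"
proof (rule integrable_const_bound)
  have "\<bar>g x\<bar> \<le> \<bar>g (\<lambda>_. 0)\<bar> + L * real k" for x
  proof -
    have "\<bar>g x - g (\<lambda>_. 0)\<bar> \<le> L * trunc_dist k x (\<lambda>_. 0)" using g by (simp add: trunc_lipschitz_def)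
    also have "\<dots> \<le> L * real k" using g by (intro mult_left_mono trunc_dist_le) (simp add: trunc_lipschitz_def)
    finally show ?thesis by linarith
  qed
  then show "AE x in M. norm (g (X x)) \<le> \<bar>g (\<lambda>_. 0)\<bar> + L * real k" by simp
  show "(\<lambda>x. g (X x)) \<in> borel_measurable M"
    using g by (intro measurable_compose[OF X]) (simp add: trunc_lipschitz_def)
qed

section \<open>Density of Lipschitz functions in \<open>L\<^sub>1\<close>\<close>

definition approximable :: "nat \<Rightarrow> (nat \<Rightarrow> real) measure \<Rightarrow> ((nat \<Rightarrow> real) \<Rightarrow> real) \<Rightarrow> bool" where
  "approximable k m \<kappa> \<longleftrightarrow> (\<forall>\<epsilon>>0. \<exists>g L. trunc_lipschitz k L g \<and> (\<integral>x. \<bar>\<kappa> x - g x\<bar> \<partial>m) < \<epsilon>)"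

context
  fixes k :: nat and m :: "(nat \<Rightarrow> real) measure"
  assumes m: "finite_measure m" and sets_m: "sets m = sets (RN k)"
begin

interpretation m: finite_measure m by (rule m)

lemma integrable_indicator_finite: "A \<in> sets m \<Longrightarrow> integrable m (indicator A :: _ \<Rightarrow> real)"
  by (rule integrable_real_indicator) (auto simp: less_top[symmetric] m.emeasure_finite)

lemma integrable_trunc_lipschitz': "trunc_lipschitz k L g \<Longrightarrow> integrable m g"
  using m.integrable_trunc_lipschitz[of k L g "\<lambda>x. x"] by (simp add: measurable_ident_sets sets_m)

lemma approximable_trunc_lipschitz: "trunc_lipschitz k L g \<Longrightarrow> approximable k m g"
  unfolding approximable_def by (intro allI impI exI[of _ g] exI[of _ L]) simp

lemma approximable_add:
  assumes \<kappa>: "integrable m \<kappa>" "integrable m \<kappa>'"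
    and "approximable k m \<kappa>" "approximable k m \<kappa>'"
  shows "approximable k m (\<lambda>x. \<kappa> x + \<kappa>' x)"
  unfolding approximable_def
proof (intro allI impI)
  fix \<epsilon> :: real assume "0 < \<epsilon>"
  then have "0 < \<epsilon> / 2" by simp
  with assms obtain g L g' L' where g: "trunc_lipschitz k L g" "(\<integral>x. \<bar>\<kappa> x - g x\<bar> \<partial>m) < \<epsilon> / 2"
    and g': "trunc_lipschitz k L' g'" "(\<integral>x. \<bar>\<kappa>' x - g' x\<bar> \<partial>m) < \<epsilon> / 2"
    unfolding approximable_def by blast
  have int: "integrable m (\<lambda>x. \<bar>\<kappa> x - g x\<bar>)" "integrable m (\<lambda>x. \<bar>\<kappa>' x - g' x\<bar>)"
    using \<kappa> integrable_trunc_lipschitz'[OF g(1)] integrable_trunc_lipschitz'[OF g'(1)] by simp_all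
  have "(\<integral>x. \<bar>\<kappa> x + \<kappa>' x - (g x + g' x)\<bar> \<partial>m) \<le> (\<integral>x. \<bar>\<kappa> x - g x\<bar> + \<bar>\<kappa>' x - g' x\<bar> \<partial>m)"
    using \<kappa> integrable_trunc_lipschitz'[OF g(1)] integrable_trunc_lipschitz'[OF g'(1)]
    by (intro integral_mono) auto
  also have "\<dots> < \<epsilon>" using int g(2) g'(2) by simp
  finally show "\<exists>g L. trunc_lipschitz k L g \<and> (\<integral>x. \<bar>\<kappa> x + \<kappa>' x - g x\<bar> \<partial>m) < \<epsilon>"
    using trunc_lipschitz_add[OF g(1) g'(1)] by (intro exI[of _ "\<lambda>x. g x + g' x"] exI[of _ "L + L'"]) simp
qed

lemma approximable_scale:
  assumes "approximable k m \<kappa>"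
  shows "approximable k m (\<lambda>x. c * \<kappa> x)"
  unfolding approximable_def
proof (intro allI impI)
  fix \<epsilon> :: real assume "0 < \<epsilon>"
  then have "0 < \<epsilon> / (\<bar>c\<bar> + 1)" by simp
  with assms obtain g L where g: "trunc_lipschitz k L g" "(\<integral>x. \<bar>\<kappa> x - g x\<bar> \<partial>m) < \<epsilon> / (\<bar>c\<bar> + 1)"
    unfolding approximable_def by blast
  have "(\<integral>x. \<bar>c * \<kappa> x - c * g x\<bar> \<partial>m) = \<bar>c\<bar> * (\<integral>x. \<bar>\<kappa> x - g x\<bar> \<partial>m)"
    by (simp add: abs_mult right_diff_distrib[symmetric])
  also have "\<dots> \<le> (\<bar>c\<bar> + 1) * (\<integral>x. \<bar>\<kappa> x - g x\<bar> \<partial>m)"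
    by (intro mult_right_mono integral_nonneg_AE) auto
  also have "\<dots> < \<epsilon>" using g(2) by (simp add: field_simps)
  finally show "\<exists>g L. trunc_lipschitz k L g \<and> (\<integral>x. \<bar>c * \<kappa> x - g x\<bar> \<partial>m) < \<epsilon>"
    using trunc_lipschitz_scale[OF g(1), of c] by blast
qed

lemma approximable_lim:
  assumes s: "\<And>n. integrable m (s n)" "\<And>n. approximable k m (s n)"
    and \<kappa>: "integrable m \<kappa>" and w: "integrable m w"
    and lim: "\<And>x. x \<in> space m \<Longrightarrow> (\<lambda>n. s n x) \<longlonglongrightarrow> \<kappa> x"
    and dom: "\<And>n x. x \<in> space m \<Longrightarrow> \<bar>s n x\<bar> \<le> w x"
  shows "approximable k m \<kappa>"
  unfolding approximable_def
proof (intro allI impI)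
  fix \<epsilon> :: real assume \<epsilon>: "0 < \<epsilon>"
  have "(\<lambda>n. \<integral>x. \<bar>s n x - \<kappa> x\<bar> \<partial>m) \<longlonglongrightarrow> (\<integral>x. 0 \<partial>m)"
  proof (rule integral_dominated_convergence[where w="\<lambda>x. w x + \<bar>\<kappa> x\<bar>"])
    show "AE x in m. (\<lambda>n. \<bar>s n x - \<kappa> x\<bar>) \<longlonglongrightarrow> 0"
      using lim by (intro AE_I2 tendsto_rabs_zero) (simp add: LIM_zero)
    show "AE x in m. norm \<bar>s n x - \<kappa> x\<bar> \<le> w x + \<bar>\<kappa> x\<bar>" for n
    proof (intro AE_I2)
      fix x assume "x \<in> space m"
      from dom[OF this, of n] show "norm \<bar>s n x - \<kappa> x\<bar> \<le> w x + \<bar>\<kappa> x\<bar>" by simp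
    qed
  qed (use s(1) \<kappa> w in auto)
  then have "\<forall>\<^sub>F n in sequentially. (\<integral>x. \<bar>s n x - \<kappa> x\<bar> \<partial>m) < \<epsilon> / 2"
    using \<epsilon> by (intro order_tendstoD(2)) auto
  then obtain n where n: "(\<integral>x. \<bar>s n x - \<kappa> x\<bar> \<partial>m) < \<epsilon> / 2" by (auto simp: eventually_sequentially)
  have "0 < \<epsilon> / 2" using \<epsilon> by simp
  with s(2)[of n] obtain g L where g: "trunc_lipschitz k L g" "(\<integral>x. \<bar>s n x - g x\<bar> \<partial>m) < \<epsilon> / 2"
    unfolding approximable_def by blast
  have int: "integrable m (\<lambda>x. \<bar>s n x - \<kappa> x\<bar>)" "integrable m (\<lambda>x. \<bar>s n x - g x\<bar>)"
    using \<kappa> s(1) integrable_trunc_lipschitz'[OF g(1)] by simp_all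
  have "(\<integral>x. \<bar>\<kappa> x - g x\<bar> \<partial>m) \<le> (\<integral>x. \<bar>s n x - \<kappa> x\<bar> + \<bar>s n x - g x\<bar> \<partial>m)"
    using \<kappa> s(1) integrable_trunc_lipschitz'[OF g(1)]
    by (intro integral_mono) auto
  also have "\<dots> < \<epsilon>" using int n g(2) by simp
  finally show "\<exists>g L. trunc_lipschitz k L g \<and> (\<integral>x. \<bar>\<kappa> x - g x\<bar> \<partial>m) < \<epsilon>" using g(1) by blast
qed

text \<open>\<open>d\<close> is a truncated distance to the box: it is Lipschitz with constant
  \<open>1\<close> and vanishes exactly on the box. So the functions \<open>s n\<close>, Lipschitz
  with constant \<open>n\<close>, decrease to the indicator.\<close>

lemma approximable_box:
  fixes a :: "nat \<Rightarrow> real"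
  shows "approximable k m (indicator {x\<in>space m. \<forall>i<k. x i \<le> a i})"
proof -
  define d where "d x = (\<Sum>i<k. max 0 (min 1 (x i - a i)))" for x :: "nat \<Rightarrow> real"
  define s where "s n x = max 0 (1 - real n * d x)" for n :: nat and x :: "nat \<Rightarrow> real"
  have d0: "0 \<le> d x" for x by (auto simp: d_def intro!: sum_nonneg)
  have dm: "d \<in> borel_measurable (RN k)" unfolding d_def by measurable
  have dL: "\<bar>d x - d y\<bar> \<le> trunc_dist k x y" for x y
  proof -
    have "\<bar>d x - d y\<bar> \<le> (\<Sum>i<k. \<bar>max 0 (min 1 (x i - a i)) - max 0 (min 1 (y i - a i))\<bar>)"
      unfolding d_def sum_subtractf[symmetric] by (rule sum_abs)
    also have "\<dots> \<le> trunc_dist k x y"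
      unfolding trunc_dist_def by (intro sum_mono) (auto simp: max_def min_def)
    finally show ?thesis .
  qed
  have s: "trunc_lipschitz k (real n) (s n)" for n
    unfolding trunc_lipschitz_def
  proof (intro conjI allI)
    show "s n \<in> borel_measurable (RN k)" unfolding s_def using dm by measurable
    fix x y
    have "\<bar>s n x - s n y\<bar> \<le> \<bar>real n * d x - real n * d y\<bar>"
      by (auto simp: s_def max_def)
    also have "\<dots> = real n * \<bar>d x - d y\<bar>" by (simp add: abs_mult right_diff_distrib[symmetric])
    also have "\<dots> \<le> real n * trunc_dist k x y" by (intro mult_left_mono dL) simp
    finally show "\<bar>s n x - s n y\<bar> \<le> real n * trunc_dist k x y" .
  qed simp
  have sp: "space m = space (RN k)" by (rule sets_eq_imp_space_eq[OF sets_m])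
  show ?thesis
  proof (rule approximable_lim[where s=s and w="\<lambda>_. 1"])
    show "integrable m (s n)" for n using s by (rule integrable_trunc_lipschitz')
    show "approximable k m (s n)" for n using s by (rule approximable_trunc_lipschitz)
    have "{x\<in>space (RN k). \<forall>i\<in>{..<k}. x i \<le> a i} \<in> sets (RN k)"
      by (intro sets.sets_Collect_finite_All borel_measurable_le) auto
    moreover have "{x\<in>space (RN k). \<forall>i\<in>{..<k}. x i \<le> a i} = {x\<in>space m. \<forall>i<k. x i \<le> a i}"
      unfolding sp by blast
    ultimately have "{x\<in>space m. \<forall>i<k. x i \<le> a i} \<in> sets m"
      by (simp only: sets_m)
    then show "integrable m (indicator {x\<in>space m. \<forall>i<k. x i \<le> a i} :: _ \<Rightarrow> real)" by (rule integrable_indicator_finite)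
    show "integrable m (\<lambda>_. 1 :: real)" by simp
    show "\<bar>s n x\<bar> \<le> 1" for n x using d0[of x] by (auto simp: s_def max_def)
    fix x assume x: "x \<in> space m"
    show "(\<lambda>n. s n x) \<longlonglongrightarrow> indicator {x\<in>space m. \<forall>i<k. x i \<le> a i} x"
    proof (cases "\<forall>i<k. x i \<le> a i")
      case True
      then have "d x = 0" by (auto simp: d_def intro!: sum.neutral)
      with True x show ?thesis by (simp add: s_def)
    next
      case False
      then obtain i where i: "i < k" "a i < x i" by (auto simp: not_le)
      have "0 < max 0 (min 1 (x i - a i))" using i by simp
      also have "\<dots> \<le> d x" unfolding d_def using i by (intro member_le_sum) auto
      finally have dpos: "0 < d x" .
      obtain n0 :: nat where n0: "1 / d x < real n0" using reals_Archimedean2 by blast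
      have "s n x = 0" if "n \<ge> n0" for n
      proof -
        have "1 / d x < real n" using n0 that by simp
        then have "1 < real n * d x" using dpos by (simp add: field_simps)
        then show ?thesis by (simp add: s_def)
      qed
      then have "\<forall>\<^sub>F n in sequentially. s n x = 0" by (auto simp: eventually_sequentially)
      then have "(\<lambda>n. s n x) \<longlonglongrightarrow> 0" by (rule tendsto_eventually)
      with False show ?thesis by simp
    qed
  qed
qed

text \<open>A pi-lambda argument starting from boxes: these are stable under intersection and
  generate the product sigma-algebra, while approximability passes to complements by linearity and
  to disjoint unions by dominated convergence.\<close>

lemma approximable_indicator:
  assumes A: "A \<in> sets m"
  shows "approximable k m (indicator A)"
proof -
  define E where "E = {{x\<in>(\<Pi>\<^sub>E i\<in>{0..<k}. UNIV :: real set). \<forall>i\<in>j. x i \<in> B i} | B j. j \<in> {{0..<k}} \<and> B \<in> Pi j (\<lambda>_. range atMost)}"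
  have sp: "space m = (\<Pi>\<^sub>E i\<in>{0..<k}. UNIV)" using sets_eq_imp_space_eq[OF sets_m] by (simp add: space_PiM)
  have cover: "\<exists>S\<subseteq>range (atMost :: real \<Rightarrow> _). countable S \<and> UNIV = \<Union>S"
  proof (intro exI[of _ "range (\<lambda>n::nat. {..real n})"] conjI)
    show "UNIV = \<Union>(range (\<lambda>n::nat. {..real n}))" using real_arch_simple by auto
  qed auto
  have "sets m = sets (PiM {0..<k} (\<lambda>_. sigma UNIV (range (atMost :: real \<Rightarrow> _))))"
    unfolding sets_m by (intro sets_PiM_cong) (auto simp: borel_eq_atMost)
  also have "\<dots> = sets (sigma (\<Pi>\<^sub>E i\<in>{0..<k}. UNIV) E)"
    unfolding E_def using cover by (intro sets_PiM_sigma) auto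
  also have "\<dots> = sigma_sets (space m) E"
    unfolding sp by (intro sets_measure_of) (auto simp: E_def)
  finally have sets_E: "sets m = sigma_sets (space m) E" .
  have E_box: "\<exists>a. X = {x\<in>space m. \<forall>i<k. x i \<le> a i}" if "X \<in> E" for X
  proof -
    from that obtain B where B: "B \<in> {0..<k} \<rightarrow> range atMost" "X = {x\<in>space m. \<forall>i\<in>{0..<k}. x i \<in> B i}"
      unfolding E_def sp by blast
    then have "\<forall>i\<in>{0..<k}. \<exists>a. B i = {..a}" by blast
    then obtain a where "\<And>i. i \<in> {0..<k} \<Longrightarrow> B i = {..a i}" by metis
    then have "X = {x\<in>space m. \<forall>i<k. x i \<le> a i}" using B(2) by auto
    then show ?thesis by blast
  qed
  have box_E: "{x\<in>space m. \<forall>i<k. x i \<le> a i} \<in> E" for a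
    unfolding E_def sp by (auto intro!: exI[of _ "\<lambda>i. {..a i}"])
  have stable: "Int_stable E"
  proof (rule Int_stableI)
    fix X Y assume "X \<in> E" "Y \<in> E"
    then obtain a b where "X = {x\<in>space m. \<forall>i<k. x i \<le> a i}" "Y = {x\<in>space m. \<forall>i<k. x i \<le> b i}"
      using E_box by meson
    then have "X \<inter> Y = {x\<in>space m. \<forall>i<k. x i \<le> min (a i) (b i)}" by auto
    then show "X \<inter> Y \<in> E" using box_E[of "\<lambda>i. min (a i) (b i)"] by simp
  qed
  have "E \<subseteq> Pow (space m)" unfolding E_def sp by auto
  from stable this A[unfolded sets_E] show ?thesis
  proof (induction rule: sigma_sets_induct_disjoint)
    case (basic X)
    then obtain a where "X = {x\<in>space m. \<forall>i<k. x i \<le> a i}" using E_box by blast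
    then show ?case using approximable_box by simp
  next
    case empty
    have "trunc_lipschitz k 0 (\<lambda>_. 0)" by (simp add: trunc_lipschitz_def)
    then show ?case using approximable_trunc_lipschitz by (simp add: indicator_def[abs_def])
  next
    case (compl X)
    then have X: "X \<in> sets m" by (simp add: sets_E)
    have "trunc_lipschitz k 0 (\<lambda>_. 1)" by (simp add: trunc_lipschitz_def)
    from approximable_add[OF _ _ approximable_trunc_lipschitz[OF this]
        approximable_scale[OF compl.IH, of "- 1"]]
    have "approximable k m (\<lambda>x. 1 - indicator X x)"
      using integrable_indicator_finite[OF X] by simp
    \<comment> \<open>The indicator of the complement equals \<open>1 - indicator X\<close> only on
      \<open>space m\<close>, hence the detour through the integrals.\<close>
    moreover have "(\<integral>x. \<bar>indicator (space m - X) x - g x\<bar> \<partial>m) = (\<integral>x. \<bar>1 - indicator X x - g x\<bar> \<partial>m)" for g :: "_ \<Rightarrow> real"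
      by (intro Bochner_Integration.integral_cong) (auto simp: indicator_def)
    ultimately show ?case
      by (simp add: approximable_def)
  next
    case (union A)
    then have A: "A i \<in> sets m" for i by (auto simp: sets_E)
    define s where "s n x = (\<Sum>i<n. indicator (A i) x :: real)" for n x
    have int: "integrable m (indicator (A i) :: _ \<Rightarrow> real)" for i using A by (rule integrable_indicator_finite)
    have s_eq: "s n = indicator (\<Union>i<n. A i)" for n
      unfolding s_def
      using union(1) by (intro ext) (subst indicator_UN_disjoint; auto simp: disjoint_family_on_def)
    show ?case
    proof (rule approximable_lim[where s=s and w="\<lambda>_. 1"])
      show "integrable m (s n)" for n unfolding s_def using int by (intro Bochner_Integration.integrable_sum) auto
      show "approximable k m (s n)" for n
      proof (induction n)
        case 0
        have "trunc_lipschitz k 0 (\<lambda>_. 0)" by (simp add: trunc_lipschitz_def)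
        then show ?case using approximable_trunc_lipschitz by (simp add: s_def)
      next
        case (Suc n)
        then have "approximable k m (\<lambda>x. s n x + indicator (A n) x)"
          using int union(3) by (intro approximable_add) (auto simp: s_def)
        then show ?case by (simp add: s_def)
      qed
      show "integrable m (indicator (\<Union>(range A)) :: _ \<Rightarrow> real)"
        using A by (intro integrable_indicator_finite sets.countable_UN) auto
      show "integrable m (\<lambda>_. 1 :: real)" by simp
      show "\<bar>s n x\<bar> \<le> 1" for n x unfolding s_eq by (simp add: indicator_def)
      show "(\<lambda>n. s n x) \<longlonglongrightarrow> indicator (\<Union>(range A)) x" for x
      proof (cases "x \<in> \<Union>(range A)")
        case True
        then obtain i where "x \<in> A i" by blast
        then have "s n x = 1" if "n > i" for n using that by (auto simp: s_eq indicator_def)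
        then have "\<forall>\<^sub>F n in sequentially. s n x = 1" by (auto simp: eventually_sequentially intro: exI[of _ "Suc i"])
        then have "(\<lambda>n. s n x) \<longlonglongrightarrow> 1" by (rule tendsto_eventually)
        with True show ?thesis by simp
      next
        case False
        then show ?thesis by (simp add: s_eq)
      qed
    qed
  qed
qed

theorem approximable_integrable:
  assumes "integrable m \<kappa>"
  shows "approximable k m \<kappa>"
  using assms
proof (induction rule: integrable_induct)
  case (base A c)
  then show ?case
    using approximable_scale[OF approximable_indicator[OF base(1)], of c] by (simp add: mult.commute)
next
  case (add f g)
  then show ?case by (intro approximable_add)
next
  case (lim f s)
  \<comment> \<open>The majorant is the bound on the approximants that the induction rule
    provides.\<close>
  then show ?case
    by (intro approximable_lim[of s f "\<lambda>x. 2 * \<bar>f x\<bar>"]) auto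
qed

end

section \<open>Moving estimates between couplings, and level crossings\<close>

lemma measurable_coordinate:
  "f \<in> measurable M (RN N) \<Longrightarrow> i < N \<Longrightarrow> (\<lambda>w. f w i) \<in> borel_measurable M"
  using measurable_compose[OF _ measurable_component_singleton[of i "{0..<N}" "\<lambda>_. borel"]] by simp

lemma (in prob_space) integrable_trunc_dist:
  assumes "f \<in> measurable M (RN N)" "g \<in> measurable M (RN N)" "k \<le> N"
  shows "integrable M (\<lambda>w. trunc_dist k (f w) (g w))"
  using assms trunc_dist_nonneg trunc_dist_le[of k]
  by (intro integrable_const_bound[where B="real k"] borel_measurable_trunc_dist) (auto intro: measurable_coordinate)

lemma integral_eq_of_distr_eq:
  fixes h :: "'c \<Rightarrow> real"
  assumes "X \<in> measurable M R" "X' \<in> measurable M' R" "distr M R X = distr M' R X'" "h \<in> borel_measurable R"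
  shows "(\<integral>w. h (X w) \<partial>M) = (\<integral>w. h (X' w) \<partial>M')"
  using assms by (metis integral_distr)

text \<open>
  Whether a kernel composed with one coordinate is close to another kernel composed with the other
  coordinate depends on the coupling only through the closeness of the two coordinates: compare
  both with a Lipschitz approximation \<open>g\<close> of \<open>\<kappa>\<close>.
\<close>

lemma coupling_transfer:
  fixes \<alpha> \<kappa> :: "(nat \<Rightarrow> real) \<Rightarrow> real"
  assumes M1: "prob_space M1" and M2: "prob_space M2"
    and X1: "X1 \<in> measurable M1 (RN k)" and Y1: "Y1 \<in> measurable M1 (RN k)"
    and X2: "X2 \<in> measurable M2 (RN k)" and Y2: "Y2 \<in> measurable M2 (RN k)"
    and X12: "distr M1 (RN k) X1 = distr M2 (RN k) X2" and Y12: "distr M1 (RN k) Y1 = distr M2 (RN k) Y2"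
    and \<alpha>: "\<alpha> \<in> borel_measurable (RN k)" "\<And>x. \<bar>\<alpha> x\<bar> \<le> 1"
    and \<kappa>: "\<kappa> \<in> borel_measurable (RN k)" "\<And>x. \<bar>\<kappa> x\<bar> \<le> 1"
    and g: "trunc_lipschitz k L g"
  shows "(\<integral>w. \<bar>\<alpha> (X2 w) - \<kappa> (Y2 w)\<bar> \<partial>M2) \<le> (\<integral>w. \<bar>\<alpha> (X1 w) - \<kappa> (Y1 w)\<bar> \<partial>M1)
    + 2 * (\<integral>w. \<bar>\<kappa> (Y2 w) - g (Y2 w)\<bar> \<partial>M2)
    + L * ((\<integral>w. trunc_dist k (X1 w) (Y1 w) \<partial>M1) + (\<integral>w. trunc_dist k (X2 w) (Y2 w) \<partial>M2))"
proof -
  interpret M1: prob_space M1 by fact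
  interpret M2: prob_space M2 by fact
  have gm: "g \<in> borel_measurable (RN k)" and gL: "\<bar>g x - g y\<bar> \<le> L * trunc_dist k x y" for x y
    using g by (auto simp: trunc_lipschitz_def)
  note td1 = M1.integrable_trunc_dist[OF X1 Y1 order_refl] and td2 = M2.integrable_trunc_dist[OF X2 Y2 order_refl]
  have i1: "integrable M1 (\<lambda>w. \<alpha> (X1 w))" "integrable M1 (\<lambda>w. \<kappa> (Y1 w))"
    "integrable M1 (\<lambda>w. g (X1 w))" "integrable M1 (\<lambda>w. g (Y1 w))"
    using \<alpha> \<kappa> M1.integrable_trunc_lipschitz[OF g X1] M1.integrable_trunc_lipschitz[OF g Y1]
    by (auto intro!: M1.integrable_const_bound[where B=1] measurable_compose[OF X1] measurable_compose[OF Y1])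
  have i2: "integrable M2 (\<lambda>w. \<alpha> (X2 w))" "integrable M2 (\<lambda>w. \<kappa> (Y2 w))"
    "integrable M2 (\<lambda>w. g (X2 w))" "integrable M2 (\<lambda>w. g (Y2 w))"
    using \<alpha> \<kappa> M2.integrable_trunc_lipschitz[OF g X2] M2.integrable_trunc_lipschitz[OF g Y2]
    by (auto intro!: M2.integrable_const_bound[where B=1] measurable_compose[OF X2] measurable_compose[OF Y2])
  let ?ak1 = "\<integral>w. \<bar>\<alpha> (X1 w) - \<kappa> (Y1 w)\<bar> \<partial>M1" and ?ag1 = "\<integral>w. \<bar>\<alpha> (X1 w) - g (X1 w)\<bar> \<partial>M1"
    and ?kg1 = "\<integral>w. \<bar>\<kappa> (Y1 w) - g (Y1 w)\<bar> \<partial>M1" and ?t1 = "\<integral>w. trunc_dist k (X1 w) (Y1 w) \<partial>M1"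
  let ?ak2 = "\<integral>w. \<bar>\<alpha> (X2 w) - \<kappa> (Y2 w)\<bar> \<partial>M2" and ?ag2 = "\<integral>w. \<bar>\<alpha> (X2 w) - g (X2 w)\<bar> \<partial>M2"
    and ?kg2 = "\<integral>w. \<bar>\<kappa> (Y2 w) - g (Y2 w)\<bar> \<partial>M2" and ?t2 = "\<integral>w. trunc_dist k (X2 w) (Y2 w) \<partial>M2"
  have "?ak2 \<le>
    (\<integral>w. \<bar>\<alpha> (X2 w) - g (X2 w)\<bar> + L * trunc_dist k (X2 w) (Y2 w) + \<bar>\<kappa> (Y2 w) - g (Y2 w)\<bar> \<partial>M2)"
  proof (rule integral_mono)
    fix w
    show "\<bar>\<alpha> (X2 w) - \<kappa> (Y2 w)\<bar> \<le> \<bar>\<alpha> (X2 w) - g (X2 w)\<bar> + L * trunc_dist k (X2 w) (Y2 w) + \<bar>\<kappa> (Y2 w) - g (Y2 w)\<bar>"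
      using gL[of "X2 w" "Y2 w"] by linarith
  qed (use i2 td2 in auto)
  also have "\<dots> = ?ag2 + L * ?t2 + ?kg2"
    using i2 td2 by simp
  also have "?ag2 = ?ag1"
    using \<alpha>(1) gm by (intro integral_eq_of_distr_eq[OF X2 X1 X12[symmetric]]) simp
  also have "\<dots> \<le> (\<integral>w. \<bar>\<alpha> (X1 w) - \<kappa> (Y1 w)\<bar> + L * trunc_dist k (X1 w) (Y1 w) + \<bar>\<kappa> (Y1 w) - g (Y1 w)\<bar> \<partial>M1)"
  proof (rule integral_mono)
    fix w
    show "\<bar>\<alpha> (X1 w) - g (X1 w)\<bar> \<le> \<bar>\<alpha> (X1 w) - \<kappa> (Y1 w)\<bar> + L * trunc_dist k (X1 w) (Y1 w) + \<bar>\<kappa> (Y1 w) - g (Y1 w)\<bar>"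
      using gL[of "X1 w" "Y1 w"] by linarith
  qed (use i1 td1 in auto)
  also have "\<dots> = ?ak1 + L * ?t1 + ?kg1"
    using i1 td1 by simp
  \<comment> \<open>The error of \<open>g\<close> is met once in each coupling and depends only on
    the law of the second variable; this is the origin of the factor \<open>2\<close>.\<close>
  also have "?kg1 = ?kg2"
    using \<kappa>(1) gm by (intro integral_eq_of_distr_eq[OF Y1 Y2 Y12]) simp
  finally show ?thesis by (simp add: distrib_left)
qed

text \<open>Two points more than \<open>2 * \<delta>\<close> apart leave a whole cell of the grid of
  mesh \<delta> between them, and as long as \<bar>x\<bar> is at most
  \<open>\<delta> * real J\<close> only finitely many cells come into question. The index
  \<open>- int J - 1\<close> is reached when \<open>y\<close> is the lower point, since the cell is
  then the one ending at the grid point just below \<open>x\<close>.\<close>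

lemma min_dist_le_crossings:
  fixes x y \<delta> :: real and J :: nat
  assumes \<delta>: "0 < \<delta>"
  shows "min \<bar>x - y\<bar> 1 \<le> 2 * \<delta> + indicator {x. \<delta> * real J < \<bar>x\<bar>} x
    + (\<Sum>j\<in>{- int J - 1..int J}. indicator {(x, y). x \<le> \<delta> * of_int j \<and> \<delta> * (of_int j + 1) \<le> y} (x, y)
        + indicator {(x, y). y \<le> \<delta> * of_int j \<and> \<delta> * (of_int j + 1) \<le> x} (x, y))"
    (is "_ \<le> _ + _ + (\<Sum>j\<in>?J. ?c j)")
proof -
  have c0: "0 \<le> ?c j" for j by simp
  then have s0: "0 \<le> (\<Sum>j\<in>?J. ?c j)" by (intro sum_nonneg) simp
  have i0: "0 \<le> (indicator {x. \<delta> * real J < \<bar>x\<bar>} x :: real)" by simp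
  have m1: "min \<bar>x - y\<bar> 1 \<le> 1" by simp
  have c_le: "?c j \<le> (\<Sum>j\<in>?J. ?c j)" if "j \<in> ?J" for j
    using that c0 by (intro member_le_sum) auto
  consider "\<delta> * real J < \<bar>x\<bar>" | "\<bar>x - y\<bar> \<le> 2 * \<delta>"
    | "\<bar>x\<bar> \<le> \<delta> * real J" "x + 2 * \<delta> < y" | "\<bar>x\<bar> \<le> \<delta> * real J" "y < x - 2 * \<delta>"
    by linarith
  then show ?thesis
  proof cases
    case 1
    then have "(indicator {x. \<delta> * real J < \<bar>x\<bar>} x :: real) = 1" by simp
    then show ?thesis using \<delta> s0 m1 by linarith
  next
    case 2
    then have "min \<bar>x - y\<bar> 1 \<le> 2 * \<delta>" by simp
    then show ?thesis using s0 i0 by linarith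
  next
    case 3
    define j where "j = \<lceil>x / \<delta>\<rceil>"
    have xd: "- real J \<le> x / \<delta>" "x / \<delta> \<le> real J" using 3(1) \<delta> by (auto simp: field_simps abs_le_iff)
    have j: "x / \<delta> \<le> of_int j" "of_int j < x / \<delta> + 1" unfolding j_def by linarith+
    have "x \<le> \<delta> * of_int j" "\<delta> * (of_int j + 1) \<le> y"
      using j 3(2) \<delta> by (auto simp: field_simps)
    moreover have "j \<in> ?J" using xd j by simp
    ultimately have "1 \<le> (\<Sum>j\<in>?J. ?c j)" by (intro order_trans[OF _ c_le[of j]]) simp_all
    then show ?thesis using \<delta> i0 m1 by linarith
  next
    case 4
    define j where "j = \<lfloor>x / \<delta>\<rfloor> - 1"
    have xd: "- real J \<le> x / \<delta>" "x / \<delta> \<le> real J" using 4(1) \<delta> by (auto simp: field_simps abs_le_iff)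
    have j: "of_int j + 1 \<le> x / \<delta>" "x / \<delta> < of_int j + 2" unfolding j_def by linarith+
    have "y \<le> \<delta> * of_int j" "\<delta> * (of_int j + 1) \<le> x"
      using j 4(2) \<delta> by (auto simp: field_simps)
    moreover have "j \<in> ?J" using xd j by simp
    ultimately have "1 \<le> (\<Sum>j\<in>?J. ?c j)" by (intro order_trans[OF _ c_le[of j]]) simp_all
    then show ?thesis using \<delta> i0 m1 by linarith
  qed
qed

text \<open>Tightness of the single variable \<open>X\<close> leaves finitely many cells to cross,
  and each crossing has vanishing probability.\<close>

lemma (in prob_space) tendsto_min_dist_of_crossings:
  fixes X :: "'a \<Rightarrow> real" and Y :: "nat \<Rightarrow> 'a \<Rightarrow> real"
  assumes X[measurable]: "X \<in> borel_measurable M" and Y[measurable]: "\<And>n. Y n \<in> borel_measurable M"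
    and up: "\<And>a b. a < b \<Longrightarrow> (\<lambda>n. prob {w\<in>space M. X w \<le> a \<and> b \<le> Y n w}) \<longlonglongrightarrow> 0"
    and down: "\<And>a b. a < b \<Longrightarrow> (\<lambda>n. prob {w\<in>space M. Y n w \<le> a \<and> b \<le> X w}) \<longlonglongrightarrow> 0"
  shows "(\<lambda>n. \<integral>w. min \<bar>X w - Y n w\<bar> 1 \<partial>M) \<longlonglongrightarrow> 0"
proof (rule tendstoI)
  fix \<epsilon> :: real assume \<epsilon>: "0 < \<epsilon>"
  \<comment> \<open>The mesh contributes \<open>2 * \<delta> = \<epsilon> / 4\<close>; the tail of
    \<open>X\<close> and the crossings contribute less than \<open>\<epsilon> / 4\<close>
    each.\<close>
  define \<delta> where "\<delta> = \<epsilon> / 8"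
  have \<delta>: "0 < \<delta>" using \<epsilon> by (simp add: \<delta>_def)
  let ?T = "\<lambda>J::nat. {w\<in>space M. \<delta> * real J < \<bar>X w\<bar>}"
  let ?U = "\<lambda>n (j::int). {w\<in>space M. X w \<le> \<delta> * of_int j \<and> \<delta> * (of_int j + 1) \<le> Y n w}"
  let ?D = "\<lambda>n (j::int). {w\<in>space M. Y n w \<le> \<delta> * of_int j \<and> \<delta> * (of_int j + 1) \<le> X w}"
  have "(\<lambda>J. prob (?T J)) \<longlonglongrightarrow> prob (\<Inter>J. (?T J))"
  proof (rule finite_Lim_measure_decseq)
    show "decseq ?T"
    proof (unfold decseq_def, safe)
      fix m n :: nat and w assume "m \<le> n" "\<delta> * real n < \<bar>X w\<bar>"
      moreover have "\<delta> * real m \<le> \<delta> * real n" using \<delta> \<open>m \<le> n\<close> by simp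
      ultimately show "\<delta> * real m < \<bar>X w\<bar>" by simp
    qed
  qed auto
  also have "(\<Inter>J. (?T J)) = {}"
  proof -
    have "\<exists>J::nat. \<bar>x\<bar> \<le> \<delta> * real J" for x :: real
      using real_arch_simple[of "\<bar>x\<bar> / \<delta>"] \<delta> by (auto simp: field_simps)
    then show ?thesis by (fastforce simp: not_less[symmetric])
  qed
  finally have "(\<lambda>J. prob (?T J)) \<longlonglongrightarrow> 0" by simp
  then have "\<forall>\<^sub>F J in sequentially. prob (?T J) < \<epsilon> / 4"
    using \<epsilon> by (intro order_tendstoD(2)) auto
  then obtain J where J: "prob (?T J) < \<epsilon> / 4"
    by (auto simp: eventually_sequentially)
  define S where "S n = (\<Sum>j\<in>{- int J - 1..int J}.
      prob (?U n j)
      + prob (?D n j))" for n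
  have "S \<longlonglongrightarrow> (\<Sum>j\<in>{- int J - 1..int J}. 0 + 0)"
    unfolding S_def using \<delta> by (intro tendsto_sum tendsto_add up down) (auto simp: distrib_left)
  then have "S \<longlonglongrightarrow> 0" by simp
  then have "\<forall>\<^sub>F n in sequentially. S n < \<epsilon> / 4"
    using \<epsilon> by (intro order_tendstoD(2)) auto
  then show "\<forall>\<^sub>F n in sequentially. dist (\<integral>w. min \<bar>X w - Y n w\<bar> 1 \<partial>M) 0 < \<epsilon>"
  proof eventually_elim
    case (elim n)
    have ind: "integrable M (indicator A :: _ \<Rightarrow> real)" if "A \<in> sets M" for A
      using that by (rule integrable_real_indicator) (simp add: less_top[symmetric])
    have [simp]: "?T J \<in> sets M" "?U n j \<in> sets M" "?D n j \<in> sets M" for j by measurable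
    have "(\<integral>w. min \<bar>X w - Y n w\<bar> 1 \<partial>M) \<le> (\<integral>w. 2 * \<delta> + indicator (?T J) w +
        (\<Sum>j\<in>{- int J - 1..int J}. indicator (?U n j) w + indicator (?D n j) w) \<partial>M)"
    proof (rule integral_mono)
      show "integrable M (\<lambda>w. min \<bar>X w - Y n w\<bar> 1)"
        by (rule integrable_const_bound[where B=1]) auto
      show "integrable M (\<lambda>w. 2 * \<delta> + indicator (?T J) w + (\<Sum>j\<in>{- int J - 1..int J}. indicator (?U n j) w + indicator (?D n j) w :: real))"
        by (intro Bochner_Integration.integrable_add Bochner_Integration.integrable_sum ind integrable_const) simp_all
      fix w assume w: "w \<in> space M"
      show "min \<bar>X w - Y n w\<bar> 1 \<le> 2 * \<delta> + indicator (?T J) w + (\<Sum>j\<in>{- int J - 1..int J}. indicator (?U n j) w + indicator (?D n j) w)"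
        using min_dist_le_crossings[OF \<delta>, of "X w" "Y n w" J] w by (simp add: indicator_def)
    qed
    also have "\<dots> = 2 * \<delta> + prob (?T J) + S n"
      unfolding S_def
      by (subst Bochner_Integration.integral_add Bochner_Integration.integral_sum;
          (intro Bochner_Integration.integrable_add Bochner_Integration.integrable_sum ind integrable_const)?; simp add: prob_space ind)+
    also have "\<dots> < \<epsilon>" using J elim \<epsilon> by (simp add: \<delta>_def)
    finally have "(\<integral>w. min \<bar>X w - Y n w\<bar> 1 \<partial>M) < \<epsilon>" .
    moreover have "0 \<le> (\<integral>w. min \<bar>X w - Y n w\<bar> 1 \<partial>M)" by (intro integral_nonneg_AE) auto
    ultimately show ?case by simp
  qed
qed

section \<open>From convergence in probability to convergence in \<open>L\<^sub>p\<close>\<close>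

lemma powr_sum3_le:
  fixes a b c p :: real
  assumes "0 \<le> a" "0 \<le> b" "0 \<le> c" "0 \<le> p"
  shows "(a + b + c) powr p \<le> 3 powr p * (a powr p + b powr p + c powr p)"
proof -
  define d where "d = max a (max b c)"
  have "(a + b + c) powr p \<le> (3 * d) powr p" using assms by (intro powr_mono2) (auto simp: d_def)
  also have "\<dots> = 3 powr p * d powr p" by (rule powr_mult)
  also have "d powr p \<le> a powr p + b powr p + c powr p" by (auto simp: d_def max_def)
  finally show ?thesis by simp
qed

lemma powr_sum2_le:
  fixes a b p :: real
  assumes "0 \<le> a" "0 \<le> b" "0 \<le> p"
  shows "(a + b) powr p \<le> 3 powr p * (a powr p + b powr p)"
proof -
  have "(a + b + 0) powr p \<le> 3 powr p * (a powr p + b powr p + 0 powr p)"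
    using assms by (intro powr_sum3_le) auto
  then show ?thesis by simp
qed

text \<open>For nonnegative \<open>R\<close>, the distance of \<open>x\<close> from the interval
  between \<open>- R\<close> and \<open>R\<close>. Being Lipschitz with constant \<open>1\<close>,
  unlike \<bar>x\<bar> cut off below \<open>R\<close>, it lets uniform integrability pass from one
  variable to an \<open>L\<^sub>p\<close>-close one.\<close>

definition excess :: "real \<Rightarrow> real \<Rightarrow> real" where
  "excess R x = max 0 (\<bar>x\<bar> - R)"

text \<open>Clamping both points to the interval between \<open>- R\<close> and \<open>R\<close>
  costs the two excesses. The clamped points are at most \<open>2 * R\<close> apart and no further
  apart than \<open>x\<close> and \<open>y\<close>, so for \<open>1 \<le> p\<close> the power of
  their distance is bounded by a multiple of the truncated distance.\<close>

lemma powr_dist_le_excess: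
  fixes x y R p :: real
  assumes R: "1 \<le> R" and p: "1 \<le> p"
  shows "\<bar>x - y\<bar> powr p \<le> 3 powr p * ((2 * R) powr p * min \<bar>x - y\<bar> 1 + excess R x powr p + excess R y powr p)"
proof -
  define c where "c z = max (- R) (min R z)" for z
  have ex: "\<bar>z - c z\<bar> = excess R z" for z using R by (auto simp: c_def excess_def)
  have "\<bar>x - y\<bar> \<le> \<bar>c x - c y\<bar> + excess R x + excess R y"
    unfolding ex[symmetric] by linarith
  then have "\<bar>x - y\<bar> powr p \<le> (\<bar>c x - c y\<bar> + excess R x + excess R y) powr p"
    using p by (intro powr_mono2) auto
  also have "\<dots> \<le> 3 powr p * (\<bar>c x - c y\<bar> powr p + excess R x powr p + excess R y powr p)"
    using p by (intro powr_sum3_le) (auto simp: excess_def)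
  also have "\<bar>c x - c y\<bar> powr p \<le> (2 * R) powr p * min \<bar>x - y\<bar> 1"
  proof (cases "1 \<le> \<bar>x - y\<bar>")
    case True
    have "\<bar>c x - c y\<bar> powr p \<le> (2 * R) powr p"
      using R p by (intro powr_mono2) (auto simp: c_def)
    with True show ?thesis by simp
  next
    case False
    have "\<bar>c x - c y\<bar> powr p \<le> \<bar>x - y\<bar> powr p"
      using p by (intro powr_mono2) (auto simp: c_def)
    also have "\<dots> \<le> \<bar>x - y\<bar> powr 1"
      using False p by (intro powr_mono') auto
    also have "\<dots> \<le> (2 * R) powr p * \<bar>x - y\<bar>"
      using R p ge_one_powr_ge_zero[of "2 * R" p] by (simp add: mult_le_cancel_right1)
    finally show ?thesis using False by simp
  qed
  finally show ?thesis by simp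
qed

lemma excess_powr_le:
  assumes p: "1 \<le> p"
  shows "excess R y powr p \<le> 3 powr p * (excess R x powr p + \<bar>x - y\<bar> powr p)"
proof -
  have "excess R y powr p \<le> (excess R x + \<bar>x - y\<bar>) powr p"
    using p by (intro powr_mono2) (auto simp: excess_def)
  also have "\<dots> \<le> 3 powr p * (excess R x powr p + \<bar>x - y\<bar> powr p)"
    using p by (intro powr_sum2_le) (auto simp: excess_def)
  finally show ?thesis .
qed

lemma powr_dist_le_sum:
  fixes x y p :: real
  assumes "0 \<le> p"
  shows "\<bar>x - y\<bar> powr p \<le> 3 powr p * (\<bar>x\<bar> powr p + \<bar>y\<bar> powr p)"
proof -
  have "\<bar>x - y\<bar> powr p \<le> (\<bar>x\<bar> + \<bar>y\<bar>) powr p"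
    using assms by (intro powr_mono2) auto
  also have "\<dots> \<le> 3 powr p * (\<bar>x\<bar> powr p + \<bar>y\<bar> powr p)"
    using assms by (intro powr_sum2_le) auto
  finally show ?thesis .
qed

lemma integrable_powr_dist:
  fixes X Y :: "'a \<Rightarrow> real"
  assumes p: "0 \<le> p" and [measurable]: "X \<in> borel_measurable M" "Y \<in> borel_measurable M"
    and "integrable M (\<lambda>w. \<bar>X w\<bar> powr p)" "integrable M (\<lambda>w. \<bar>Y w\<bar> powr p)"
  shows "integrable M (\<lambda>w. \<bar>X w - Y w\<bar> powr p)"
proof (rule Bochner_Integration.integrable_bound)
  show "integrable M (\<lambda>w. 3 powr p * (\<bar>X w\<bar> powr p + \<bar>Y w\<bar> powr p))" using assms by simp
  show "AE w in M. norm (\<bar>X w - Y w\<bar> powr p) \<le> norm (3 powr p * (\<bar>X w\<bar> powr p + \<bar>Y w\<bar> powr p))"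
    using powr_dist_le_sum[OF p] by (simp add: abs_mult)
qed measurable

lemma borel_measurable_excess [measurable]: "excess R \<in> borel_measurable borel"
  unfolding excess_def by measurable

lemma integrable_excess_powr:
  fixes X :: "'a \<Rightarrow> real"
  assumes p: "0 \<le> p" and R: "0 \<le> R" and [measurable]: "X \<in> borel_measurable M"
    and "integrable M (\<lambda>w. \<bar>X w\<bar> powr p)"
  shows "integrable M (\<lambda>w. excess R (X w) powr p)"
  using assms(4)
proof (rule Bochner_Integration.integrable_bound)
  show "AE w in M. norm (excess R (X w) powr p) \<le> norm (\<bar>X w\<bar> powr p)"
    using p R by (auto simp: excess_def intro!: AE_I2 powr_mono2)
qed measurable

text \<open>
  Uniform integrability of the \<open>p\<close>-th powers is transported from an arbitrary \<open>L\<^sub>p\<close>-close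
  coupling of the same two laws.
\<close>

lemma (in prob_space) tendsto_Lp_of_tendsto_min_dist:
  fixes X :: "'a \<Rightarrow> real" and Y :: "nat \<Rightarrow> 'a \<Rightarrow> real" and U V :: "nat \<Rightarrow> 'b \<Rightarrow> real"
  assumes p: "1 \<le> p"
    and X: "X \<in> borel_measurable M" and Y: "\<And>n. Y n \<in> borel_measurable M"
    and U: "\<And>n. U n \<in> borel_measurable (P n)" and V: "\<And>n. V n \<in> borel_measurable (P n)"
    and XU: "\<And>n. distr (P n) borel (U n) = distr M borel X"
    and YV: "\<And>n. distr (P n) borel (V n) = distr M borel (Y n)"
    and int_X: "integrable M (\<lambda>w. \<bar>X w\<bar> powr p)" and int_Y: "\<And>n. integrable M (\<lambda>w. \<bar>Y n w\<bar> powr p)"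
    and UV: "(\<lambda>n. \<integral>w. \<bar>U n w - V n w\<bar> powr p \<partial>P n) \<longlonglongrightarrow> 0"
    and XY: "(\<lambda>n. \<integral>w. min \<bar>X w - Y n w\<bar> 1 \<partial>M) \<longlonglongrightarrow> 0"
  shows "(\<lambda>n. \<integral>w. \<bar>X w - Y n w\<bar> powr p \<partial>M) \<longlonglongrightarrow> 0"
proof (rule tendstoI)
  fix \<epsilon> :: real assume \<epsilon>: "0 < \<epsilon>"
  let ?X = "\<lambda>R. \<integral>w. excess R (X w) powr p \<partial>M"
  let ?uv = "\<lambda>n. \<integral>w. \<bar>U n w - V n w\<bar> powr p \<partial>P n"
  let ?xy = "\<lambda>n. \<integral>w. min \<bar>X w - Y n w\<bar> 1 \<partial>M"
  let ?d = "\<lambda>n. \<integral>w. \<bar>X w - Y n w\<bar> powr p \<partial>M"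
  have ex_le: "excess R x powr p \<le> \<bar>x\<bar> powr p" if "0 \<le> R" for R x
    using p that by (intro powr_mono2) (auto simp: excess_def)
  \<comment> \<open>The total weight of the excess of \<open>X\<close>: it enters once directly and
    once through that of \<open>Y n\<close>, which has the law of \<open>V n\<close> and is bounded
    through the close variable \<open>U n\<close>.\<close>
  define T :: real where "T = 3 powr p * (1 + 3 powr p)"
  have T: "0 < T" by (simp add: T_def add_pos_nonneg)
  have "(\<lambda>m. \<integral>w. excess (real m) (X w) powr p \<partial>M) \<longlonglongrightarrow> (\<integral>w. 0 \<partial>M)"
  proof (rule integral_dominated_convergence[where w="\<lambda>w. \<bar>X w\<bar> powr p"])
    show "AE w in M. (\<lambda>m. excess (real m) (X w) powr p) \<longlonglongrightarrow> 0"
    proof (intro AE_I2 tendsto_eventually)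
      fix w
      obtain m0 :: nat where "\<bar>X w\<bar> \<le> real m0" using real_arch_simple by blast
      then have "excess (real m) (X w) powr p = 0" if "m \<ge> m0" for m
        using that by (simp add: excess_def)
      then show "\<forall>\<^sub>F m in sequentially. excess (real m) (X w) powr p = 0"
        by (auto simp: eventually_sequentially)
    qed
    show "AE w in M. norm (excess (real m) (X w) powr p) \<le> \<bar>X w\<bar> powr p" for m
      using ex_le[of "real m"] by simp
  qed (use X int_X in measurable)
  then have "\<forall>\<^sub>F m in sequentially. ?X (real m) < \<epsilon> / (2 * T)"
    using \<epsilon> T by (intro order_tendstoD(2)) auto
  then have "\<forall>\<^sub>F m in sequentially. ?X (real m) < \<epsilon> / (2 * T) \<and> 1 \<le> m"
    using eventually_ge_at_top[of 1] by eventually_elim simp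
  then obtain m where m: "?X (real m) < \<epsilon> / (2 * T)" "1 \<le> m"
    by (auto simp: eventually_sequentially)
  define R where "R = real m"
  have R: "1 \<le> R" "T * ?X R < \<epsilon> / 2"
    using m T by (auto simp: R_def field_simps)
  \<comment> \<open>The part of the bound that vanishes as \<open>n\<close> grows while
    \<open>R\<close> stays fixed.\<close>
  define b where "b n = 3 powr p * ((2 * R) powr p * ?xy n
    + 3 powr p * ?uv n)" for n
  have "b \<longlonglongrightarrow> 3 powr p * ((2 * R) powr p * 0 + 3 powr p * 0)"
    unfolding b_def by (intro tendsto_intros XY UV)
  then have "\<forall>\<^sub>F n in sequentially. b n < \<epsilon> / 2"
    using \<epsilon> by (intro order_tendstoD(2)) auto
  then show "\<forall>\<^sub>F n in sequentially. dist (?d n) 0 < \<epsilon>"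
  proof eventually_elim
    case (elim n)
    note [measurable] = X Y[of n] U[of n] V[of n]
    have int_distr: "integrable (P n) (\<lambda>w. \<bar>U n w\<bar> powr p)" "integrable (P n) (\<lambda>w. \<bar>V n w\<bar> powr p)"
    proof -
      have "integrable (distr (P n) borel (U n)) (\<lambda>x. \<bar>x\<bar> powr p)"
        unfolding XU using int_X by (subst integrable_distr_eq) auto
      then show "integrable (P n) (\<lambda>w. \<bar>U n w\<bar> powr p)" by (subst (asm) integrable_distr_eq) auto
      have "integrable (distr (P n) borel (V n)) (\<lambda>x. \<bar>x\<bar> powr p)"
        unfolding YV using int_Y[of n] by (subst integrable_distr_eq) auto
      then show "integrable (P n) (\<lambda>w. \<bar>V n w\<bar> powr p)" by (subst (asm) integrable_distr_eq) auto
    qed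
    have int_UV: "integrable (P n) (\<lambda>w. \<bar>U n w - V n w\<bar> powr p)"
      using p by (intro integrable_powr_dist int_distr) auto
    have int_ex: "integrable M (\<lambda>w. excess R (X w) powr p)" "integrable M (\<lambda>w. excess R (Y n w) powr p)"
      "integrable (P n) (\<lambda>w. excess R (U n w) powr p)" "integrable (P n) (\<lambda>w. excess R (V n w) powr p)"
      using p R by (intro integrable_excess_powr int_X int_Y int_distr; simp)+
    have int_min: "integrable M (\<lambda>w. min \<bar>X w - Y n w\<bar> 1)"
      by (rule integrable_const_bound[where B=1]) auto
    have int_XY: "integrable M (\<lambda>w. \<bar>X w - Y n w\<bar> powr p)"
      using p by (intro integrable_powr_dist int_X int_Y) auto
    have law_ex: "(\<integral>w. excess R (Y n w) powr p \<partial>M) = (\<integral>w. excess R (V n w) powr p \<partial>P n)"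
      "?X R = (\<integral>w. excess R (U n w) powr p \<partial>P n)"
      by (rule integral_eq_of_distr_eq[where R=borel and h="\<lambda>x. excess R x powr p"]; simp add: XU YV)+
    have "(\<integral>w. excess R (V n w) powr p \<partial>P n) \<le> (\<integral>w. 3 powr p * (excess R (U n w) powr p + \<bar>U n w - V n w\<bar> powr p) \<partial>P n)"
      using int_ex int_UV by (intro integral_mono excess_powr_le p) auto
    also have "\<dots> = 3 powr p * (?X R + ?uv n)"
      using int_ex int_UV law_ex by simp
    finally have V_le: "(\<integral>w. excess R (Y n w) powr p \<partial>M) \<le> 3 powr p * (?X R + ?uv n)"
      using law_ex by simp
    have "?d n \<le>
      (\<integral>w. 3 powr p * ((2 * R) powr p * min \<bar>X w - Y n w\<bar> 1 + excess R (X w) powr p + excess R (Y n w) powr p) \<partial>M)"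
      using int_XY int_ex int_min by (intro integral_mono powr_dist_le_excess R p) auto
    also have "\<dots> = 3 powr p * ((2 * R) powr p * ?xy n + ?X R + (\<integral>w. excess R (Y n w) powr p \<partial>M))"
      using int_ex int_min by simp
    also have "\<dots> \<le> 3 powr p * ((2 * R) powr p * ?xy n + ?X R
        + 3 powr p * (?X R + ?uv n))"
      using V_le by (intro mult_left_mono add_left_mono) auto
    also have "\<dots> = b n + T * ?X R"
      by (simp add: b_def T_def algebra_simps)
    also have "\<dots> < \<epsilon>" using elim R(2) by simp
    finally have "?d n < \<epsilon>" .
    moreover have "0 \<le> ?d n" by (intro integral_nonneg_AE) auto
    ultimately show ?case by simp
  qed
qed

section \<open>Convergence of quantile processes in probability\<close>

text \<open>For \<open>a < b\<close>, a decreasing Lipschitz substitute for the indicator of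
  \<open>{..a}\<close> that vanishes from \<open>b\<close> on. The Lipschitz property lets closeness
  of coordinates control differences of the test function.\<close>

definition ramp :: "real \<Rightarrow> real \<Rightarrow> real \<Rightarrow> real" where
  "ramp a b x = max 0 (min 1 ((b - x) / (b - a)))"

lemma ramp_bounds: "0 \<le> ramp a b x" "ramp a b x \<le> 1"
  by (auto simp: ramp_def)

lemma ramp_eq_1: "a < b \<Longrightarrow> x \<le> a \<Longrightarrow> ramp a b x = 1"
  by (auto simp: ramp_def field_simps)

lemma ramp_eq_0: "a < b \<Longrightarrow> b \<le> x \<Longrightarrow> ramp a b x = 0"
  using divide_nonpos_pos[of "b - x" "b - a"] by (simp add: ramp_def)

lemma borel_measurable_ramp [measurable]: "ramp a b \<in> borel_measurable borel"
  unfolding ramp_def by measurable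

text \<open>The slope \<open>1 / (b - a)\<close> handles small distances and the range of length
  \<open>1\<close> the large ones; adding the two gives one constant for the truncated
  distance.\<close>

lemma ramp_lipschitz:
  assumes "a < b"
  shows "\<bar>ramp a b x - ramp a b y\<bar> \<le> (1 + 1 / (b - a)) * min \<bar>x - y\<bar> 1"
proof -
  have "\<bar>ramp a b x - ramp a b y\<bar> \<le> \<bar>(b - x) / (b - a) - (b - y) / (b - a)\<bar>"
    by (auto simp: ramp_def max_def min_def)
  also have "\<dots> = 1 / (b - a) * \<bar>x - y\<bar>"
    using assms by (simp add: diff_divide_distrib[symmetric] abs_minus_commute)
  also have "\<dots> \<le> (1 + 1 / (b - a)) * \<bar>x - y\<bar>" by (intro mult_right_mono) auto
  finally have 1: "\<bar>ramp a b x - ramp a b y\<bar> \<le> (1 + 1 / (b - a)) * \<bar>x - y\<bar>" .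
  have "\<bar>ramp a b x - ramp a b y\<bar> \<le> 1"
    using ramp_bounds[of a b x] ramp_bounds[of a b y] by linarith
  also have "\<dots> \<le> 1 + 1 / (b - a)" using assms by simp
  finally have "\<bar>ramp a b x - ramp a b y\<bar> \<le> (1 + 1 / (b - a)) * 1" by simp
  with 1 show ?thesis by (auto simp: min_def)
qed

section \<open>Crossings and conditional means\<close>

lemma cond_mean_bounds:
  assumes "\<And>x. 0 \<le> f x" "\<And>x. f x \<le> 1"
  shows "\<bar>cond_mean N Q f k x\<bar> \<le> 1"
  using lambda1.integral_unit_interval[of "\<lambda>t. f (cond_quantile N Q k x t)"] assms
  by (simp add: cond_mean_def)

lemma cond_mean_resample:
  assumes Q: "quantile_process N Q" and u: "u \<in> space (lambdaN N)" and k: "k < N"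
  shows "cond_mean N Q f k (past k (Q u)) = (\<integral>t. f (Q (u(k := t)) k) \<partial>lambda1)"
  unfolding cond_mean_def
  by (intro Bochner_Integration.integral_cong refl)
    (simp add: space_lambda1 cond_quantile_resample[OF Q u k] del: restrict_apply)

text \<open>
  Both quantile functions increase in the last coordinate \<open>t\<close>, so a crossing at one \<open>t\<close> fixes the
  sign of \<open>ramp a b (Q (u(k := t)) k) - ramp a b (Q' (u(k := t)) k)\<close> for all \<open>t\<close>. Hence
  means of ramp functions control the crossings.
\<close>

lemma crossing_le_cond_mean:
  assumes Q: "quantile_process N Q" and Q': "quantile_process N Q'" and k: "k < N" and ab: "a < b"
  shows "measure (lambdaN N) {u\<in>space (lambdaN N). Q u k \<le> a \<and> b \<le> Q' u k}
    \<le> (\<integral>u. \<bar>cond_mean N Q (ramp a b) k (past k (Q u)) - cond_mean N Q' (ramp a b) k (past k (Q' u))\<bar> \<partial>lambdaN N)"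
proof -
  let ?d = "\<lambda>u. \<bar>cond_mean N Q (ramp a b) k (past k (Q u)) - cond_mean N Q' (ramp a b) k (past k (Q' u))\<bar>"
  let ?S = "{u\<in>space (lambdaN N). Q u k \<le> a \<and> b \<le> Q' u k}"
  have Qm[measurable]: "(\<lambda>u. Q u k) \<in> borel_measurable (lambdaN N)" and Q'm[measurable]: "(\<lambda>u. Q' u k) \<in> borel_measurable (lambdaN N)"
    using k Q Q' by (auto intro: measurable_coordinate quantile_processD)
  have S: "?S \<in> sets (lambdaN N)" by measurable
  have dm: "?d \<in> borel_measurable (lambdaN N)"
    using k by (intro borel_measurable_abs borel_measurable_diff
        measurable_compose[OF measurable_compose[OF quantile_processD(2)[OF Q] measurable_restrict_prefix[OF refl]] measurable_cond_mean[OF quantile_processD(2)[OF Q]]]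
        measurable_compose[OF measurable_compose[OF quantile_processD(2)[OF Q'] measurable_restrict_prefix[OF refl]] measurable_cond_mean[OF quantile_processD(2)[OF Q']]]) simp_all
  have d_int: "integrable (lambdaN N) ?d"
  proof (rule lN.integrable_const_bound[where B=2])
    have "?d u \<le> 2" for u
      using cond_mean_bounds[where f="ramp a b", OF ramp_bounds, of N Q k "past k (Q u)"]
        cond_mean_bounds[where f="ramp a b", OF ramp_bounds, of N Q' k "past k (Q' u)"] by linarith
    then show "AE u in lambdaN N. norm (?d u) \<le> 2" by simp
  qed (rule dm)
  have "emeasure (lambdaN N) ?S = (\<integral>\<^sup>+u. \<integral>\<^sup>+t. indicator ?S (u(k := t)) \<partial>lambda1 \<partial>lambdaN N)"
    using nn_integral_lambdaN_resample[OF borel_measurable_indicator[OF S] k] S by simp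
  also have "\<dots> \<le> (\<integral>\<^sup>+u. ennreal (?d u) \<partial>lambdaN N)"
  proof (rule nn_integral_mono)
    fix u assume u: "u \<in> space (lambdaN N)"
    define \<phi> where "\<phi> t = Q (u(k := t)) k" for t
    define \<psi> where "\<psi> t = Q' (u(k := t)) k" for t
    have upd: "(\<lambda>t. u(k := t)) \<in> measurable lambda1 (lambdaN N)"
      using u by (intro measurable_fun_upd_lambdaN k measurable_const measurable_ident_sets refl)
    have \<phi>m: "\<phi> \<in> borel_measurable lambda1" "\<psi> \<in> borel_measurable lambda1"
      unfolding \<phi>_def \<psi>_def
      using measurable_coordinate_comp[OF quantile_processD(2)[OF Q] upd k]
        measurable_coordinate_comp[OF quantile_processD(2)[OF Q'] upd k] by simp_all
    have mono: "\<phi> s \<le> \<phi> t" "\<psi> s \<le> \<psi> t" if "0 < s" "s \<le> t" "t < 1" for s t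
      using quantile_processD(3)[OF Q k fun_upd_in_lambdaN[OF u k, of s], of t]
        quantile_processD(3)[OF Q' k fun_upd_in_lambdaN[OF u k, of s], of t] that by (auto simp: \<phi>_def \<psi>_def)
    let ?A = "{t\<in>{0<..<1}. \<phi> t \<le> a \<and> b \<le> \<psi> t}"
    have int: "integrable lambda1 (\<lambda>t. ramp a b (\<phi> t))" "integrable lambda1 (\<lambda>t. ramp a b (\<psi> t))"
      using \<phi>m ramp_bounds by (auto intro!: lambda1.integrable_const_bound[where B=1])
    have ind: "indicator ?S (u(k := t)) = (indicator ?A t :: ennreal)" if "t \<in> space lambda1" for t
      using that fun_upd_in_lambdaN[OF u k, of t] by (auto simp: indicator_def \<phi>_def \<psi>_def space_lambda1)
    have d_eq: "?d u = \<bar>(\<integral>t. ramp a b (\<phi> t) \<partial>lambda1) - (\<integral>t. ramp a b (\<psi> t) \<partial>lambda1)\<bar>"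
      unfolding cond_mean_resample[OF Q u k] cond_mean_resample[OF Q' u k] \<phi>_def \<psi>_def ..
    let ?i = "\<integral>\<^sup>+t. indicator ?S (u(k := t)) \<partial>lambda1"
    show "?i \<le> ennreal (?d u)"
    proof (cases "?A = {}")
      case True
      then have "?i = (\<integral>\<^sup>+t. 0 \<partial>lambda1)"
        using ind by (intro nn_integral_cong) simp
      then show ?thesis by simp
    next
      case False
      then obtain s where s: "0 < s" "s < 1" "\<phi> s \<le> a" "b \<le> \<psi> s" by auto
      \<comment> \<open>Up to the crossing point \<open>s\<close> the first ramp equals
        \<open>1\<close>, beyond it the second equals \<open>0\<close>. Either way the difference is
        nonnegative, and at any crossing \<open>t\<close> it is \<open>1\<close>.\<close>
      have le: "indicator ?A t \<le> ramp a b (\<phi> t) - ramp a b (\<psi> t)" if t: "t \<in> space lambda1" for t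
      proof (cases "t \<le> s")
        case True
        then have "ramp a b (\<phi> t) = 1"
          using mono[of t s] s t ab by (intro ramp_eq_1) (auto simp: space_lambda1)
        then show ?thesis using ramp_bounds[of a b "\<psi> t"] ramp_eq_0[OF ab, of "\<psi> t"] by (auto simp: indicator_def)
      next
        case False
        then have "ramp a b (\<psi> t) = 0"
          using mono[of s t] s t ab by (intro ramp_eq_0) (auto simp: space_lambda1)
        then show ?thesis using ramp_bounds[of a b "\<phi> t"] ramp_eq_1[OF ab, of "\<phi> t"] by (auto simp: indicator_def)
      qed
      have "?i \<le> (\<integral>\<^sup>+t. ennreal (ramp a b (\<phi> t) - ramp a b (\<psi> t)) \<partial>lambda1)"
      proof (rule nn_integral_mono)
        fix t assume t: "t \<in> space lambda1"
        have "indicator ?S (u(k := t)) = ennreal (indicator ?A t)" using ind[OF t] by (simp add: ennreal_indicator)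
        also have "\<dots> \<le> ennreal (ramp a b (\<phi> t) - ramp a b (\<psi> t))" using le[OF t] by (rule ennreal_leI)
        finally show "indicator ?S (u(k := t)) \<le> ennreal (ramp a b (\<phi> t) - ramp a b (\<psi> t))" .
      qed
      also have "\<dots> = ennreal (\<integral>t. ramp a b (\<phi> t) - ramp a b (\<psi> t) \<partial>lambda1)"
      proof (rule nn_integral_eq_integral)
        show "AE t in lambda1. 0 \<le> ramp a b (\<phi> t) - ramp a b (\<psi> t)"
          using order_trans[OF indicator_pos_le le] by (intro AE_I2)
      qed (use int in simp)
      also have "\<dots> \<le> ennreal (?d u)"
        using int unfolding d_eq by (intro ennreal_leI) simp
      finally show ?thesis .
    qed
  qed
  also have "\<dots> = ennreal (\<integral>u. ?d u \<partial>lambdaN N)"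
    using d_int by (intro nn_integral_eq_integral) auto
  finally show ?thesis
    by (simp add: lN.emeasure_eq_measure)
qed

lemma trunc_dist_cong: "(\<And>i. i < k \<Longrightarrow> x i = x' i) \<Longrightarrow> (\<And>i. i < k \<Longrightarrow> y i = y' i) \<Longrightarrow> trunc_dist k x y = trunc_dist k x' y'"
  unfolding trunc_dist_def by (intro sum.cong) auto

lemma trunc_dist_mono: "k \<le> N \<Longrightarrow> trunc_dist k x y \<le> trunc_dist N x y"
  unfolding trunc_dist_def by (intro sum_mono2) auto

lemma trunc_dist_component: "k < N \<Longrightarrow> min \<bar>x k - y k\<bar> 1 \<le> trunc_dist N x y"
  unfolding trunc_dist_def by (intro member_le_sum[of k _ "\<lambda>i. min \<bar>x i - y i\<bar> 1"]) auto

text \<open>Only the kernel of the fixed \<open>Q\<close> is approximated, so \<open>g\<close> and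
  \<open>L\<close> do not vary with \<open>n\<close>; of the kernels of \<open>Qn n\<close> nothing
  but boundedness enters. The bound on \<open>?D a b\<close> is symmetric in the two processes and
  therefore serves upward and downward crossings alike.\<close>

lemma tendsto_trunc_dist_quantile_processes:
  assumes Q: "quantile_process N Q" and Qn: "\<And>n. quantile_process N (Qn n)"
    and \<pi>: "\<And>n. \<pi> n \<in> bicausal N (law N Q) (law N (Qn n))"
    and conv: "(\<lambda>n. \<integral>z. trunc_dist N (fst z) (snd z) \<partial>\<pi> n) \<longlonglongrightarrow> 0"
  shows "k \<le> N \<Longrightarrow> (\<lambda>n. \<integral>u. trunc_dist k (Q u) (Qn n u) \<partial>lambdaN N) \<longlonglongrightarrow> 0"
proof (induction k)
  case 0
  then show ?case by (simp add: trunc_dist_def)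
next
  case (Suc k)
  then have k: "k < N" "k \<le> N" and IH: "(\<lambda>n. \<integral>u. trunc_dist k (Q u) (Qn n u) \<partial>lambdaN N) \<longlonglongrightarrow> 0" by auto
  note Qm = quantile_processD(2)[OF Q] and Qnm = quantile_processD(2)[OF Qn]
  have p: "prob_space (law N Q)" by (rule lN.prob_space_distr[OF Qm])
  note marg = bicausal_marginals[OF \<pi> p sets_distr sets_distr]
  define r where "r x = past k x" for x :: "nat \<Rightarrow> real"
  have r: "r \<in> measurable (RN N) (RN k)"
    unfolding r_def using k by (intro measurable_restrict_prefix[OF refl]) simp
  let ?e = "\<lambda>n. \<integral>z. trunc_dist N (fst z) (snd z) \<partial>\<pi> n"
  let ?t = "\<lambda>n. \<integral>u. trunc_dist k (Q u) (Qn n u) \<partial>lambdaN N"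
  let ?D = "\<lambda>a b n. \<integral>u. \<bar>cond_mean N Q (ramp a b) k (r (Q u)) - cond_mean N (Qn n) (ramp a b) k (r (Qn n u))\<bar> \<partial>lambdaN N"
  have D_lim: "?D a b \<longlonglongrightarrow> 0" if ab: "a < b" for a b
  proof (rule tendstoI)
    fix \<epsilon> :: real assume \<epsilon>: "0 < \<epsilon>"
    let ?\<kappa> = "cond_mean N Q (ramp a b) k" and ?\<alpha> = "\<lambda>n. cond_mean N (Qn n) (ramp a b) k"
    have \<kappa>: "?\<kappa> \<in> borel_measurable (RN k)" "\<And>x. \<bar>?\<kappa> x\<bar> \<le> 1"
      using ramp_bounds by (auto intro!: measurable_cond_mean[OF Qm] cond_mean_bounds)
    have \<alpha>: "?\<alpha> n \<in> borel_measurable (RN k)" "\<And>x. \<bar>?\<alpha> n x\<bar> \<le> 1" for n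
      using ramp_bounds by (auto intro!: measurable_cond_mean[OF Qnm] cond_mean_bounds)
    define C where "C = 1 + 1 / (b - a)"
    let ?m = "distr (lambdaN N) (RN k) (\<lambda>u. r (Q u))"
    have rQ: "(\<lambda>u. r (Q u)) \<in> measurable (lambdaN N) (RN k)" by (rule measurable_compose[OF Qm r])
    interpret m: prob_space ?m by (rule lN.prob_space_distr[OF rQ])
    have "integrable ?m ?\<kappa>"
      using \<kappa> by (intro m.integrable_const_bound[where B=1]) auto
    then have "approximable k ?m ?\<kappa>"
      by (intro approximable_integrable m.finite_measure_axioms) simp_all
    moreover have "0 < \<epsilon> / 4" using \<epsilon> by simp
    ultimately obtain g L where g: "trunc_lipschitz k L g" "(\<integral>x. \<bar>?\<kappa> x - g x\<bar> \<partial>?m) < \<epsilon> / 4"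
      unfolding approximable_def by blast
    have gm: "g \<in> borel_measurable (RN k)" and L: "0 \<le> L" using g(1) by (auto simp: trunc_lipschitz_def)
    let ?kg = "\<integral>u. \<bar>?\<kappa> (r (Q u)) - g (r (Q u))\<bar> \<partial>lambdaN N"
    let ?ak = "\<lambda>n. \<integral>z. \<bar>?\<alpha> n (r (snd z)) - ?\<kappa> (r (fst z))\<bar> \<partial>\<pi> n"
    \<comment> \<open>The error of \<open>g\<close> enters twice and takes up
      \<open>\<epsilon> / 2\<close>; all other terms vanish in the limit, the last one by the
      induction hypothesis.\<close>
    let ?B = "\<lambda>n. C * ?e n + 2 * (\<epsilon> / 4) + L * (?e n + ?t n)"
    have g2: "?kg < \<epsilon> / 4"
      using g(2) \<kappa>(1) gm by (subst (asm) integral_distr[OF rQ]) auto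
    have bound: "?D a b n \<le> ?B n" for n
    proof -
      interpret \<pi>: prob_space "\<pi> n" by (rule marg(4))
      note fm = marg(5)[of n] and sm = marg(6)[of n]
      have td: "integrable (\<pi> n) (\<lambda>z. trunc_dist j (fst z) (snd z))" if "j \<le> N" for j
        using fm sm that by (rule \<pi>.integrable_trunc_dist)
      have law: "distr (\<pi> n) (RN k) (\<lambda>z. r (fst z)) = distr (lambdaN N) (RN k) (\<lambda>u. r (Q u))"
        "distr (\<pi> n) (RN k) (\<lambda>z. r (snd z)) = distr (lambdaN N) (RN k) (\<lambda>u. r (Qn n u))"
        using distr_distr[OF r fm] distr_distr[OF r sm] distr_distr[OF r Qm] distr_distr[OF r Qnm[of n]]
        by (simp_all add: marg(2,3) comp_def)
      \<comment> \<open>The variable of the approximated kernel comes second in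
        \<open>coupling_transfer\<close>, hence the exchange of the two processes.\<close>
      have "?D a b n = (\<integral>u. \<bar>?\<alpha> n (r (Qn n u)) - ?\<kappa> (r (Q u))\<bar> \<partial>lambdaN N)"
        by (simp add: abs_minus_commute)
      also have "\<dots> \<le> ?ak n
        + 2 * ?kg
        + L * ((\<integral>z. trunc_dist k (r (snd z)) (r (fst z)) \<partial>\<pi> n) + (\<integral>u. trunc_dist k (r (Qn n u)) (r (Q u)) \<partial>lambdaN N))"
        by (rule coupling_transfer[OF \<pi>.prob_space_axioms lN.prob_space_axioms measurable_compose[OF sm r] measurable_compose[OF fm r]
              measurable_compose[OF Qnm r] measurable_compose[OF Qm r] law(2) law(1) \<alpha> \<kappa> g(1)])
      also have "\<dots> \<le> ?B n"
      proof (intro add_mono mult_left_mono L)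
        have "?ak n \<le> (\<integral>z. \<bar>ramp a b (fst z k) - ramp a b (snd z k)\<bar> \<partial>\<pi> n)"
          using bicausal_cond_mean_le[OF Q Qn \<pi> k(1) borel_measurable_ramp ramp_bounds]
          by (simp add: r_def abs_minus_commute del: restrict_apply)
        also have "\<dots> \<le> (\<integral>z. C * trunc_dist N (fst z) (snd z) \<partial>\<pi> n)"
        proof (rule integral_mono)
          have km: "(\<lambda>z. fst z k) \<in> borel_measurable (\<pi> n)" "(\<lambda>z. snd z k) \<in> borel_measurable (\<pi> n)"
            using fm sm k by (auto intro: measurable_coordinate)
          show "integrable (\<pi> n) (\<lambda>z. \<bar>ramp a b (fst z k) - ramp a b (snd z k)\<bar>)"
          proof (intro \<pi>.integrable_const_bound[where B=1])
            have "\<bar>ramp a b x - ramp a b y\<bar> \<le> 1" for x y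
              using ramp_bounds[of a b x] ramp_bounds[of a b y] by linarith
            then show "AE z in \<pi> n. norm \<bar>ramp a b (fst z k) - ramp a b (snd z k)\<bar> \<le> 1" by simp
          qed (intro borel_measurable_abs borel_measurable_diff measurable_compose[OF _ borel_measurable_ramp] km)
          show "integrable (\<pi> n) (\<lambda>z. C * trunc_dist N (fst z) (snd z))" using td[of N] by simp
          fix z :: "(nat \<Rightarrow> real) \<times> (nat \<Rightarrow> real)"
          have "\<bar>ramp a b (fst z k) - ramp a b (snd z k)\<bar> \<le> C * min \<bar>fst z k - snd z k\<bar> 1"
            unfolding C_def by (rule ramp_lipschitz[OF ab])
          also have "\<dots> \<le> C * trunc_dist N (fst z) (snd z)"
            using ab k by (intro mult_left_mono trunc_dist_component) (auto simp: C_def)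
          finally show "\<bar>ramp a b (fst z k) - ramp a b (snd z k)\<bar> \<le> C * trunc_dist N (fst z) (snd z)" .
        qed
        also have "\<dots> = C * ?e n" by simp
        finally show "?ak n \<le> C * ?e n" .
        show "?kg \<le> \<epsilon> / 4" using g2 by simp
        have "(\<integral>z. trunc_dist k (r (snd z)) (r (fst z)) \<partial>\<pi> n) = (\<integral>z. trunc_dist k (fst z) (snd z) \<partial>\<pi> n)"
          by (intro Bochner_Integration.integral_cong refl, subst trunc_dist_commute, rule trunc_dist_cong) (auto simp: r_def)
        also have "\<dots> \<le> ?e n" using td k by (intro integral_mono trunc_dist_mono) auto
        finally show "(\<integral>z. trunc_dist k (r (snd z)) (r (fst z)) \<partial>\<pi> n) \<le> ?e n" .
        have "(\<integral>u. trunc_dist k (r (Qn n u)) (r (Q u)) \<partial>lambdaN N) = ?t n"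
          by (intro Bochner_Integration.integral_cong refl, subst trunc_dist_commute, rule trunc_dist_cong) (auto simp: r_def)
        then show "(\<integral>u. trunc_dist k (r (Qn n u)) (r (Q u)) \<partial>lambdaN N) \<le> ?t n" by simp
      qed simp
      finally show ?thesis .
    qed
    have "?B
      \<longlonglongrightarrow> C * 0 + 2 * (\<epsilon> / 4) + L * (0 + 0)"
      by (intro tendsto_intros conv IH)
    from order_tendstoD(2)[OF this, of \<epsilon>] have "\<forall>\<^sub>F n in sequentially. ?B n < \<epsilon>"
      using \<epsilon> by simp
    then show "\<forall>\<^sub>F n in sequentially. dist (?D a b n) 0 < \<epsilon>"
    proof eventually_elim
      case (elim n)
      have "0 \<le> ?D a b n" by (intro integral_nonneg_AE) auto
      with bound[of n] elim show ?case by simp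
    qed
  qed
  have Qk: "(\<lambda>u. Q u k) \<in> borel_measurable (lambdaN N)" "(\<lambda>u. Qn n u k) \<in> borel_measurable (lambdaN N)" for n
    using k Qm Qnm by (auto intro: measurable_coordinate)
  have "(\<lambda>n. \<integral>u. min \<bar>Q u k - Qn n u k\<bar> 1 \<partial>lambdaN N) \<longlonglongrightarrow> 0"
  proof (rule lN.tendsto_min_dist_of_crossings[OF Qk])
    fix a b :: real assume ab: "a < b"
    show "(\<lambda>n. measure (lambdaN N) {u\<in>space (lambdaN N). Q u k \<le> a \<and> b \<le> Qn n u k}) \<longlonglongrightarrow> 0"
      using crossing_le_cond_mean[OF Q Qn k(1) ab]
      by (intro tendsto_sandwich[OF _ _ tendsto_const D_lim[OF ab]]) (auto simp: r_def simp del: restrict_apply)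
    show "(\<lambda>n. measure (lambdaN N) {u\<in>space (lambdaN N). Qn n u k \<le> a \<and> b \<le> Q u k}) \<longlonglongrightarrow> 0"
      using crossing_le_cond_mean[OF Qn Q k(1) ab]
      by (intro tendsto_sandwich[OF _ _ tendsto_const D_lim[OF ab]]) (auto simp: r_def abs_minus_commute simp del: restrict_apply)
  qed
  then have "(\<lambda>n. ?t n + (\<integral>u. min \<bar>Q u k - Qn n u k\<bar> 1 \<partial>lambdaN N)) \<longlonglongrightarrow> 0 + 0"
    by (intro tendsto_add IH)
  moreover have "(\<integral>u. trunc_dist (Suc k) (Q u) (Qn n u) \<partial>lambdaN N)
    = ?t n + (\<integral>u. min \<bar>Q u k - Qn n u k\<bar> 1 \<partial>lambdaN N)" for n
  proof -
    have "integrable (lambdaN N) (\<lambda>u. min \<bar>Q u k - Qn n u k\<bar> 1)"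
      using Qk by (intro lN.integrable_const_bound[where B=1]) auto
    with lN.integrable_trunc_dist[OF Qm Qnm k(2)] show ?thesis
      by (simp add: trunc_dist_def)
  qed
  ultimately show ?case by simp
qed

section \<open>Costs and the adapted weak topology\<close>

lemma cost_nonneg: "0 \<le> cost p N x y"
  by (simp add: cost_def sum_nonneg L2_set_nonneg)

lemma cost_self: "p \<noteq> 0 \<Longrightarrow> cost p N x x = 0" "cost 0 N x x = 0"
  by (simp_all add: cost_def L2_set_def)

lemma cost_commute: "cost p N x y = cost p N y x"
  by (simp add: cost_def L2_set_def abs_minus_commute power2_commute)

lemma cost_zero_le_trunc_dist: "cost 0 N x y \<le> trunc_dist N x y"
proof (cases "\<exists>i<N. 1 \<le> \<bar>x i - y i\<bar>")
  case True
  then obtain i where i: "i < N" "1 \<le> \<bar>x i - y i\<bar>" by blast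
  have "cost 0 N x y \<le> 1" by (simp add: cost_def)
  also have "1 \<le> trunc_dist N x y" using trunc_dist_component[OF i(1), of x y] i(2) by simp
  finally show ?thesis .
next
  case False
  have "cost 0 N x y \<le> L2_set (\<lambda>i. x i - y i) {0..<N}" by (simp add: cost_def)
  also have "\<dots> \<le> (\<Sum>i\<in>{0..<N}. \<bar>x i - y i\<bar>)" by (rule L2_set_le_sum_abs)
  also have "\<dots> = trunc_dist N x y"
    using False unfolding trunc_dist_def by (intro sum.cong) (auto simp: not_le)
  finally show ?thesis .
qed

lemma trunc_dist_le_cost_zero: "trunc_dist N x y \<le> real N * cost 0 N x y"
proof -
  have "min \<bar>x i - y i\<bar> 1 \<le> cost 0 N x y" if "i < N" for i
    using member_le_L2_set[of "{0..<N}" i "\<lambda>i. \<bar>x i - y i\<bar>"] that by (auto simp: cost_def L2_set_def)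
  then have "trunc_dist N x y \<le> (\<Sum>i<N. cost 0 N x y)"
    unfolding trunc_dist_def by (intro sum_mono) auto
  then show ?thesis by simp
qed

text \<open>A pointwise Markov inequality: coordinates at distance at most \<delta> are charged
  \<delta>, the others are paid for by their \<open>p\<close>-th power.\<close>

lemma trunc_dist_le_cost:
  assumes p: "1 \<le> p" and \<delta>: "0 < \<delta>"
  shows "trunc_dist N x y \<le> real N * \<delta> + \<delta> powr (- p) * cost p N x y"
proof -
  have "min \<bar>x i - y i\<bar> 1 \<le> \<delta> + \<delta> powr (- p) * \<bar>x i - y i\<bar> powr p" for i
  proof (cases "\<bar>x i - y i\<bar> \<le> \<delta>")
    case True
    then have "min \<bar>x i - y i\<bar> 1 \<le> \<delta>" by simp
    moreover have "0 \<le> \<delta> powr (- p) * \<bar>x i - y i\<bar> powr p" by simp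
    ultimately show ?thesis by linarith
  next
    case False
    have "1 = \<delta> powr (- p) * \<delta> powr p" using \<delta> by (simp add: powr_add[symmetric])
    also have "\<dots> \<le> \<delta> powr (- p) * \<bar>x i - y i\<bar> powr p"
      using False \<delta> p by (intro mult_left_mono powr_mono2) auto
    finally show ?thesis using \<delta> by linarith
  qed
  then have "trunc_dist N x y \<le> (\<Sum>i<N. \<delta> + \<delta> powr (- p) * \<bar>x i - y i\<bar> powr p)"
    unfolding trunc_dist_def by (rule sum_mono)
  also have "\<dots> = real N * \<delta> + \<delta> powr (- p) * cost p N x y"
    using p by (simp add: sum.distrib sum_distrib_left cost_def)
  finally show ?thesis .
qed

section \<open>Integrability of the cost and Minkowski's inequality\<close>

lemma borel_measurable_cost:
  assumes "f \<in> measurable M (RN N)" "g \<in> measurable M (RN N)"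
  shows "(\<lambda>w. cost p N (f w) (g w)) \<in> borel_measurable M"
proof -
  have "(\<lambda>w. f w i) \<in> borel_measurable M" "(\<lambda>w. g w i) \<in> borel_measurable M" if "i < N" for i
    using assms that by (auto intro: measurable_coordinate)
  then show ?thesis
    unfolding cost_def L2_set_def by (cases "p = 0") (auto intro!: borel_measurable_sum borel_measurable_min
      borel_measurable_sqrt borel_measurable_power borel_measurable_diff powr_real_measurable borel_measurable_abs)
qed

definition moment :: "real \<Rightarrow> nat \<Rightarrow> 'a measure \<Rightarrow> ('a \<Rightarrow> nat \<Rightarrow> real) \<Rightarrow> bool" where
  "moment p N M f \<longleftrightarrow> f \<in> measurable M (RN N) \<and> (p \<noteq> 0 \<longrightarrow> (\<forall>i<N. integrable M (\<lambda>w. \<bar>f w i\<bar> powr p)))"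

lemma moment_distr:
  assumes f: "f \<in> measurable M (RN N)" and P: "distr M (RN N) f \<in> P_space p N"
  shows "moment p N M f"
  unfolding moment_def
proof (intro conjI impI allI f)
  fix i assume p: "p \<noteq> 0" and i: "i < N"
  have "integrable (distr M (RN N) f) (\<lambda>x. \<Sum>i<N. \<bar>x i\<bar> powr p)"
    using P p by (simp add: P_space_def)
  then have "integrable M (\<lambda>w. \<Sum>i<N. \<bar>f w i\<bar> powr p)"
    using f by (subst (asm) integrable_distr_eq) auto
  then show "integrable M (\<lambda>w. \<bar>f w i\<bar> powr p)"
  proof (rule Bochner_Integration.integrable_bound)
    have "(\<lambda>w. f w i) \<in> borel_measurable M" using f i by (rule measurable_coordinate)
    then show "(\<lambda>w. \<bar>f w i\<bar> powr p) \<in> borel_measurable M" by measurable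
    have "\<bar>f w i\<bar> powr p \<le> (\<Sum>i<N. \<bar>f w i\<bar> powr p)" for w
      using i by (intro member_le_sum) auto
    then show "AE w in M. norm (\<bar>f w i\<bar> powr p) \<le> norm (\<Sum>i<N. \<bar>f w i\<bar> powr p)"
      by (simp add: sum_nonneg)
  qed
qed

lemma (in prob_space) integrable_cost:
  assumes p: "p \<in> {0} \<union> {1..}" and f: "moment p N M f" and g: "moment p N M g"
  shows "integrable M (\<lambda>w. cost p N (f w) (g w))"
proof (cases "p = 0")
  case True
  have m: "(\<lambda>w. cost p N (f w) (g w)) \<in> borel_measurable M"
    using f g by (intro borel_measurable_cost) (auto simp: moment_def)
  show ?thesis
    using m by (rule integrable_const_bound[where B=1, rotated]) (simp add: True cost_def L2_set_nonneg)
next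
  case False
  have "integrable M (\<lambda>w. \<bar>f w i - g w i\<bar> powr p)" if "i < N" for i
    using that f g p False by (intro integrable_powr_dist measurable_coordinate) (auto simp: moment_def)
  with False show ?thesis
    unfolding cost_def by (auto intro!: Bochner_Integration.integrable_sum)
qed

lemma p_root_nonneg: "0 \<le> c \<Longrightarrow> 0 \<le> p_root p c"
  by (simp add: p_root_def)

lemma tendsto_p_root_zero_iff:
  assumes p: "p \<in> {0} \<union> {1..}" and c: "\<And>n. 0 \<le> c n"
  shows "(\<lambda>n. p_root p (c n)) \<longlonglongrightarrow> 0 \<longleftrightarrow> c \<longlonglongrightarrow> 0"
proof (cases "p = 0")
  case True
  then show ?thesis by (simp add: p_root_def)
next
  case False
  then have p1: "1 \<le> p" using p by auto
  have pow: "(\<lambda>n. a n powr q) \<longlonglongrightarrow> 0" if "a \<longlonglongrightarrow> 0" "\<And>n. 0 \<le> a n" "0 < q" for a :: "nat \<Rightarrow> real" and q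
    using tendsto_powr'[OF that(1) tendsto_const, of q] that(2,3) by simp
  show ?thesis
  proof
    assume "(\<lambda>n. p_root p (c n)) \<longlonglongrightarrow> 0"
    then have "(\<lambda>n. c n powr (1 / p)) \<longlonglongrightarrow> 0" using False by (simp add: p_root_def)
    from pow[OF this, of p] have "(\<lambda>n. (c n powr (1 / p)) powr p) \<longlonglongrightarrow> 0" using p1 by simp
    then show "c \<longlonglongrightarrow> 0" using p1 c by (simp add: powr_powr)
  next
    assume "c \<longlonglongrightarrow> 0"
    from pow[OF this c, of "1 / p"] show "(\<lambda>n. p_root p (c n)) \<longlonglongrightarrow> 0"
      using False p1 by (simp add: p_root_def)
  qed
qed

text \<open>Convexity of the power function at \<open>s / a\<close> and \<open>t / b\<close> with
  weights \<open>a / (a + b)\<close> and \<open>b / (a + b)\<close>. These weights are those of the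
  proof of Minkowski's inequality: if \<open>a\<close> and \<open>b\<close> bound the two norms,
  integration turns the right side into at most \<open>(a + b) powr p\<close>.\<close>

lemma powr_add_weighted_le:
  fixes a b s t p :: real
  assumes ab: "0 < a" "0 < b" and st: "0 \<le> s" "0 \<le> t" and p: "1 \<le> p"
  shows "(s + t) powr p \<le> (a + b) powr (p - 1) * (s powr p * a powr (1 - p) + t powr p * b powr (1 - p))"
proof -
  have one: "t powr p \<le> (a + b) powr (p - 1) * (t powr p * b powr (1 - p))" if "0 < a" "0 < b" for a b t :: real
  proof -
    have "1 = b powr (p - 1) * b powr (1 - p)" using that by (simp add: powr_add[symmetric])
    also have "\<dots> \<le> (a + b) powr (p - 1) * b powr (1 - p)"
      using that p by (intro mult_right_mono powr_mono2) auto
    finally have "t powr p * 1 \<le> t powr p * ((a + b) powr (p - 1) * b powr (1 - p))"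
      by (intro mult_left_mono) auto
    then show ?thesis by (simp add: mult_ac)
  qed
  consider "s = 0" | "t = 0" | "0 < s" "0 < t" using st by linarith
  then show ?thesis
  proof cases
    case 1
    then show ?thesis using one[OF ab, of t] p by simp
  next
    case 2
    then show ?thesis using one[OF ab(2,1), of s] p by (simp add: add.commute)
  next
    case 3
    define u where "u = b / (a + b)"
    have u: "0 \<le> u" "u \<le> 1" "1 - u = a / (a + b)" using ab by (auto simp: u_def field_simps)
    have "((1 - u) *\<^sub>R (s / a) + u *\<^sub>R (t / b)) powr p \<le> (1 - u) * (s / a) powr p + u * (t / b) powr p"
      using 3 ab u by (intro convex_onD[OF powr_convex[OF p]]) auto
    also have "(1 - u) *\<^sub>R (s / a) + u *\<^sub>R (t / b) = (s + t) / (a + b)"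
      unfolding u(3) using ab by (simp add: u_def add_divide_distrib)
    finally have "((s + t) / (a + b)) powr p \<le> a / (a + b) * (s / a) powr p + b / (a + b) * (t / b) powr p"
      unfolding u(3) by (simp add: u_def)
    then have "(s + t) powr p / (a + b) powr p \<le> a / (a + b) * (s powr p / a powr p) + b / (a + b) * (t powr p / b powr p)"
      using 3 ab by (simp add: powr_divide)
    then have "(a + b) powr p * ((s + t) powr p / (a + b) powr p) \<le>
      (a + b) powr p * (a / (a + b) * (s powr p / a powr p) + b / (a + b) * (t powr p / b powr p))"
      by (rule mult_left_mono) simp
    also have "(a + b) powr p = (a + b) powr (p - 1) * (a + b)"
      using ab powr_add[of "a + b" "p - 1" 1] by simp
    also have "(a + b) powr (p - 1) * (a + b) * (a / (a + b) * (s powr p / a powr p) + b / (a + b) * (t powr p / b powr p))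
      = (a + b) powr (p - 1) * (s powr p * (a / a powr p) + t powr p * (b / b powr p))"
    proof -
      have gen: "X * (a / X * S + b / X * T) = a * S + b * T" if "X \<noteq> 0" for X S T :: real
        using that by (simp add: distrib_left)
      have "(a + b) * (a / (a + b) * (s powr p / a powr p) + b / (a + b) * (t powr p / b powr p))
        = a * (s powr p / a powr p) + b * (t powr p / b powr p)"
        using ab by (intro gen) simp
      then show ?thesis unfolding mult.assoc by (simp add: mult.commute)
    qed
    also have "a / a powr p = a powr (1 - p)" using ab by (simp add: powr_diff)
    also have "b / b powr p = b powr (1 - p)" using ab by (simp add: powr_diff)
    finally show ?thesis using ab powr_add[of "a + b" "p - 1" 1] by simp
  qed
qed

lemma cost_triangle_weighted:
  assumes p: "p \<in> {1..}" and ab: "0 < a" "0 < b"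
  shows "cost p N x z \<le> (a + b) powr (p - 1) * (cost p N x y * a powr (1 - p) + cost p N y z * b powr (1 - p))"
proof -
  have c: "cost p N x y = (\<Sum>i<N. \<bar>x i - y i\<bar> powr p)" for x y
    using p by (simp add: cost_def)
  have "\<bar>x i - z i\<bar> powr p \<le> (a + b) powr (p - 1) * (\<bar>x i - y i\<bar> powr p * a powr (1 - p) + \<bar>y i - z i\<bar> powr p * b powr (1 - p))" for i
  proof -
    have "\<bar>x i - z i\<bar> powr p \<le> (\<bar>x i - y i\<bar> + \<bar>y i - z i\<bar>) powr p"
      using p by (intro powr_mono2) auto
    also have "\<dots> \<le> (a + b) powr (p - 1) * (\<bar>x i - y i\<bar> powr p * a powr (1 - p) + \<bar>y i - z i\<bar> powr p * b powr (1 - p))"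
      using p ab by (intro powr_add_weighted_le) auto
    finally show ?thesis .
  qed
  then have "cost p N x z \<le> (\<Sum>i<N. (a + b) powr (p - 1) * (\<bar>x i - y i\<bar> powr p * a powr (1 - p) + \<bar>y i - z i\<bar> powr p * b powr (1 - p)))"
    unfolding c by (rule sum_mono)
  also have "\<dots> = (a + b) powr (p - 1) * (cost p N x y * a powr (1 - p) + cost p N y z * b powr (1 - p))"
    unfolding c sum_distrib_right sum.distrib[symmetric] sum_distrib_left ..
  finally show ?thesis .
qed

lemma cost_triangle_zero: "cost 0 N x z \<le> cost 0 N x y + cost 0 N y z"
proof -
  have "L2_set (\<lambda>i. x i - z i) {0..<N} = L2_set (\<lambda>i. (x i - y i) + (y i - z i)) {0..<N}" by simp
  also have "\<dots> \<le> L2_set (\<lambda>i. x i - y i) {0..<N} + L2_set (\<lambda>i. y i - z i) {0..<N}" by (rule L2_set_triangle_ineq)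
  finally have "L2_set (\<lambda>i. x i - z i) {0..<N} \<le> L2_set (\<lambda>i. x i - y i) {0..<N} + L2_set (\<lambda>i. y i - z i) {0..<N}" .
  moreover have "min C 1 \<le> min A 1 + min B 1" if "C \<le> A + B" "0 \<le> A" "0 \<le> B" for A B C :: real
    using that by (simp add: min_def)
  ultimately show ?thesis by (simp add: cost_def L2_set_nonneg)
qed

text \<open>The triangle inequality is phrased with strict upper bounds \<open>a\<close> and
  \<open>b\<close> because these serve as weights and must be positive, while the distances
  themselves may be zero.\<close>

lemma Lp_dist_triangle:
  assumes p: "p \<in> {0} \<union> {1..}"
    and f: "moment p N (lambdaN N) f" and g: "moment p N (lambdaN N) g" and h: "moment p N (lambdaN N) h"
    and ab: "0 < a" "0 < b" "Lp_dist p N f g < a" "Lp_dist p N g h < b"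
  shows "Lp_dist p N f h \<le> a + b"
proof -
  note int = lN.integrable_cost[OF p f g] lN.integrable_cost[OF p g h] lN.integrable_cost[OF p f h]
  let ?C = "\<lambda>f g. \<integral>u. cost p N (f u) (g u) \<partial>lambdaN N"
  have C0: "0 \<le> ?C f g" "0 \<le> ?C g h" "0 \<le> ?C f h" by (auto intro!: integral_nonneg_AE simp: cost_nonneg)
  show ?thesis
  proof (cases "p = 0")
    case True
    have "?C f h \<le> (\<integral>u. cost p N (f u) (g u) + cost p N (g u) (h u) \<partial>lambdaN N)"
      using int by (intro integral_mono) (auto simp: True cost_triangle_zero)
    also have "\<dots> = ?C f g + ?C g h" using int by simp
    finally show ?thesis using ab True by (simp add: Lp_dist_def p_root_def)
  next
    case False
    then have p1: "1 \<le> p" using p by auto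
    have le: "c \<le> d powr p" if "0 \<le> c" "0 < d" "c powr (1 / p) < d" for c d :: real
      using powr_mono2[of p "c powr (1 / p)" d] that p1 by (simp add: powr_powr)
    have Cfg: "?C f g \<le> a powr p" "?C g h \<le> b powr p"
      using ab False C0 by (auto simp: Lp_dist_def p_root_def intro!: le)
    have "?C f h \<le> (\<integral>u. (a + b) powr (p - 1) * (cost p N (f u) (g u) * a powr (1 - p) + cost p N (g u) (h u) * b powr (1 - p)) \<partial>lambdaN N)"
      using int p1 ab by (intro integral_mono cost_triangle_weighted) auto
    also have "\<dots> = (a + b) powr (p - 1) * (?C f g * a powr (1 - p) + ?C g h * b powr (1 - p))"
      using int by simp
    also have "\<dots> \<le> (a + b) powr (p - 1) * (a powr p * a powr (1 - p) + b powr p * b powr (1 - p))"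
      by (intro mult_left_mono add_mono mult_right_mono Cfg) auto
    also have "\<dots> = (a + b) powr (p - 1) * (a + b)"
      using ab by (simp add: powr_add[symmetric])
    also have "\<dots> = (a + b) powr p"
      using ab powr_add[of "a + b" "p - 1" 1] by simp
    finally have "?C f h powr (1 / p) \<le> ((a + b) powr p) powr (1 / p)"
      using C0 p1 by (intro powr_mono2) auto
    also have "\<dots> = a + b" using ab p1 by (simp add: powr_powr)
    finally show ?thesis using False by (simp add: Lp_dist_def p_root_def)
  qed
qed

section \<open>The adapted distance against the distance of quantile processes\<close>

lemma Lp_dist_nonneg: "0 \<le> Lp_dist p N f g"
  unfolding Lp_dist_def by (intro p_root_nonneg integral_nonneg_AE) (simp add: cost_nonneg)

lemma Lp_dist_self: "Lp_dist p N f f = 0"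
  by (cases "p = 0") (simp_all add: Lp_dist_def cost_self p_root_def)

lemma Lp_dist_commute: "Lp_dist p N f g = Lp_dist p N g f"
  by (simp add: Lp_dist_def cost_commute)

lemma moment_Qproc:
  assumes "\<mu> \<in> P_space p N"
  shows "moment p N (lambdaN N) (Qproc N \<mu>)"
  using quantile_processD(2)[OF quantile_process_Qproc[OF assms]] assms
  by (intro moment_distr) (simp_all add: distr_Qproc[OF assms])

lemma bicausal_Qproc:
  assumes \<mu>: "\<mu> \<in> P_space p N" and \<nu>: "\<nu> \<in> P_space p N"
  shows "distr (lambdaN N) (RN N \<Otimes>\<^sub>M RN N) (\<lambda>u. (Qproc N \<mu> u, Qproc N \<nu> u)) \<in> bicausal N \<mu> \<nu>"
  using bicausal_quantile_coupling[OF quantile_process_Qproc[OF \<mu>] quantile_process_Qproc[OF \<nu>]]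
  by (simp add: distr_Qproc[OF \<mu>] distr_Qproc[OF \<nu>])

lemma AW_nonneg:
  assumes "\<mu> \<in> P_space p N" "\<nu> \<in> P_space p N"
  shows "0 \<le> AW p N \<mu> \<nu>"
  unfolding AW_def using bicausal_Qproc[OF assms]
  by (intro cINF_greatest) (auto intro!: p_root_nonneg integral_nonneg_AE simp: cost_nonneg)

abbreviation (input) Qproc_dist :: "real \<Rightarrow> nat \<Rightarrow> (nat \<Rightarrow> real) measure \<Rightarrow> (nat \<Rightarrow> real) measure \<Rightarrow> real" where
  "Qproc_dist p N \<mu> \<nu> \<equiv> Lp_dist p N (Qproc N \<mu>) (Qproc N \<nu>)"

lemma AW_le_Lp_dist:
  assumes \<mu>: "\<mu> \<in> P_space p N" and \<nu>: "\<nu> \<in> P_space p N"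
  shows "AW p N \<mu> \<nu> \<le> Qproc_dist p N \<mu> \<nu>"
proof -
  let ?\<pi> = "distr (lambdaN N) (RN N \<Otimes>\<^sub>M RN N) (\<lambda>u. (Qproc N \<mu> u, Qproc N \<nu> u))"
  have Qm: "Qproc N \<mu> \<in> measurable (lambdaN N) (RN N)" "Qproc N \<nu> \<in> measurable (lambdaN N) (RN N)"
    using \<mu> \<nu> by (auto intro: quantile_processD quantile_process_Qproc)
  have "AW p N \<mu> \<nu> \<le> p_root p (\<integral>z. cost p N (fst z) (snd z) \<partial>?\<pi>)"
    unfolding AW_def
  proof (rule cINF_lower[OF _ bicausal_Qproc[OF \<mu> \<nu>]])
    show "bdd_below ((\<lambda>\<pi>. p_root p (\<integral>z. cost p N (fst z) (snd z) \<partial>\<pi>)) ` bicausal N \<mu> \<nu>)"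
      by (rule bdd_belowI[of _ 0]) (auto intro!: p_root_nonneg integral_nonneg_AE simp: cost_nonneg)
  qed
  also have "(\<integral>z. cost p N (fst z) (snd z) \<partial>?\<pi>) = (\<integral>u. cost p N (Qproc N \<mu> u) (Qproc N \<nu> u) \<partial>lambdaN N)"
    using Qm by (subst integral_distr) (auto intro!: borel_measurable_cost)
  finally show ?thesis by (simp add: Lp_dist_def)
qed

lemma tendsto_trunc_dist_of_cost:
  assumes p: "p \<in> {0} \<union> {1..}" and P: "\<And>n. prob_space (P n)"
    and f: "\<And>n. moment p N (P n) (f n)" and g: "\<And>n. moment p N (P n) (g n)"
    and lim: "(\<lambda>n. \<integral>w. cost p N (f n w) (g n w) \<partial>P n) \<longlonglongrightarrow> 0"
  shows "(\<lambda>n. \<integral>w. trunc_dist N (f n w) (g n w) \<partial>P n) \<longlonglongrightarrow> 0"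
proof -
  let ?c = "\<lambda>n. \<integral>w. cost p N (f n w) (g n w) \<partial>P n"
  let ?t = "\<lambda>n. \<integral>w. trunc_dist N (f n w) (g n w) \<partial>P n"
  have t0: "0 \<le> ?t n" for n by (intro integral_nonneg_AE) (simp add: trunc_dist_nonneg)
  have int: "integrable (P n) (\<lambda>w. cost p N (f n w) (g n w))" "integrable (P n) (\<lambda>w. trunc_dist N (f n w) (g n w))" for n
    using f[of n] g[of n] prob_space.integrable_cost[OF P p f g] prob_space.integrable_trunc_dist[OF P, of "f n" n N "g n" N]
    by (auto simp: moment_def)
  show ?thesis
  proof (cases "p = 0")
    case True
    have "?t n \<le> (\<integral>w. real N * cost p N (f n w) (g n w) \<partial>P n)" for n
      using int by (intro integral_mono) (auto simp: True trunc_dist_le_cost_zero)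
    then have le: "?t n \<le> real N * ?c n" for n by simp
    have "(\<lambda>n. real N * ?c n) \<longlonglongrightarrow> real N * 0" by (intro tendsto_intros lim)
    then show ?thesis
      using t0 le by (intro tendsto_sandwich[OF _ _ tendsto_const, of _ ?t _ "\<lambda>n. real N * ?c n"]) auto
  next
    case False
    then have p1: "1 \<le> p" using p by auto
    show ?thesis
    proof (rule tendstoI)
      fix \<epsilon> :: real assume \<epsilon>: "0 < \<epsilon>"
      \<comment> \<open>Adding \<open>1\<close> to \<open>real N\<close> keeps \<delta> positive for
        \<open>N = 0\<close>.\<close>
      define \<delta> where "\<delta> = \<epsilon> / (2 * (real N + 1))"
      have \<delta>: "0 < \<delta>" "real N * \<delta> < \<epsilon>" using \<epsilon> by (auto simp: \<delta>_def field_simps add_pos_nonneg intro: add_nonneg_pos)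
      have le: "?t n \<le> real N * \<delta> + \<delta> powr (- p) * ?c n" for n
      proof -
        interpret prob_space "P n" by (rule P)
        have "?t n \<le> (\<integral>w. real N * \<delta> + \<delta> powr (- p) * cost p N (f n w) (g n w) \<partial>P n)"
          using int p1 \<delta> by (intro integral_mono trunc_dist_le_cost) auto
        also have "\<dots> = real N * \<delta> + \<delta> powr (- p) * ?c n"
          using int by (simp add: prob_space)
        finally show ?thesis .
      qed
      have "(\<lambda>n. real N * \<delta> + \<delta> powr (- p) * ?c n) \<longlonglongrightarrow> real N * \<delta> + \<delta> powr (- p) * 0"
        by (intro tendsto_intros lim)
      from order_tendstoD(2)[OF this, of \<epsilon>] have "\<forall>\<^sub>F n in sequentially. real N * \<delta> + \<delta> powr (- p) * ?c n < \<epsilon>"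
        using \<delta> by simp
      then show "\<forall>\<^sub>F n in sequentially. dist (?t n) 0 < \<epsilon>"
      proof eventually_elim
        case (elim n)
        then show ?case using le[of n] t0[of n] by simp
      qed
    qed
  qed
qed

text \<open>Couplings that are optimal up to \<open>1 / real (Suc n)\<close> are used twice:
  bicausality gives convergence of the quantile processes in probability, and then, for
  \<open>1 \<le> p\<close>, the small cost transports uniform integrability coordinate by
  coordinate.\<close>

proposition Lp_dist_tendsto_of_AW:
  assumes p: "p \<in> {0} \<union> {1..}" and \<mu>: "\<mu> \<in> P_space p N" and \<nu>: "\<And>n. \<nu> n \<in> P_space p N"
    and AW: "(\<lambda>n. AW p N \<mu> (\<nu> n)) \<longlonglongrightarrow> 0"
  shows "(\<lambda>n. Qproc_dist p N \<mu> (\<nu> n)) \<longlonglongrightarrow> 0"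
proof -
  let ?cost = "\<lambda>\<pi>. \<integral>z. cost p N (fst z) (snd z) \<partial>\<pi>"
  let ?Q = "Qproc N \<mu>" and ?Qn = "\<lambda>n. Qproc N (\<nu> n)"
  let ?t = "\<lambda>n. \<integral>u. trunc_dist N (?Q u) (?Qn n u) \<partial>lambdaN N"
  let ?c = "\<lambda>n. \<integral>u. cost p N (?Q u) (?Qn n u) \<partial>lambdaN N"
  have "\<exists>\<pi>\<in>bicausal N \<mu> (\<nu> n). p_root p (?cost \<pi>) < AW p N \<mu> (\<nu> n) + 1 / real (Suc n)" for n
  proof -
    have "Inf ((\<lambda>\<pi>. p_root p (?cost \<pi>)) ` bicausal N \<mu> (\<nu> n)) < AW p N \<mu> (\<nu> n) + 1 / real (Suc n)"
      by (simp add: AW_def)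
    from cInf_lessD[OF _ this] bicausal_Qproc[OF \<mu> \<nu>[of n]] show ?thesis by auto
  qed
  then obtain \<pi> where \<pi>: "\<And>n. \<pi> n \<in> bicausal N \<mu> (\<nu> n)"
    and \<pi>_less: "\<And>n. p_root p (?cost (\<pi> n)) < AW p N \<mu> (\<nu> n) + 1 / real (Suc n)"
    by metis
  have \<mu>': "prob_space \<mu>" "sets \<mu> = sets (RN N)" and \<nu>': "prob_space (\<nu> n)" "sets (\<nu> n) = sets (RN N)" for n
    using \<mu> \<nu>[of n] by (auto simp: P_space_def)
  note marg = bicausal_marginals[OF \<pi> \<mu>'(1) \<mu>'(2) \<nu>'(2)]
  have mom: "moment p N (\<pi> n) fst" "moment p N (\<pi> n) snd" for n
    using marg(5,6)[of n] \<mu> \<nu>[of n] by (auto intro!: moment_distr simp: marg(2,3))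
  have cost0: "0 \<le> ?cost (\<pi> n)" for n by (intro integral_nonneg_AE) (simp add: cost_nonneg)
  have "(\<lambda>n. AW p N \<mu> (\<nu> n) + 1 / real (Suc n)) \<longlonglongrightarrow> 0 + 0"
    using LIMSEQ_inverse_real_of_nat by (intro tendsto_add AW) (simp add: inverse_eq_divide)
  then have upper: "(\<lambda>n. AW p N \<mu> (\<nu> n) + 1 / real (Suc n)) \<longlonglongrightarrow> 0" by simp
  have "(\<lambda>n. p_root p (?cost (\<pi> n))) \<longlonglongrightarrow> 0"
  proof (rule tendsto_sandwich[OF always_eventually always_eventually tendsto_const upper]; intro allI)
    show "0 \<le> p_root p (?cost (\<pi> n))" for n by (rule p_root_nonneg[OF cost0])
    show "p_root p (?cost (\<pi> n)) \<le> AW p N \<mu> (\<nu> n) + 1 / real (Suc n)" for n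
      using \<pi>_less[of n] by (rule less_imp_le)
  qed
  then have cost_lim: "(\<lambda>n. ?cost (\<pi> n)) \<longlonglongrightarrow> 0"
    using tendsto_p_root_zero_iff[OF p, of "\<lambda>n. ?cost (\<pi> n)"] cost0 by simp
  have trunc_lim: "?t \<longlonglongrightarrow> 0"
  proof (rule tendsto_trunc_dist_quantile_processes[OF quantile_process_Qproc[OF \<mu>] quantile_process_Qproc[OF \<nu>]])
    show "\<pi> n \<in> bicausal N (law N ?Q) (law N (?Qn n))" for n
      using \<pi>[of n] by (simp add: distr_Qproc[OF \<mu>] distr_Qproc[OF \<nu>])
    show "(\<lambda>n. \<integral>z. trunc_dist N (fst z) (snd z) \<partial>\<pi> n) \<longlonglongrightarrow> 0"
      by (rule tendsto_trunc_dist_of_cost[OF p marg(4) mom cost_lim])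
  qed simp
  note momQ = moment_Qproc[OF \<mu>] moment_Qproc[OF \<nu>]
  note Qm = quantile_processD(2)[OF quantile_process_Qproc[OF \<mu>]] quantile_processD(2)[OF quantile_process_Qproc[OF \<nu>]]
  have "?c \<longlonglongrightarrow> 0"
  proof (cases "p = 0")
    case True
    have "?c n \<le> ?t n" for n
      using lN.integrable_cost[OF p momQ(1) momQ(2)[of n]] lN.integrable_trunc_dist[OF Qm order_refl, of n]
      by (intro integral_mono) (auto simp: True cost_zero_le_trunc_dist)
    then show ?thesis
      by (intro tendsto_sandwich[OF _ _ tendsto_const trunc_lim])
        (auto intro!: always_eventually integral_nonneg_AE simp: cost_nonneg)
  next
    case False
    then have p1: "1 \<le> p" using p by auto
    let ?q = "\<lambda>i n. \<integral>u. \<bar>?Q u i - ?Qn n u i\<bar> powr p \<partial>lambdaN N"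
    let ?z = "\<lambda>i n. \<integral>z. \<bar>fst z i - snd z i\<bar> powr p \<partial>\<pi> n"
    let ?m = "\<lambda>i n. \<integral>u. min \<bar>?Q u i - ?Qn n u i\<bar> 1 \<partial>lambdaN N"
    have comp: "?q i \<longlonglongrightarrow> 0" if i: "i < N" for i
    proof (rule lN.tendsto_Lp_of_tendsto_min_dist[where P=\<pi> and U="\<lambda>n z. fst z i" and V="\<lambda>n z. snd z i", OF p1])
      have pi: "(\<lambda>x. x i) \<in> borel_measurable (RN N)" using i by simp
      show "(\<lambda>u. ?Q u i) \<in> borel_measurable (lambdaN N)" "(\<lambda>u. ?Qn n u i) \<in> borel_measurable (lambdaN N)"
        "(\<lambda>z. fst z i) \<in> borel_measurable (\<pi> n)" "(\<lambda>z. snd z i) \<in> borel_measurable (\<pi> n)" for n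
        using Qm marg(5,6)[of n] i by (auto intro: measurable_coordinate)
      show "distr (\<pi> n) borel (\<lambda>z. fst z i) = distr (lambdaN N) borel (\<lambda>u. ?Q u i)"
        "distr (\<pi> n) borel (\<lambda>z. snd z i) = distr (lambdaN N) borel (\<lambda>u. ?Qn n u i)" for n
        using distr_distr[OF pi marg(5)[of n]] distr_distr[OF pi marg(6)[of n]] distr_distr[OF pi Qm(1)] distr_distr[OF pi Qm(2)[of n]]
        by (simp_all add: marg(2,3) distr_Qproc[OF \<mu>] distr_Qproc[OF \<nu>] comp_def)
      show "integrable (lambdaN N) (\<lambda>u. \<bar>?Q u i\<bar> powr p)" "integrable (lambdaN N) (\<lambda>u. \<bar>?Qn n u i\<bar> powr p)" for n
        using momQ(1) momQ(2)[of n] i False by (auto simp: moment_def)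
      show "?z i \<longlonglongrightarrow> 0"
      proof (rule tendsto_sandwich[OF _ _ tendsto_const cost_lim])
        have "?z i n \<le> ?cost (\<pi> n)" for n
        proof (rule integral_mono)
          show "integrable (\<pi> n) (\<lambda>z. \<bar>fst z i - snd z i\<bar> powr p)"
            using mom[of n] i p1 False by (intro integrable_powr_dist measurable_coordinate) (auto simp: moment_def)
          show "integrable (\<pi> n) (\<lambda>z. cost p N (fst z) (snd z))"
            by (rule prob_space.integrable_cost[OF marg(4) p mom])
          show "\<bar>fst z i - snd z i\<bar> powr p \<le> cost p N (fst z) (snd z)" for z
            using i False unfolding cost_def by (auto intro!: member_le_sum[of i _ "\<lambda>i. \<bar>fst z i - snd z i\<bar> powr p"])
        qed
        then show "\<forall>\<^sub>F n in sequentially. ?z i n \<le> ?cost (\<pi> n)"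
          by (intro always_eventually allI)
      qed (auto intro!: always_eventually integral_nonneg_AE)
      show "?m i \<longlonglongrightarrow> 0"
      proof (rule tendsto_sandwich[OF _ _ tendsto_const trunc_lim])
        have "?m i n \<le> ?t n" for n
        proof (rule integral_mono)
          show "integrable (lambdaN N) (\<lambda>u. min \<bar>?Q u i - ?Qn n u i\<bar> 1)"
            using measurable_coordinate[OF Qm(1) i] measurable_coordinate[OF Qm(2)[of n] i]
            by (intro lN.integrable_const_bound[where B=1]) auto
        qed (use i lN.integrable_trunc_dist[OF Qm order_refl] in \<open>auto intro: trunc_dist_component\<close>)
        then show "\<forall>\<^sub>F n in sequentially. ?m i n \<le> ?t n"
          by (intro always_eventually allI)
      qed (auto intro!: always_eventually integral_nonneg_AE)
    qed
    have "(\<lambda>n. \<Sum>i<N. ?q i n) \<longlonglongrightarrow> (\<Sum>i<N. 0)"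
      using comp by (intro tendsto_sum) auto
    moreover have "?c n = (\<Sum>i<N. ?q i n)" for n
    proof -
      have "integrable (lambdaN N) (\<lambda>u. \<bar>?Q u i - ?Qn n u i\<bar> powr p)" if "i < N" for i
        using that momQ(1) momQ(2)[of n] p1 False by (intro integrable_powr_dist measurable_coordinate) (auto simp: moment_def)
      then show ?thesis
        using False unfolding cost_def by (simp add: Bochner_Integration.integral_sum)
    qed
    ultimately show ?thesis by simp
  qed
  then show ?thesis
    unfolding Lp_dist_def by (subst tendsto_p_root_zero_iff[OF p]) (auto intro!: integral_nonneg_AE simp: cost_nonneg)
qed

text \<open>Counterexamples for the radii \<open>1 / real (Suc n)\<close> would form a sequence
  contradicting the sequential statement. The argument gives no rate, and the radius depends on the
  centre \<mu>.\<close>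

lemma Lp_dist_small_of_AW_small:
  assumes p: "p \<in> {0} \<union> {1..}" and \<mu>: "\<mu> \<in> P_space p N" and s: "0 < s"
  shows "\<exists>r>0. \<forall>\<nu>\<in>P_space p N. AW p N \<mu> \<nu> < r \<longrightarrow> Qproc_dist p N \<mu> \<nu> < s"
proof (rule ccontr)
  assume *: "\<not> ?thesis"
  have "\<exists>\<nu>\<in>P_space p N. AW p N \<mu> \<nu> < 1 / real (Suc n) \<and> s \<le> Qproc_dist p N \<mu> \<nu>" for n
    using *[simplified, rule_format, of "1 / real (Suc n)"] by (force simp: not_less)
  then obtain \<nu> where \<nu>: "\<And>n. \<nu> n \<in> P_space p N" "\<And>n. AW p N \<mu> (\<nu> n) < 1 / real (Suc n)"
    and far: "\<And>n. s \<le> Qproc_dist p N \<mu> (\<nu> n)"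
    by metis
  have "(\<lambda>n. AW p N \<mu> (\<nu> n)) \<longlonglongrightarrow> 0"
  proof (rule tendsto_sandwich[OF _ _ tendsto_const])
    show "(\<lambda>n. 1 / real (Suc n)) \<longlonglongrightarrow> 0"
      using LIMSEQ_inverse_real_of_nat by (simp add: inverse_eq_divide)
  qed (auto intro!: always_eventually less_imp_le[OF \<nu>(2)] AW_nonneg \<mu> \<nu>(1) simp del: of_nat_Suc)
  from order_tendstoD(2)[OF Lp_dist_tendsto_of_AW[OF p \<mu> \<nu>(1) this] s] far show False
    by (auto simp: eventually_sequentially not_less[symmetric])
qed

section \<open>Open sets of the adapted weak topology\<close>

abbreviation (input) AW_ball :: "real \<Rightarrow> nat \<Rightarrow> (nat \<Rightarrow> real) measure \<Rightarrow> real \<Rightarrow> (nat \<Rightarrow> real) measure set" where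
  "AW_ball p N \<mu> r \<equiv> {\<nu> \<in> P_space p N. AW p N \<mu> \<nu> < r}"

text \<open>The family is a topology for any function in place of \<open>AW\<close>, intersections
  being handled by the smaller radius. It does not follow that the balls themselves are open, so
  convergence has to be tested on other open sets.\<close>

lemma openin_adapted_weak_topology:
  "openin (adapted_weak_topology p N) U \<longleftrightarrow>
    U \<subseteq> P_space p N \<and> (\<forall>\<mu>\<in>U. \<exists>r>0. AW_ball p N \<mu> r \<subseteq> U)"
proof -
  let ?P = "\<lambda>U. U \<subseteq> P_space p N \<and> (\<forall>\<mu>\<in>U. \<exists>r>0. AW_ball p N \<mu> r \<subseteq> U)"
  have "istopology ?P"
    unfolding istopology_def
  proof (intro conjI allI impI ballI)
    fix S T \<mu> assume S: "?P S" and T: "?P T" and \<mu>: "\<mu> \<in> S \<inter> T"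
    then obtain r s where "0 < r" "AW_ball p N \<mu> r \<subseteq> S" "0 < s" "AW_ball p N \<mu> s \<subseteq> T"
      by blast
    then show "\<exists>r>0. AW_ball p N \<mu> r \<subseteq> S \<inter> T"
      by (intro exI[of _ "min r s"]) auto
  next
    fix \<K> \<mu> assume \<K>: "\<forall>K\<in>\<K>. ?P K" and "\<mu> \<in> \<Union>\<K>"
    then obtain K where "K \<in> \<K>" "\<mu> \<in> K" by blast
    with \<K> obtain r where "0 < r" "AW_ball p N \<mu> r \<subseteq> K" by blast
    with \<open>K \<in> \<K>\<close> show "\<exists>r>0. AW_ball p N \<mu> r \<subseteq> \<Union>\<K>" by blast
  qed blast+
  then show ?thesis by (simp add: adapted_weak_topology_def)
qed

lemma openin_Lp_ball:
  assumes p: "p \<in> {0} \<union> {1..}" and \<mu>: "\<mu> \<in> P_space p N"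
  shows "openin (adapted_weak_topology p N) {\<nu> \<in> P_space p N. Qproc_dist p N \<mu> \<nu> < \<epsilon>}"
  unfolding openin_adapted_weak_topology
proof (intro conjI ballI)
  fix \<nu> assume "\<nu> \<in> {\<nu> \<in> P_space p N. Qproc_dist p N \<mu> \<nu> < \<epsilon>}"
  then have \<nu>: "\<nu> \<in> P_space p N" and d: "Qproc_dist p N \<mu> \<nu> < \<epsilon>" by auto
  \<comment> \<open>A third of the slack: one \<open>s\<close> makes the bound on the first leg
    strict, one bounds the second leg, and the last keeps the final inequality strict.\<close>
  define s where "s = (\<epsilon> - Qproc_dist p N \<mu> \<nu>) / 3"
  have s: "0 < s" using d by (simp add: s_def)
  obtain r where r: "0 < r" "\<And>\<rho>. \<rho> \<in> P_space p N \<Longrightarrow> AW p N \<nu> \<rho> < r \<Longrightarrow> Qproc_dist p N \<nu> \<rho> < s"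
    using Lp_dist_small_of_AW_small[OF p \<nu> s] by blast
  show "\<exists>r>0. AW_ball p N \<nu> r \<subseteq> {\<nu> \<in> P_space p N. Qproc_dist p N \<mu> \<nu> < \<epsilon>}"
  proof (intro exI[of _ r] conjI r(1) subsetI CollectI)
    fix \<rho> assume "\<rho> \<in> AW_ball p N \<nu> r"
    then have \<rho>: "\<rho> \<in> P_space p N" "AW p N \<nu> \<rho> < r" by auto
    have "Qproc_dist p N \<mu> \<rho> \<le> (Qproc_dist p N \<mu> \<nu> + s) + s"
      using s r(2)[OF \<rho>] Lp_dist_nonneg[of p N "Qproc N \<mu>" "Qproc N \<nu>"]
      by (intro Lp_dist_triangle[OF p moment_Qproc[OF \<mu>] moment_Qproc[OF \<nu>] moment_Qproc[OF \<rho>(1)]]) auto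
    also have "\<dots> < \<epsilon>" using s by (simp add: s_def field_simps)
    finally show "Qproc_dist p N \<mu> \<rho> < \<epsilon>" .
    show "\<rho> \<in> P_space p N" by (rule \<rho>(1))
  qed
qed blast

theorem corollary1p6:
  fixes N :: nat and p :: real
    and \<mu> :: "(nat \<Rightarrow> real) measure" and \<mu>n :: "nat \<Rightarrow> (nat \<Rightarrow> real) measure"
  assumes "p \<in> {0} \<union> {1..}"
    and "\<mu> \<in> P_space p N"
    and "\<And>n. \<mu>n n \<in> P_space p N"
  shows "limitin (adapted_weak_topology p N) \<mu>n \<mu> sequentially \<longleftrightarrow>
    (\<lambda>n. Lp_dist p N (Qproc N (\<mu>n n)) (Qproc N \<mu>)) \<longlonglongrightarrow> 0"
proof
  assume lim: "limitin (adapted_weak_topology p N) \<mu>n \<mu> sequentially"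
  show "(\<lambda>n. Lp_dist p N (Qproc N (\<mu>n n)) (Qproc N \<mu>)) \<longlonglongrightarrow> 0"
  proof (rule tendstoI)
    fix \<epsilon> :: real assume \<epsilon>: "0 < \<epsilon>"
    let ?U = "{\<nu> \<in> P_space p N. Qproc_dist p N \<mu> \<nu> < \<epsilon>}"
    have "\<mu> \<in> ?U" using \<epsilon> assms(2) by (simp add: Lp_dist_self)
    with lim openin_Lp_ball[OF assms(1,2), of \<epsilon>] have "\<forall>\<^sub>F n in sequentially. \<mu>n n \<in> ?U"
      unfolding limitin_def by blast
    then show "\<forall>\<^sub>F n in sequentially. dist (Lp_dist p N (Qproc N (\<mu>n n)) (Qproc N \<mu>)) 0 < \<epsilon>"
      by eventually_elim (simp add: Lp_dist_commute[of p N _ "Qproc N \<mu>"] Lp_dist_nonneg)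
  qed
next
  assume conv: "(\<lambda>n. Lp_dist p N (Qproc N (\<mu>n n)) (Qproc N \<mu>)) \<longlonglongrightarrow> 0"
  show "limitin (adapted_weak_topology p N) \<mu>n \<mu> sequentially"
    unfolding limitin_def
  proof (intro conjI allI impI)
    have "openin (adapted_weak_topology p N) (P_space p N)"
      unfolding openin_adapted_weak_topology by (auto intro: exI[of _ 1])
    then show "\<mu> \<in> topspace (adapted_weak_topology p N)"
      using assms(2) openin_subset by blast
    fix U assume U: "openin (adapted_weak_topology p N) U \<and> \<mu> \<in> U"
    then obtain r where r: "0 < r" "AW_ball p N \<mu> r \<subseteq> U"
      unfolding openin_adapted_weak_topology by blast
    from order_tendstoD(2)[OF conv r(1)] show "\<forall>\<^sub>F n in sequentially. \<mu>n n \<in> U"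
    proof eventually_elim
      case (elim n)
      then have "AW p N \<mu> (\<mu>n n) < r"
        using AW_le_Lp_dist[OF assms(2) assms(3)[of n]] by (simp add: Lp_dist_commute[of p N "Qproc N \<mu>"])
      with r(2) assms(3)[of n] show ?case by blast
    qed
  qed
qed

end
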